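(* Let $1\le p<\infty$. Assume that the metric measure space $X=(X,d,\mu)$ is complete, that $\mu$ is doubling, and that $X$ supports a $p$-Poincaré inequality. Then every $p$-path open set $U\subset X$ is quasiopen (and in particular measurable).
   Context: Setting: $1\le p<\infty$, and $X=(X,d,\mu)$ is a metric space with metric $d$ and a positive complete Borel measure $\mu$ such that $\mu(B)<\infty$ for all open balls $B\subset X$. Write $B(x_0,r)=\{x\in X:d(x,x_0)<r\}$ and, for $B=B(x_0,r)$ and $\delta>0$, $\delta B=B(x_0,\delta r)$. Curves: a curve is a continuous mapping from an interval. Only compact rectifiable curves are considered; they are nonconstant unless otherwise stated and parameterized by arc length $ds$, so $\gamma:[0,l_\gamma]\to X$ with $l_\gamma$ the length of $\gamma$. A property holds for $p$-almost every ($p$-a.e.) curve if it fails only for a curve family $\Gamma$ for which there is a nonnegative Borel function $\rho\in L^p(X)$ with $\int_\gamma\rho\,ds=\infty$ for every $\gamma\in\Gamma$. Upper gradients: a nonnegative Borel function $g$ on $X$ is an upper gradient of $f:X\to[-\infty,\infty]$ if $|f(\gamma(0))-f(\gamma(l_\gamma))|\le\int_\gamma g\,ds$ for all nonconstant compact rectifiable curves $\gamma:[0,l_\gamma]\to X$, where the left-hand side is $\infty$ whenever at least one of its terms is infinite. Newtonian space and capacity: for measurable $f:X\to[-\infty,\infty]$ (defined everywhere), $\|f\|_{N^{1,p}(X)}=\bigl(\int_X|f|^p\,d\mu+\inf_g\int_X g^p\,d\mu\bigr)^{1/p}$, with infimum over all upper gradients $g$ of $f$, and $N^{1,p}(X)=\{f:\|f\|_{N^{1,p}(X)}<\infty\}$.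 For $E\subset X$, $C_p(E)=\inf_u\|u\|_{N^{1,p}(X)}^p$, the infimum being over all $u\in N^{1,p}(X)$ with $u\ge1$ on $E$. Doubling: there is $C>0$ such that $0<\mu(2B)\le C\mu(B)<\infty$ for all balls $B$. $p$-Poincaré inequality: there are constants $C>0$ and $\lambda\ge1$ such that for all balls $B\subset X$, all integrable functions $f$ on $X$ and all upper gradients $g$ of $f$, $$\frac1{\mu(B)}\int_B|f-f_B|\,d\mu\le C\,\mathrm{diam}(B)\Bigl(\frac1{\mu(\lambda B)}\int_{\lambda B}g^p\,d\mu\Bigr)^{1/p},\qquad f_B=\frac1{\mu(B)}\int_B f\,d\mu.$$ A set $U\subset X$ is quasiopen if for every $\varepsilon>0$ there is an open set $G\subset X$ with $C_p(G)<\varepsilon$ and $G\cup U$ open. A set $U\subset X$ is $p$-path open if for $p$-a.e. curve $\gamma:[0,l_\gamma]\to X$ the set $\gamma^{-1}(U)$ is relatively open in $[0,l_\gamma]$. (No measurability of $U$ is assumed in this definition.) *)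

theory Defs
  imports "HOL-Analysis.Analysis"
begin

text \<open>
  A metric space carrying a complete Borel measure that is finite on balls. ``Borel measure'' means
  that every Borel set is measurable; the sigma-algebra may be larger (it must be, by completeness).
\<close>

locale metric_measure_space = complete_measure M
  for M :: "'a::metric_space measure" +
  assumes borel_sets: "sets borel \<subseteq> sets M"
    and ball_finite: "emeasure M (ball x r) < \<infinity>"

text \<open>The power \<open>x\<^sup>a\<close> of an extended nonnegative real, meant for exponents \<open>a > 0\<close>.\<close>

definition epowr :: "ennreal \<Rightarrow> real \<Rightarrow> ennreal" where
  "epowr x a = (if x = \<infinity> then \<infinity> else ennreal (enn2real x powr a))"


subsection \<open>Curves\<close>

definition curve_length :: "(real \<Rightarrow> 'a::metric_space) \<Rightarrow> real \<Rightarrow> real \<Rightarrow> ennreal" where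
  "curve_length \<gamma> a b =
     (SUP (n, t) \<in> {(n::nat, t::nat \<Rightarrow> real). t 0 = a \<and> t n = b \<and> mono_on {..n} t}.
        \<Sum>i<n. ennreal (dist (\<gamma> (t i)) (\<gamma> (t (Suc i)))))"

text \<open>
  Nonconstant compact rectifiable curves \<open>\<gamma> : [0, l] \<rightarrow> X\<close> parameterized by arc length.
  The values of \<open>\<gamma>\<close> outside of \<open>{0..l}\<close> are irrelevant, here and below. Rectifiability and
  the fact that \<open>l\<close> is the length of \<open>\<gamma>\<close> are the case \<open>s = 0\<close>, \<open>t = l\<close> of the last condition.
\<close>

definition arc_curve :: "(real \<Rightarrow> 'a::metric_space) \<Rightarrow> real \<Rightarrow> bool" where
  "arc_curve \<gamma> l \<longleftrightarrow>
     continuous_on {0..l} \<gamma> \<and> \<not> \<gamma> constant_on {0..l} \<and>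
     (\<forall>s t. 0 \<le> s \<and> s \<le> t \<and> t \<le> l \<longrightarrow> curve_length \<gamma> s t = ennreal (t - s))"

definition curve_integral :: "('a \<Rightarrow> ennreal) \<Rightarrow> (real \<Rightarrow> 'a) \<Rightarrow> real \<Rightarrow> ennreal" where
  "curve_integral \<rho> \<gamma> l = (\<integral>\<^sup>+ t\<in>{0..l}. \<rho> (\<gamma> t) \<partial>lborel)"

definition exceptional :: "real \<Rightarrow> 'a::metric_space measure \<Rightarrow> ((real \<Rightarrow> 'a) \<times> real) set \<Rightarrow> bool" where
  "exceptional p M \<Gamma> \<longleftrightarrow>
     (\<exists>\<rho> \<in> borel_measurable borel. (\<integral>\<^sup>+ x. epowr (\<rho> x) p \<partial>M) < \<infinity> \<and>
        (\<forall>(\<gamma>, l) \<in> \<Gamma>. curve_integral \<rho> \<gamma> l = \<infinity>))"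

definition ae_curve :: "real \<Rightarrow> 'a::metric_space measure \<Rightarrow> ((real \<Rightarrow> 'a) \<Rightarrow> real \<Rightarrow> bool) \<Rightarrow> bool" where
  "ae_curve p M P \<longleftrightarrow> exceptional p M {(\<gamma>, l). arc_curve \<gamma> l \<and> \<not> P \<gamma> l}"


subsection \<open>Upper gradients, Newtonian functions and capacity\<close>

definition upper_gradient :: "('a::metric_space \<Rightarrow> ennreal) \<Rightarrow> ('a \<Rightarrow> ereal) \<Rightarrow> bool" where
  "upper_gradient g f \<longleftrightarrow>
     g \<in> borel_measurable borel \<and>
     (\<forall>\<gamma> l. arc_curve \<gamma> l \<longrightarrow>
        (if \<bar>f (\<gamma> 0)\<bar> = \<infinity> \<or> \<bar>f (\<gamma> l)\<bar> = \<infinity> then \<infinity> else e2ennreal \<bar>f (\<gamma> 0) - f (\<gamma> l)\<bar>)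
          \<le> curve_integral g \<gamma> l)"

definition newtonian_norm :: "real \<Rightarrow> 'a::metric_space measure \<Rightarrow> ('a \<Rightarrow> ereal) \<Rightarrow> ennreal" where
  "newtonian_norm p M f =
     epowr ((\<integral>\<^sup>+ x. epowr (e2ennreal \<bar>f x\<bar>) p \<partial>M) +
            (INF g \<in> {g. upper_gradient g f}. \<integral>\<^sup>+ x. epowr (g x) p \<partial>M)) (1 / p)"

definition newtonian_space :: "real \<Rightarrow> 'a::metric_space measure \<Rightarrow> ('a \<Rightarrow> ereal) set" where
  "newtonian_space p M = {f \<in> borel_measurable M. newtonian_norm p M f < \<infinity>}"

definition capacity :: "real \<Rightarrow> 'a::metric_space measure \<Rightarrow> 'a set \<Rightarrow> ennreal" where
  "capacity p M E =
     (INF u \<in> {u \<in> newtonian_space p M. \<forall>x\<in>E. 1 \<le> u x}. epowr (newtonian_norm p M u) p)"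


subsection \<open>Standing assumptions on the space\<close>

definition doubling :: "'a::metric_space measure \<Rightarrow> bool" where
  "doubling M \<longleftrightarrow>
     (\<exists>C::real. C > 0 \<and>
        (\<forall>x r. r > 0 \<longrightarrow>
           0 < emeasure M (ball x (2 * r)) \<and>
           emeasure M (ball x (2 * r)) \<le> ennreal C * emeasure M (ball x r) \<and>
           ennreal C * emeasure M (ball x r) < \<infinity>))"

text \<open>
  The functions \<open>f\<close> take values in \<open>[-\<infinity>, \<infinity>]\<close>, as for upper gradients. An integrable \<open>f\<close> is finite
  almost everywhere, so \<open>real_of_ereal\<close> does not affect the mean value over the ball.
\<close>

definition poincare_inequality :: "real \<Rightarrow> 'a::metric_space measure \<Rightarrow> bool" where
  "poincare_inequality p M \<longleftrightarrow>
     (\<exists>(C::real) (L::real). C > 0 \<and> L \<ge> 1 \<and>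
        (\<forall>z r f g.
           r > 0 \<and> f \<in> borel_measurable M \<and> (\<integral>\<^sup>+ x. e2ennreal \<bar>f x\<bar> \<partial>M) < \<infinity> \<and>
           upper_gradient g f \<longrightarrow>
           (let B = ball z r; LB = ball z (L * r);
                f\<^sub>B = (LINT x:B|M. real_of_ereal (f x)) / measure M B
            in (\<integral>\<^sup>+ x\<in>B. e2ennreal \<bar>f x - ereal f\<^sub>B\<bar> \<partial>M) / emeasure M B
                 \<le> ennreal (C * diameter B) *
                   epowr ((\<integral>\<^sup>+ x\<in>LB. epowr (g x) p \<partial>M) / emeasure M LB) (1 / p))))"


subsection \<open>Quasiopen and path open sets\<close>

definition quasiopen :: "real \<Rightarrow> 'a::metric_space measure \<Rightarrow> 'a set \<Rightarrow> bool" where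
  "quasiopen p M U \<longleftrightarrow>
     (\<forall>\<epsilon>::real. \<epsilon> > 0 \<longrightarrow> (\<exists>G. open G \<and> capacity p M G < ennreal \<epsilon> \<and> open (G \<union> U)))"

definition path_open :: "real \<Rightarrow> 'a::metric_space measure \<Rightarrow> 'a set \<Rightarrow> bool" where
  "path_open p M U \<longleftrightarrow>
     ae_curve p M (\<lambda>\<gamma> l. openin (top_of_set {0..l}) {t \<in> {0..l}. \<gamma> t \<in> U})"

end

theory Submission
  imports Defs "HOL-Library.Diagonal_Subsequence"
begin

text \<open>
  Enlarging the function that witnesses path openness, by Vitali--Caratheodory we get
  \<open>w = \<rho> + 1\<close> with \<open>\<rho> \<in> L\<^sup>p\<close> a supremum of continuous functions, such that \<open>U\<close> is relatively
  open along every curve on which \<open>w\<close> is integrable. Let \<open>f x\<close> be the minimum of 1 and the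
  infimum of \<open>\<integral>\<^sub>\<gamma> w\<close> over the curves \<open>\<gamma>\<close> from \<open>x\<close> to the complement of \<open>U\<close>. Then \<open>U = {f > 0}\<close>:
  if \<open>f x = 0\<close> for some \<open>x \<in> U\<close>, then running back and forth along curves of rapidly decreasing
  \<open>w\<close>-length gives one curve with finite \<open>w\<close>-integral along which \<open>U\<close> is not open at \<open>x\<close>.

  Let \<open>V\<close> be the union of the balls on which the mean of \<open>\<rho>\<^sup>p\<close> exceeds \<open>k\<close>; then \<open>k \<mu>(V) \<rightarrow> 0\<close> as
  \<open>k \<rightarrow> \<infinity>\<close>. Two points \<open>x\<close>, \<open>y\<close> outside \<open>V\<close> are joined by a curve with \<open>\<integral>\<^sub>\<gamma> w \<le> L d(x,y)\<close>,
  where \<open>L\<close> is a multiple of \<open>k powr (1/p)\<close>: the Poincare inequality, applied to infima of discrete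
  sums over chains of small step size, bounds these sums, and the chains converge to a curve since
  \<open>X\<close> is proper. Hence \<open>f\<close> is \<open>L\<close>-Lipschitz off \<open>V\<close>; let \<open>F\<close> be a Lipschitz extension.
  If \<open>v\<close> is the \<open>(w + L)\<close>-distance to the complement of \<open>V\<close>, truncated at 1 and again computed by
  chains, then \<open>\<bar>f - F\<bar> \<le> v\<close>, \<open>v\<close> is lower semicontinuous and \<open>(w + L) 1\<^sub>V\<close> is an upper gradient
  of \<open>v\<close>, so that the open sets \<open>{v > s}\<close> have small capacity. Off a countable union of such sets,
  \<open>f\<close> is a uniform limit of continuous functions.
\<close>

section \<open>Powers of extended nonnegative reals and the Vitali--Caratheodory theorem\<close>

text \<open>The Poincare inequality speaks about measurable functions, and an infimum over curves is
  not visibly measurable. Chains get around this: for a continuous weight their infimum is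
  continuous, since a jump shorter than the step size is always admissible, and the weight is an
  upper gradient of it. Curves return only as the step size tends to 0; there lower semicontinuity
  of \<open>w\<close> lets Fatou's lemma bound the integral along the limit, which is why
  \<open>\<rho>\<close> is first made a supremum of continuous functions. The summand 1 in
  \<open>w\<close> bounds lengths by integrals; this gives compactness of the chains and makes the
  back-and-forth curve rectifiable.

  The decisive balance is the energy of \<open>v\<close>. Since \<open>L powr p\<close> is of order
  \<open>k\<close>, the integral of \<open>(w + L) powr p\<close> over \<open>V\<close> is
  controlled by the integral of \<open>\<rho> powr p\<close> over \<open>V\<close> (in the code, of
  \<open>weight h\<close>) plus \<open>k\<close> times the measure of \<open>V\<close>. A plain weak
  type estimate would only bound the second term; charging only the values of
  \<open>\<rho> powr p\<close> above \<open>k / 2\<close> makes both tend to 0.\<close>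

lemma epowr_top [simp]: "epowr \<infinity> a = \<infinity>" "epowr top a = top"
  by (simp_all add: epowr_def)

lemma epowr_ennreal: "0 \<le> x \<Longrightarrow> epowr (ennreal x) a = ennreal (x powr a)"
  by (simp add: epowr_def)

lemma epowr_0 [simp]: "epowr 0 a = 0"
  using epowr_ennreal[of 0 a] by simp

lemma epowr_mono:
  assumes "x \<le> y" "0 \<le> a"
  shows "epowr x a \<le> epowr y a"
proof (cases y)
  case (real r)
  then obtain s where "0 \<le> s" "x = ennreal s" "s \<le> r"
    using assms by (cases x) (auto simp: top_unique)
  then show ?thesis
    using real assms by (auto simp: epowr_ennreal intro!: ennreal_leI powr_mono2)
qed simp

lemma epowr_mult:
  assumes "0 < c" 
  shows "epowr (ennreal c * x) a = ennreal (c powr a) * epowr x a"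
proof (cases x)
  case (real r)
  then show ?thesis using assms
    by (simp add: epowr_ennreal powr_mult flip: ennreal_mult)
next
  case top
  then show ?thesis using assms by (simp add: ennreal_mult_top)
qed

lemma epowr_epowr_inverse:
  assumes "0 < p"
  shows "epowr (epowr x (1 / p)) p = x"
proof (cases x)
  case (real r)
  then show ?thesis using assms by (simp add: epowr_ennreal powr_powr)
qed simp

text \<open>The sum is at most twice the larger summand. The crude factor works for every
  \<open>a \<ge> 0\<close>, so one bound serves for \<open>p\<close> as well as for
  \<open>1 / p\<close>.\<close>

lemma epowr_add_le:
  assumes "0 \<le> a"
  shows "epowr (x + y) a \<le> ennreal (2 powr a) * (epowr x a + epowr y a)"
proof -
  have *: "epowr (x + y) a \<le> ennreal (2 powr a) * epowr y a" if "x \<le> y" for x y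
  proof -
    have "epowr (x + y) a \<le> epowr (ennreal 2 * y) a"
      using that by (intro epowr_mono assms) (simp add: mult_2 add_right_mono)
    also have "\<dots> = ennreal (2 powr a) * epowr y a" by (rule epowr_mult) simp
    finally show ?thesis .
  qed
  show ?thesis
  proof (cases "x \<le> y")
    case True
    show ?thesis using *[OF True] by (rule order_trans) (simp add: mult_left_mono)
  next
    case False
    then have "epowr (y + x) a \<le> ennreal (2 powr a) * epowr x a" by (intro *) simp
    then show ?thesis unfolding add.commute[of y x]
      by (rule order_trans) (simp add: mult_left_mono)
  qed
qed

lemma measurable_epowr [measurable]:
  "f \<in> borel_measurable N \<Longrightarrow> (\<lambda>x. epowr (f x) a) \<in> borel_measurable N"
proof -
  assume [measurable]: "f \<in> borel_measurable N"
  show ?thesis unfolding epowr_def by measurable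
qed

text \<open>The power \<open>1 / a\<close> is a monotone inverse of the power \<open>a\<close>;
  applying it to an upper bound of the powers and going back gives the inequality that monotonicity
  alone does not.\<close>

lemma epowr_SUP:
  fixes f :: "nat \<Rightarrow> real"
  assumes "\<And>n. 0 \<le> f n" "0 < a"
  shows "epowr (SUP n. ennreal (f n)) a = (SUP n. ennreal (f n powr a))"
proof (rule antisym)
  define S where "S = (SUP n. ennreal (f n powr a))"
  have "ennreal (f n) \<le> epowr S (1 / a)" for n
  proof -
    have "ennreal (f n) = epowr (ennreal (f n powr a)) (1 / a)"
      using assms by (simp add: epowr_ennreal powr_powr)
    also have "\<dots> \<le> epowr S (1 / a)"
      unfolding S_def using assms by (intro epowr_mono SUP_upper) auto
    finally show ?thesis .
  qed
  then have "epowr (SUP n. ennreal (f n)) a \<le> epowr (epowr S (1 / a)) a"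
    using assms by (intro epowr_mono SUP_least) auto
  then show "epowr (SUP n. ennreal (f n)) a \<le> S"
    using assms by (simp add: epowr_epowr_inverse)
  show "S \<le> epowr (SUP n. ennreal (f n)) a"
    unfolding S_def
  proof (rule SUP_least)
    fix n
    have "ennreal (f n powr a) = epowr (ennreal (f n)) a" using assms by (simp add: epowr_ennreal)
    also have "\<dots> \<le> epowr (SUP n. ennreal (f n)) a"
      using assms by (intro epowr_mono SUP_upper) auto
    finally show "ennreal (f n powr a) \<le> epowr (SUP n. ennreal (f n)) a" .
  qed
qed

section \<open>Regularity of the measure and lower semicontinuous majorants\<close>

context metric_measure_space begin

lemma space_UNIV [simp]: "space M = UNIV"
proof -
  have "UNIV \<in> sets M" using borel_sets sets.top[of borel] by auto
  then show ?thesis using sets.sets_into_space by blast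
qed

lemma borel_in_sets: "A \<in> sets borel \<Longrightarrow> A \<in> sets M"
  using borel_sets by blast

lemma open_in_sets: "open A \<Longrightarrow> A \<in> sets M"
  by (rule borel_in_sets) simp

lemma ball_in_sets [simp, measurable]: "ball x r \<in> sets M"
  by (rule open_in_sets) simp

lemma measurable_from_borel: "f \<in> measurable borel N \<Longrightarrow> f \<in> measurable M N"
  by (rule measurableI) (use borel_in_sets measurable_sets[of f borel N] measurable_space[of f borel N] in auto)

text \<open>Good sets principle on the sigma-algebra generated by the closed sets. Carrying an inner
  closed and an outer open set at once makes the complement step trivial: the two swap roles.
  Everything is confined to a ball, where the measure is known to be finite.\<close>

lemma closed_open_approximation:
  assumes "A \<in> sets borel" "0 < e"
  shows "\<exists>F G. closed F \<and> open G \<and> F \<subseteq> A \<and> A \<subseteq> G \<and> measure M ((G - F) \<inter> ball x r) \<le> e"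
proof -
  have fin: "emeasure M (B \<inter> ball x r) \<noteq> \<infinity>" if "B \<in> sets M" for B
    using emeasure_mono[of "B \<inter> ball x r" "ball x r" M] ball_finite[of x r] by (auto simp: top_unique)
  have "A \<in> sigma_sets UNIV (Collect closed)"
    using assms(1) by (simp add: borel_eq_closed)
  then show ?thesis using assms(2)
  proof (induction arbitrary: e)
    case (Basic A)
    show ?case
    \<comment> \<open>\<open>infdist y {}\<close> is 0, so the neighbourhoods \<open>G k\<close> of
      an empty set would be the whole space.\<close>
    proof (cases "A = {}")
      case True
      then show ?thesis using Basic by (intro exI[of _ "{}"]) auto
    next
      case False
      define G where "G k = {y. infdist y A < 1 / Suc k}" for k
      have op: "open (G k)" for k
        unfolding G_def by (intro open_Collect_less continuous_intros)
      have AG: "A \<subseteq> G k" for k unfolding G_def by auto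
      have int: "(\<Inter>k. (G k - A) \<inter> ball x r) = {}"
      proof -
        have "y \<in> A" if "\<forall>k. infdist y A < 1 / Suc k" for y
        proof -
          have "infdist y A \<le> 0"
          proof (rule ccontr)
            assume "\<not> infdist y A \<le> 0"
            then obtain n where "inverse (real (Suc n)) < infdist y A"
              using reals_Archimedean[of "infdist y A"] by auto
            with that[rule_format, of n] show False by (simp add: inverse_eq_divide)
          qed
          then show ?thesis
            using Basic False in_closed_iff_infdist_zero[of A y] infdist_nonneg[of y A] by auto
        qed
        then show ?thesis unfolding G_def by auto
      qed
      have "(\<lambda>k. measure M ((G k - A) \<inter> ball x r)) \<longlonglongrightarrow> measure M (\<Inter>k. (G k - A) \<inter> ball x r)"
      proof (rule Lim_measure_decseq)
        show "range (\<lambda>k. (G k - A) \<inter> ball x r) \<subseteq> sets M"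
          using op Basic by (auto intro!: sets.Int sets.Diff open_in_sets borel_in_sets[of A])
        show "decseq (\<lambda>k. (G k - A) \<inter> ball x r)"
        proof (rule decseq_SucI)
          fix k
          have "1 / real (Suc (Suc k)) \<le> 1 / real (Suc k)" by (simp add: field_simps)
          then have "G (Suc k) \<subseteq> G k" unfolding G_def by force
          then show "(G (Suc k) - A) \<inter> ball x r \<subseteq> (G k - A) \<inter> ball x r" by blast
        qed
        show "emeasure M ((G i - A) \<inter> ball x r) \<noteq> \<infinity>" for i
          using op Basic by (intro fin sets.Diff open_in_sets borel_in_sets[of A]) auto
      qed
      then have "(\<lambda>k. measure M ((G k - A) \<inter> ball x r)) \<longlonglongrightarrow> 0" unfolding int by simp
      from order_tendstoD(2)[OF this \<open>0 < e\<close>] obtain k where "measure M ((G k - A) \<inter> ball x r) < e"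
        unfolding eventually_sequentially by blast
      with op AG Basic show ?thesis by (intro exI[of _ A] exI[of _ "G k"]) auto
    qed
  next
    case Empty
    then show ?case by (intro exI[of _ "{}"]) auto
  next
    case (Compl A)
    then obtain F G where "closed F" "open G" "F \<subseteq> A" "A \<subseteq> G" "measure M ((G - F) \<inter> ball x r) \<le> e"
      by meson
    moreover have "- F - (- G) = G - F" by auto
    ultimately show ?case
      by (intro exI[of _ "- G"] exI[of _ "- F"]) (auto simp: closed_Compl open_Compl)
  next
    case (Union A)
    have "\<exists>F G. closed F \<and> open G \<and> F \<subseteq> A i \<and> A i \<subseteq> G \<and> measure M ((G - F) \<inter> ball x r) \<le> e / 4 * (1 / 2) ^ i" for i
      using Union(2)[of "e / 4 * (1 / 2) ^ i" i] Union(3) by simp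
    then obtain F G where FG: "\<And>i. closed (F i)" "\<And>i. open (G i)" "\<And>i. F i \<subseteq> A i" "\<And>i. A i \<subseteq> G i"
      "\<And>i. measure M ((G i - F i) \<inter> ball x r) \<le> e / 4 * (1 / 2) ^ i"
      by metis
    have meas[measurable]: "F i \<in> sets M" "G i \<in> sets M" for i
      using FG by (auto intro: open_in_sets borel_in_sets)
    have fm: "B \<inter> ball x r \<in> fmeasurable M" if "B \<in> sets M" for B
      using that fin[OF that] by (auto intro!: fmeasurableI simp: less_top)
    define R where "R = ((\<Union>i. G i) - (\<Union>i. F i)) \<inter> ball x r"
    have R: "measure M R \<le> e / 2"
    proof -
      have sm: "summable (\<lambda>i. e / 4 * (1 / 2 :: real) ^ i)" by (intro summable_mult summable_geometric) simp
      have "emeasure M R \<le> emeasure M (\<Union>i. (G i - F i) \<inter> ball x r)"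
        unfolding R_def by (intro emeasure_mono) auto
      also have "\<dots> \<le> (\<Sum>i. emeasure M ((G i - F i) \<inter> ball x r))"
        by (intro emeasure_subadditive_countably) auto
      also have "\<dots> \<le> (\<Sum>i. ennreal (e / 4 * (1 / 2) ^ i))"
        using FG(5) fm by (intro suminf_le allI) (auto simp: emeasure_eq_measure2 intro!: ennreal_leI)
      also have "\<dots> = ennreal (\<Sum>i. e / 4 * (1 / 2) ^ i)"
        using Union(3) by (intro suminf_ennreal2 sm) auto
      also have "(\<Sum>i. e / 4 * (1 / 2 :: real) ^ i) = e / 2"
        by (subst suminf_mult) (auto simp: suminf_geometric)
      finally show ?thesis using Union(3) unfolding measure_def by (intro enn2real_leI) auto
    qed
    \<comment> \<open>An infinite union of closed sets need not be closed. Continuity from above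
      allows a finite one instead: half of \<open>e\<close> was spent on \<open>R\<close>, and the
      other half pays for this cut.\<close>
    have "(\<lambda>n. measure M (((\<Union>i. G i) - (\<Union>i<n. F i)) \<inter> ball x r)) \<longlonglongrightarrow>
        measure M (\<Inter>n. ((\<Union>i. G i) - (\<Union>i<n. F i)) \<inter> ball x r)"
    proof (rule Lim_measure_decseq)
      show "decseq (\<lambda>n. ((\<Union>i. G i) - (\<Union>i<n. F i)) \<inter> ball x r)"
        by (auto simp: decseq_def)
      show "emeasure M (((\<Union>i. G i) - (\<Union>i<n. F i)) \<inter> ball x r) \<noteq> \<infinity>" for n
        by (rule fin) measurable
    qed auto
    moreover have "(\<Inter>n. ((\<Union>i. G i) - (\<Union>i<n. F i)) \<inter> ball x r) = R"
      unfolding R_def by auto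
    ultimately have "(\<lambda>n. measure M (((\<Union>i. G i) - (\<Union>i<n. F i)) \<inter> ball x r)) \<longlonglongrightarrow> measure M R"
      by simp
    from order_tendstoD(2)[OF this, of e] R Union(3) obtain n
      where "measure M (((\<Union>i. G i) - (\<Union>i<n. F i)) \<inter> ball x r) < e"
      unfolding eventually_sequentially by fastforce
    moreover have "closed (\<Union>i<n. F i)" using FG by auto
    moreover have "open (\<Union>i. G i)" using FG by auto
    moreover have "(\<Union>i<n. F i) \<subseteq> (\<Union>i. A i)" "(\<Union>i. A i) \<subseteq> (\<Union>i. G i)" using FG(3,4) by blast+
    ultimately show ?case
      by (intro exI[of _ "\<Union>i<n. F i"] exI[of _ "\<Union>i. G i"]) simp
  qed
qed

text \<open>The local approximation is used on the balls of radius \<open>n\<close> with errors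
  summing to \<open>e\<close>. Intersecting the \<open>n\<close>-th open set with its ball keeps it
  from contributing where nothing is known about it, so \<open>A\<close> may have infinite
  measure.\<close>

lemma outer_regular_open:
  assumes A: "A \<in> sets borel" and "0 < e"
  shows "\<exists>G. open G \<and> A \<subseteq> G \<and> emeasure M (G - A) \<le> ennreal e"
proof -
  fix x0 :: 'a
  have "\<exists>G. open G \<and> A \<subseteq> G \<and> emeasure M ((G - A) \<inter> ball x0 (real n)) \<le> ennreal (e / 2 * (1 / 2) ^ n)" for n
  proof -
    obtain F G where FG: "closed F" "open G" "F \<subseteq> A" "A \<subseteq> G" 
        "measure M ((G - F) \<inter> ball x0 (real n)) \<le> e / 2 * (1 / 2) ^ n"
      using closed_open_approximation[OF A, of "e / 2 * (1 / 2) ^ n" x0 "real n"] assms by auto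
    have [measurable]: "F \<in> sets M" "G \<in> sets M"
      using FG by (auto intro: open_in_sets borel_in_sets)
    have "emeasure M ((G - A) \<inter> ball x0 (real n)) \<le> emeasure M ((G - F) \<inter> ball x0 (real n))"
      using FG by (intro emeasure_mono) auto
    also have "\<dots> = ennreal (measure M ((G - F) \<inter> ball x0 (real n)))"
      using emeasure_mono[of "(G - F) \<inter> ball x0 (real n)" "ball x0 (real n)" M] ball_finite[of x0 "real n"]
      by (intro emeasure_eq_ennreal_measure) (auto simp: top_unique)
    also have "\<dots> \<le> ennreal (e / 2 * (1 / 2) ^ n)" using FG(5) by (rule ennreal_leI)
    finally show ?thesis using FG by blast
  qed
  then obtain G where G: "\<And>n. open (G n)" "\<And>n. A \<subseteq> G n"
    "\<And>n. emeasure M ((G n - A) \<inter> ball x0 (real n)) \<le> ennreal (e / 2 * (1 / 2) ^ n)"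
    by metis
  have [measurable]: "G n \<in> sets M" "A \<in> sets M" for n
    using G A by (auto intro: open_in_sets borel_in_sets)
  define H where "H = (\<Union>n. G n \<inter> ball x0 (real n))"
  have "open H" unfolding H_def using G by auto
  moreover have "A \<subseteq> H"
  proof
    fix y assume "y \<in> A"
    moreover obtain n where "dist x0 y < real n" using reals_Archimedean2 by blast
    ultimately show "y \<in> H" unfolding H_def using G(2) by auto
  qed
  moreover have "emeasure M (H - A) \<le> ennreal e"
  proof -
    have sm: "summable (\<lambda>i. e / 2 * (1 / 2 :: real) ^ i)" by (intro summable_mult summable_geometric) simp
    have "emeasure M (H - A) \<le> emeasure M (\<Union>n. (G n - A) \<inter> ball x0 (real n))"
      unfolding H_def by (intro emeasure_mono) auto
    also have "\<dots> \<le> (\<Sum>n. emeasure M ((G n - A) \<inter> ball x0 (real n)))"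
      by (intro emeasure_subadditive_countably) auto
    also have "\<dots> \<le> (\<Sum>n. ennreal (e / 2 * (1 / 2) ^ n))"
      using G(3) by (intro suminf_le allI) auto
    also have "\<dots> = ennreal (\<Sum>n. e / 2 * (1 / 2) ^ n)"
      using assms by (intro suminf_ennreal2 sm) auto
    also have "(\<Sum>n. e / 2 * (1 / 2 :: real) ^ n) = e"
      by (subst suminf_mult) (auto simp: suminf_geometric)
    finally show ?thesis .
  qed
  ultimately show ?thesis by blast
qed


text \<open>Layer cake: up to an error of 1, a number is the count of the integer levels below it.
  Each superlevel set of the \<open>p\<close>-th power is enlarged to an open set at summable cost,
  and the indicator of an open set is an increasing limit of continuous functions. The approximation
  happens at the level of \<open>p\<close>-th powers, hence the root in the bound; the rounding
  error survives as the summand 1.\<close>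

lemma vitali_caratheodory:
  assumes \<rho>: "\<rho> \<in> borel_measurable borel" "(\<integral>\<^sup>+ x. epowr (\<rho> x) p \<partial>M) < \<infinity>" and "0 < p"
  obtains h :: "nat \<Rightarrow> 'a \<Rightarrow> real" where
    "\<And>n. continuous_on UNIV (h n)" "\<And>n x. 0 \<le> h n x" "\<And>x. incseq (\<lambda>n. h n x)"
    "(\<integral>\<^sup>+ x. (SUP n. ennreal (h n x)) \<partial>M) < \<infinity>"
    "\<And>x. \<rho> x \<le> ennreal (2 powr (1 / p)) * ((SUP n. ennreal (h n x powr (1 / p))) + 1)"
proof -
  define H where "H x = epowr (\<rho> x) p" for x
  have Hb [measurable]: "H \<in> borel_measurable borel" unfolding H_def using \<rho> by measurable
  have HM [measurable]: "H \<in> borel_measurable M" by (rule measurable_from_borel) (rule Hb)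
  \<comment> \<open>Levels start at 1, not at 0: the set where \<open>H\<close> is positive may have
    infinite measure, while the measures of these sets add up to at most the integral of
    \<open>H\<close>.\<close>
  define A where "A j = {x. of_nat (Suc j) < H x}" for j
  have A [measurable]: "A j \<in> sets borel" for j unfolding A_def by measurable
  have AM [measurable]: "A j \<in> sets M" for j using A by (rule borel_in_sets)
  have "\<exists>G. open G \<and> A j \<subseteq> G \<and> emeasure M (G - A j) \<le> ennreal ((1 / 2) ^ j)" for j
    using outer_regular_open[OF A] by simp
  then obtain G where G: "\<And>j. open (G j)" "\<And>j. A j \<subseteq> G j"
      "\<And>j. emeasure M (G j - A j) \<le> ennreal ((1 / 2) ^ j)"
    by metis
  have GM [measurable]: "G j \<in> sets M" for j using G by (auto intro: open_in_sets)
  \<comment> \<open>The case \<open>UNIV\<close> is separate because the distance to the empty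
    complement is 0 by convention. In \<open>h\<close> below, \<open>n\<close> bounds the number of
    terms and sharpens each of them at the same time, which keeps the sums finite and
    increasing.\<close>
  define \<phi> where "\<phi> j n x = (if G j = UNIV then 1 else min 1 (real n * infdist x (- G j)))" for j n x
  define h where "h n x = (\<Sum>j<n. \<phi> j n x)" for n x
  have \<phi>01: "0 \<le> \<phi> j n x" "\<phi> j n x \<le> 1" for j n x
    unfolding \<phi>_def by (auto simp: infdist_nonneg)
  have \<phi>mono: "\<phi> j n x \<le> \<phi> j m x" if "n \<le> m" for j n m x
  proof -
    have "real n * infdist x (- G j) \<le> real m * infdist x (- G j)"
      using that by (intro mult_right_mono) (auto simp: infdist_nonneg)
    then show ?thesis unfolding \<phi>_def by auto
  qed
  have \<phi>0: "\<phi> j n x \<le> indicator (G j) x" for j n x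
    unfolding \<phi>_def by (auto simp: indicator_def)
  show thesis
  proof
    show "continuous_on UNIV (h n)" for n
    proof -
      have "continuous_on UNIV (\<phi> j n)" for j
        unfolding \<phi>_def by (cases "G j = UNIV") (auto intro!: continuous_intros)
      then show ?thesis unfolding h_def by (intro continuous_intros)
    qed
    show "0 \<le> h n x" for n x unfolding h_def by (intro sum_nonneg \<phi>01)
    show "incseq (\<lambda>n. h n x)" for x
    proof (rule incseq_SucI)
      fix n
      have "h n x \<le> (\<Sum>j<n. \<phi> j (Suc n) x)" unfolding h_def by (intro sum_mono \<phi>mono) simp
      also have "\<dots> \<le> h (Suc n) x" unfolding h_def using \<phi>01 by simp
      finally show "h n x \<le> h (Suc n) x" .
    qed
    have "(SUP n. ennreal (h n x)) \<le> (\<Sum>j. indicator (G j) x)" for x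
    proof (rule SUP_least)
      fix n
      have "ennreal (h n x) = (\<Sum>j<n. ennreal (\<phi> j n x))" unfolding h_def using \<phi>01 by simp
      also have "\<dots> \<le> (\<Sum>j<n. indicator (G j) x)"
        by (intro sum_mono order_trans[OF ennreal_leI[OF \<phi>0]]) (auto simp: indicator_def)
      also have "\<dots> \<le> (\<Sum>j. indicator (G j) x)" by (rule sum_le_suminf) auto
      finally show "ennreal (h n x) \<le> (\<Sum>j. indicator (G j) x)" .
    qed
    then have "(\<integral>\<^sup>+ x. (SUP n. ennreal (h n x)) \<partial>M) \<le> (\<integral>\<^sup>+ x. (\<Sum>j. indicator (G j) x) \<partial>M)"
      by (intro nn_integral_mono) auto
    also have "\<dots> = (\<Sum>j. emeasure M (G j))" by (subst nn_integral_suminf) auto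
    also have "\<dots> \<le> (\<Sum>j. emeasure M (A j) + ennreal ((1 / 2) ^ j))"
    proof (intro suminf_le allI)
      fix j
      have "emeasure M (G j) = emeasure M (A j \<union> (G j - A j))" using G(2)[of j] by (simp add: Un_absorb1)
      also have "\<dots> \<le> emeasure M (A j) + emeasure M (G j - A j)" by (rule emeasure_subadditive) auto
      also have "\<dots> \<le> emeasure M (A j) + ennreal ((1 / 2) ^ j)" using G(3) by (intro add_left_mono)
      finally show "emeasure M (G j) \<le> emeasure M (A j) + ennreal ((1 / 2) ^ j)" .
    qed auto
    also have "\<dots> = (\<Sum>j. emeasure M (A j)) + (\<Sum>j. ennreal ((1 / 2) ^ j))" by (rule suminf_add[symmetric]) auto
    also have "(\<Sum>j. ennreal ((1 / 2) ^ j)) = ennreal 2"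
      by (subst suminf_ennreal2) (auto simp: suminf_geometric)
    also have "(\<Sum>j. emeasure M (A j)) = (\<integral>\<^sup>+ x. (\<Sum>j. indicator (A j) x) \<partial>M)"
      by (subst nn_integral_suminf) auto
    also have "\<dots> \<le> (\<integral>\<^sup>+ x. H x \<partial>M)"
    proof (intro nn_integral_mono suminf_le_const)
      fix x n
      show "(\<Sum>j<n. indicator (A j) x) \<le> H x"
      \<comment> \<open>On \<open>A n\<close> the number of terms, \<open>Suc n\<close>, is already
        below \<open>H x\<close>; off \<open>A n\<close> the new term vanishes.\<close>
      proof (induction n)
        case (Suc n)
        show ?case
        proof (cases "x \<in> A n")
          case True
          have "(\<Sum>j<Suc n. indicator (A j) x) \<le> (\<Sum>j<Suc n. 1 :: ennreal)"
            by (intro sum_mono) (auto simp: indicator_def)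
          also have "\<dots> \<le> H x" using True unfolding A_def by simp
          finally show ?thesis .
        qed (use Suc in simp)
      qed simp
    qed simp
    also have "(\<integral>\<^sup>+ x. H x \<partial>M) + ennreal 2 < \<infinity>"
      using \<rho>(2) unfolding H_def by simp
    finally show "(\<integral>\<^sup>+ x. (SUP n. ennreal (h n x)) \<partial>M) < \<infinity>" by (simp add: add_right_mono)
    show "\<rho> x \<le> ennreal (2 powr (1 / p)) * ((SUP n. ennreal (h n x powr (1 / p))) + 1)" for x
    proof -
      define S where "S = (SUP n. ennreal (h n x))"
      \<comment> \<open>Such an \<open>x\<close> lies in the first \<open>m\<close> open sets, and
        finitely many of the cutoffs reach the value 1 simultaneously.\<close>
      have low: "of_nat m \<le> S" if "of_nat m < H x" for m
      proof -
        have "\<forall>\<^sub>F n in sequentially. \<phi> j n x = 1" if "j < m" for j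
        proof (cases "G j = UNIV")
          case False
          have "of_nat (Suc j) < H x" using \<open>of_nat m < H x\<close> \<open>j < m\<close>
            by (metis Suc_leI le_less_trans of_nat_mono)
          then have "x \<in> G j" using G(2)[of j] unfolding A_def by auto
          then have "infdist x (- G j) > 0"
            using G(1)[of j] False infdist_nonneg[of x "- G j"] in_closed_iff_infdist_zero[of "- G j" x]
            by (auto simp: less_le closed_Compl)
          then obtain N where "1 < real N * infdist x (- G j)"
            using ex_less_of_nat_mult by blast
          then have "\<phi> j n x = 1" if "n \<ge> N" for n
            using that False mult_right_mono[of "real N" "real n" "infdist x (- G j)"] infdist_nonneg[of x "- G j"]
            unfolding \<phi>_def by auto
          then show ?thesis unfolding eventually_sequentially by blast
        qed (simp add: \<phi>_def)
        then have "\<forall>\<^sub>F n in sequentially. \<forall>j\<in>{..<m}. \<phi> j n x = 1"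
          by (intro eventually_ball_finite) auto
        then have "\<forall>\<^sub>F n in sequentially. (\<forall>j\<in>{..<m}. \<phi> j n x = 1) \<and> m \<le> n"
          by (intro eventually_conj eventually_ge_at_top)
        then obtain n where n: "\<forall>j\<in>{..<m}. \<phi> j n x = 1" "m \<le> n"
          unfolding eventually_sequentially by blast
        have "real m = (\<Sum>j<m. \<phi> j n x)" using n by simp
        also have "\<dots> \<le> h n x" unfolding h_def using n \<phi>01 by (intro sum_mono2) auto
        finally have "ennreal (real m) \<le> ennreal (h n x)" by (rule ennreal_leI)
        also have "\<dots> \<le> S" unfolding S_def by (rule SUP_upper) simp
        finally show ?thesis by (simp add: ennreal_of_nat_eq_real_of_nat)
      qed
      have HS: "H x \<le> S + 1"
      proof (cases S)
        case (real r)
        define m where "m = nat \<lfloor>r\<rfloor> + 1"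
        have m: "r < real m" "real m \<le> r + 1" using real(1) unfolding m_def by linarith+
        have "\<not> of_nat m < H x"
          using low[of m] m real by (auto simp: ennreal_of_nat_eq_real_of_nat)
        then have "H x \<le> ennreal (real m)" by (simp add: ennreal_of_nat_eq_real_of_nat not_less)
        also have "\<dots> \<le> ennreal (r + 1)" using m by (intro ennreal_leI) simp
        finally show ?thesis using real by simp
      qed simp
      have "\<rho> x = epowr (H x) (1 / p)"
        unfolding H_def using epowr_epowr_inverse[of "1 / p" "\<rho> x"] \<open>0 < p\<close> by simp
      also have "\<dots> \<le> epowr (S + 1) (1 / p)" using HS \<open>0 < p\<close> by (intro epowr_mono) auto
      also have "\<dots> \<le> ennreal (2 powr (1 / p)) * (epowr S (1 / p) + epowr 1 (1 / p))"
        using \<open>0 < p\<close> by (intro epowr_add_le) auto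
      also have "epowr 1 (1 / p) = 1" using epowr_ennreal[of 1 "1 / p"] by simp
      also have "epowr S (1 / p) = (SUP n. ennreal (h n x powr (1 / p)))"
        unfolding S_def using \<open>\<And>n x. 0 \<le> h n x\<close> \<open>0 < p\<close> by (intro epowr_SUP) auto
      finally show ?thesis .
    qed
  qed
qed

end

section \<open>Doubling measures\<close>

text \<open>Greedy choice: a ball of largest radius, tripled, contains every ball that meets it;
  those are discarded and the rest is handled by induction. The index is a pair because a ball in a
  metric space does not determine its centre and radius.\<close>

lemma finite_vitali_covering:
  fixes I :: "('a::metric_space \<times> real) set"
  assumes "finite I" "\<And>i. i \<in> I \<Longrightarrow> 0 < snd i"
  shows "\<exists>J\<subseteq>I. disjoint_family_on (\<lambda>(z, r). ball z r) J \<and>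
    (\<forall>(z, r)\<in>I. \<exists>(y, s)\<in>J. ball z r \<subseteq> ball y (3 * s))"
  using assms
proof (induction "card I" arbitrary: I rule: less_induct)
  case less
  show ?case
  proof (cases "I = {}")
    case False
    then have "Max (snd ` I) \<in> snd ` I" using less.prems(1) by (intro Max_in) auto
    then obtain b where b: "b \<in> I" "snd b = Max (snd ` I)" by auto
    then have b: "b \<in> I" "\<And>i. i \<in> I \<Longrightarrow> snd i \<le> snd b" using less.prems(1) by auto
    define I' where "I' = {i \<in> I. ball (fst i) (snd i) \<inter> ball (fst b) (snd b) = {}}"
    have "b \<notin> I'" using less.prems(2)[OF b(1)] by (auto simp: I'_def)
    then have "I' \<subset> I" using b(1) unfolding I'_def by blast
    then have "card I' < card I" "finite I'" using less.prems by (auto intro: psubset_card_mono finite_subset)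
    then obtain J where J: "J \<subseteq> I'" "disjoint_family_on (\<lambda>(z, r). ball z r) J"
        "\<forall>(z, r)\<in>I'. \<exists>(y, s)\<in>J. ball z r \<subseteq> ball y (3 * s)"
      using less.hyps[of I'] less.prems \<open>I' \<subset> I\<close> by blast
    have "disjoint_family_on (\<lambda>(z, r). ball z r) (insert b J)"
    proof (subst disjoint_family_on_insert)
      show "b \<notin> J" using J(1) \<open>b \<notin> I'\<close> by blast
      have "ball (fst i) (snd i) \<inter> ball (fst b) (snd b) = {}" if "i \<in> J" for i
        using J(1) that unfolding I'_def by blast
      then show "(case b of (z, r) \<Rightarrow> ball z r) \<inter> (\<Union>i\<in>J. case i of (z, r) \<Rightarrow> ball z r) = {} \<and>
          disjoint_family_on (\<lambda>(z, r). ball z r) J"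
        using J(2) by (fastforce simp: case_prod_beta)
    qed
    moreover have "\<exists>(y, s)\<in>insert b J. ball z r \<subseteq> ball y (3 * s)" if i: "(z, r) \<in> I" for z r
    proof (cases "(z, r) \<in> I'")
      case True
      then show ?thesis using J(3) by blast
    next
      case False
      then obtain w where w: "dist z w < r" "dist (fst b) w < snd b"
        using i by (auto simp: I'_def)
      have "r \<le> snd b" using b(2)[OF i] by simp
      have "ball z r \<subseteq> ball (fst b) (3 * snd b)"
      proof
        fix v assume "v \<in> ball z r"
        then have "dist (fst b) v < snd b + r + r"
          using w dist_triangle[of "fst b" v w] dist_triangle[of w v z] by (simp add: dist_commute)
        then show "v \<in> ball (fst b) (3 * snd b)" using \<open>r \<le> snd b\<close> by simp
      qed
      then show ?thesis by (intro bexI[of _ b]) auto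
    qed
    ultimately show ?thesis using J(1) b(1)
      by (intro exI[of _ "insert b J"]) (auto simp: I'_def)
  qed (simp add: disjoint_family_on_def)
qed

locale doubling_space = metric_measure_space M
  for M :: "'a::metric_space measure" +
  fixes D :: real
  assumes D_ge_1: "1 \<le> D"
    and ball_pos: "0 < r \<Longrightarrow> 0 < measure M (ball x r)"
    and ball_double: "0 < r \<Longrightarrow> measure M (ball x (2 * r)) \<le> D * measure M (ball x r)"

lemma (in metric_measure_space) emeasure_ball: "emeasure M (ball x r) = ennreal (measure M (ball x r))"
  using ball_finite[of x r] by (intro emeasure_eq_ennreal_measure) (auto simp: top_unique)

lemma (in metric_measure_space) measure_ball_mono:
  "ball x r \<subseteq> ball y s \<Longrightarrow> measure M (ball x r) \<le> measure M (ball y s)"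
  using emeasure_mono[of "ball x r" "ball y s" M] by (simp add: emeasure_ball)

lemma doubling_imp_doubling_space:
  assumes "metric_measure_space M" "doubling M"
  shows "\<exists>D. doubling_space M D"
proof -
  interpret metric_measure_space M by fact
  obtain C where C: "C > 0" "\<And>x r. r > 0 \<Longrightarrow> 0 < emeasure M (ball x (2 * r)) \<and>
           emeasure M (ball x (2 * r)) \<le> ennreal C * emeasure M (ball x r)"
    using assms unfolding doubling_def by blast
  have "measure M (ball x (2 * r)) \<le> max 1 C * measure M (ball x r)" if "r > 0" for x r
  proof -
    have "ennreal (measure M (ball x (2 * r))) \<le> ennreal (C * measure M (ball x r))"
      using C that by (auto simp: emeasure_ball ennreal_mult)
    then have "measure M (ball x (2 * r)) \<le> C * measure M (ball x r)"
      using C(1) by (subst (asm) ennreal_le_iff) auto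
    also have "\<dots> \<le> max 1 C * measure M (ball x r)" by (intro mult_right_mono) auto
    finally show ?thesis .
  qed
  moreover have "0 < measure M (ball x r)" if "r > 0" for x r
    using C(2)[of "r / 2" x] that by (simp add: emeasure_ball)
  ultimately have "doubling_space M (max 1 C)"
    by unfold_locales auto
  then show ?thesis by blast
qed

section \<open>Total boundedness of balls and the weak type estimate for averages\<close>

context doubling_space begin

lemma ball_double_pow: "0 < r \<Longrightarrow> measure M (ball x (2 ^ m * r)) \<le> D ^ m * measure M (ball x r)"
proof (induction m)
  case (Suc m)
  have "measure M (ball x (2 ^ Suc m * r)) \<le> D * measure M (ball x (2 ^ m * r))"
    using ball_double[of "2 ^ m * r" x] Suc.prems by (simp add: mult.assoc)
  also have "\<dots> \<le> D * (D ^ m * measure M (ball x r))"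
    using Suc D_ge_1 by (intro mult_left_mono) auto
  finally show ?case by (simp add: mult.assoc)
qed simp

text \<open>The balls of radius \<open>e / 2\<close> around the points are disjoint and lie in
  \<open>ball y (A + e)\<close>. Doubling any of them \<open>m\<close> times swallows
  \<open>ball y A\<close>, so each has at least the measure of \<open>ball y A\<close> divided by
  \<open>D ^ m\<close>.\<close>

lemma separated_card_bound:
  fixes y :: 'a
  assumes "0 < A" "0 < e"
  shows "\<exists>N. \<forall>S. finite S \<and> S \<subseteq> cball y A \<and> pairwise (\<lambda>u v. e \<le> dist u v) S \<longrightarrow> card S \<le> N"
proof -
  obtain m where m: "4 * A / e < 2 ^ m" using real_arch_pow[of 2] by auto
  define N where "N = D ^ m * measure M (ball y (A + e)) / measure M (ball y A)"
  have "real (card S) \<le> N"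
    if S: "finite S" "S \<subseteq> cball y A" "pairwise (\<lambda>u v. e \<le> dist u v) S" for S
  proof -
    have low: "measure M (ball y A) \<le> D ^ m * measure M (ball z (e / 2))" if "z \<in> S" for z
    proof -
      have "ball y A \<subseteq> ball z (2 ^ m * (e / 2))"
      proof
        fix v assume "v \<in> ball y A"
        then have "dist z v < 2 * A" using S(2) \<open>z \<in> S\<close> dist_triangle[of z v y] by (auto simp: dist_commute)
        also have "2 * A < 2 ^ m * (e / 2)" using m assms by (simp add: field_simps)
        finally show "v \<in> ball z (2 ^ m * (e / 2))" by simp
      qed
      then have "measure M (ball y A) \<le> measure M (ball z (2 ^ m * (e / 2)))" by (rule measure_ball_mono)
      also have "\<dots> \<le> D ^ m * measure M (ball z (e / 2))" using assms by (intro ball_double_pow) auto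
      finally show ?thesis .
    qed
    have "disjoint_family_on (\<lambda>z. ball z (e / 2)) S"
    proof (unfold disjoint_family_on_def, intro ballI impI)
      fix u v assume "u \<in> S" "v \<in> S" "u \<noteq> v"
      then have "e \<le> dist u v" using S(3) by (auto simp: pairwise_def)
      then show "ball u (e / 2) \<inter> ball v (e / 2) = {}"
        using dist_triangle_half_l[of u _ e v] by (force simp: dist_commute)
    qed
    then have "(\<Sum>z\<in>S. emeasure M (ball z (e / 2))) = emeasure M (\<Union>z\<in>S. ball z (e / 2))"
      using S(1) by (intro sum_emeasure) auto
    also have "\<dots> \<le> emeasure M (ball y (A + e))"
    proof (rule emeasure_mono)
      show "(\<Union>z\<in>S. ball z (e / 2)) \<subseteq> ball y (A + e)"
      proof clarify
        fix z v assume "z \<in> S" "v \<in> ball z (e / 2)"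
        then show "v \<in> ball y (A + e)"
          using S(2) dist_triangle[of y v z] assms by auto
      qed
    qed simp
    finally have "(\<Sum>z\<in>S. measure M (ball z (e / 2))) \<le> measure M (ball y (A + e))"
      by (simp add: emeasure_ball)
    then have "D ^ m * (\<Sum>z\<in>S. measure M (ball z (e / 2))) \<le> D ^ m * measure M (ball y (A + e))"
      using D_ge_1 by (intro mult_left_mono) auto
    moreover have "real (card S) * measure M (ball y A) \<le> D ^ m * (\<Sum>z\<in>S. measure M (ball z (e / 2)))"
      unfolding sum_distrib_left using sum_mono[of S "\<lambda>_. measure M (ball y A)", OF low] by simp
    ultimately show ?thesis
      unfolding N_def using ball_pos[OF assms(1), of y] by (simp add: field_simps)
  qed
  then have "\<forall>S. finite S \<and> S \<subseteq> cball y A \<and> pairwise (\<lambda>u v. e \<le> dist u v) S \<longrightarrow> card S \<le> nat \<lceil>N\<rceil>"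
    by (meson order_trans real_nat_ceiling_ge of_nat_le_iff)
  then show ?thesis by blast
qed

text \<open>A separated subset of largest cardinality is a net: a point that it fails to cover could
  be added to it.\<close>

lemma cball_totally_bounded:
  fixes y :: 'a
  assumes "0 < A" "0 < e"
  shows "\<exists>S. finite S \<and> cball y A \<subseteq> (\<Union>z\<in>S. ball z e)"
proof -
  define P where "P S \<longleftrightarrow> finite S \<and> S \<subseteq> cball y A \<and> pairwise (\<lambda>u v. e \<le> dist u v) S" for S
  obtain N where N: "\<And>S. P S \<Longrightarrow> card S \<le> N"
    using separated_card_bound[OF assms, of y] unfolding P_def by blast
  have "P {}" unfolding P_def by simp
  then obtain S where S: "P S" "\<And>S'. P S' \<Longrightarrow> card S' \<le> card S"
    using ex_has_greatest_nat[of P "{}" card "Suc N"] N by (auto simp: less_Suc_eq_le)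
  have "cball y A \<subseteq> (\<Union>z\<in>S. ball z e)"
  proof
    fix v assume v: "v \<in> cball y A"
    show "v \<in> (\<Union>z\<in>S. ball z e)"
    proof (rule ccontr)
      assume "v \<notin> (\<Union>z\<in>S. ball z e)"
      then have far: "e \<le> dist z v" if "z \<in> S" for z using that by force
      then have "v \<notin> S" using \<open>0 < e\<close> by force
      moreover have "P (insert v S)"
        using S(1) v far unfolding P_def by (auto simp: pairwise_insert dist_commute)
      ultimately show False using S(2)[of "insert v S"] S(1) unfolding P_def by simp
    qed
  qed
  then show ?thesis using S(1) unfolding P_def by blast
qed

text \<open>The superlevel set at height \<open>k\<close> of the uncentred Hardy-Littlewood maximal
  function of \<open>h\<close>, with the mean multiplied out to avoid division.\<close>

definition high_average :: "('a \<Rightarrow> ennreal) \<Rightarrow> real \<Rightarrow> 'a set" where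
  "high_average h k = \<Union>{ball z r | z r. 0 < r \<and> ennreal k * emeasure M (ball z r) < (\<integral>\<^sup>+ x\<in>ball z r. h x \<partial>M)}"

lemma open_high_average: "open (high_average h k)"
  unfolding high_average_def by auto

lemma set_nn_integral_split_le:
  assumes [measurable]: "h \<in> borel_measurable M" "B \<in> sets M" and "0 \<le> k"
  shows "(\<integral>\<^sup>+ x\<in>B. h x \<partial>M) \<le> (\<integral>\<^sup>+ x\<in>B. h x * indicator {x. ennreal k < h x} x \<partial>M) + ennreal k * emeasure M B"
proof -
  have "(\<integral>\<^sup>+ x\<in>B. h x \<partial>M) \<le> (\<integral>\<^sup>+ x. h x * indicator {x. ennreal k < h x} x * indicator B x + ennreal k * indicator B x \<partial>M)"
    by (intro nn_integral_mono) (auto simp: indicator_def)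
  also have "\<dots> = (\<integral>\<^sup>+ x\<in>B. h x * indicator {x. ennreal k < h x} x \<partial>M) + ennreal k * emeasure M B"
    by (subst nn_integral_add) (auto simp: nn_integral_cmult_indicator)
  finally show ?thesis .
qed

text \<open>The weak type estimate, sharpened so that only the values above \<open>k / 2\<close> are
  charged; for integrable \<open>h\<close> the right-hand side then tends to 0 as \<open>k\<close>
  grows. Compactness supplies the finite family for the covering lemma. The factor 2 comes from the
  halved height, and \<open>D\<close> enters squared because tripling a radius is covered by two
  doublings.\<close>

lemma emeasure_high_average_compact:
  assumes [measurable]: "h \<in> borel_measurable M" and fin: "(\<integral>\<^sup>+ x. h x \<partial>M) < \<infinity>" and "0 < k"
    and K: "compact K" "K \<subseteq> high_average h k"
  shows "ennreal k * emeasure M K \<le> ennreal (2 * D\<^sup>2) * (\<integral>\<^sup>+ x. h x * indicator {x. ennreal (k / 2) < h x} x \<partial>M)"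
proof -
  define \<B> where "\<B> = {(z, r). 0 < r \<and> ennreal k * emeasure M (ball z r) < (\<integral>\<^sup>+ x\<in>ball z r. h x \<partial>M)}"
  define g where "g x = h x * indicator {x. ennreal (k / 2) < h x} x" for x
  have [measurable]: "g \<in> borel_measurable M" unfolding g_def by measurable
  have "K \<subseteq> (\<Union>(z, r)\<in>\<B>. ball z r)"
    using K(2) unfolding high_average_def \<B>_def by blast
  then obtain I where I: "I \<subseteq> \<B>" "finite I" "K \<subseteq> (\<Union>(z, r)\<in>I. ball z r)"
    using compactE_image[OF K(1), of \<B> "\<lambda>(z, r). ball z r"] by (auto simp: case_prod_beta)
  obtain J where J: "J \<subseteq> I" "disjoint_family_on (\<lambda>(z, r). ball z r) J"
    "\<forall>(z, r)\<in>I. \<exists>(y, s)\<in>J. ball z r \<subseteq> ball y (3 * s)"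
    using finite_vitali_covering[OF I(2)] I(1) unfolding \<B>_def by force
  have "finite J" using J I by (auto intro: finite_subset)
  have key: "ennreal k * emeasure M (ball y (3 * s)) \<le> ennreal (2 * D\<^sup>2) * (\<integral>\<^sup>+ x\<in>ball y s. g x \<partial>M)"
    if "(y, s) \<in> J" for y s
  proof -
    have s: "0 < s" "ennreal k * emeasure M (ball y s) < (\<integral>\<^sup>+ x\<in>ball y s. h x \<partial>M)"
      using that J(1) I(1) unfolding \<B>_def by auto
    have "(\<integral>\<^sup>+ x\<in>ball y s. g x \<partial>M) \<le> (\<integral>\<^sup>+ x. h x \<partial>M)"
      unfolding g_def by (intro nn_integral_mono) (auto simp: indicator_def)
    then obtain t where t: "0 \<le> t" "(\<integral>\<^sup>+ x\<in>ball y s. g x \<partial>M) = ennreal t"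
      using fin by (cases "(\<integral>\<^sup>+ x\<in>ball y s. g x \<partial>M)") (auto simp: top_unique)
    \<comment> \<open>The values below \<open>k / 2\<close> account for at most half of the mean, so
      \<open>g\<close> carries the other half. Finiteness of \<open>t\<close> permits the
      subtraction that follows.\<close>
    have "ennreal k * emeasure M (ball y s) \<le> ennreal t + ennreal (k / 2) * emeasure M (ball y s)"
      using s(2) set_nn_integral_split_le[of h "ball y s" "k / 2"] \<open>0 < k\<close> t(2)[unfolded g_def] by simp
    then have "ennreal (k * measure M (ball y s)) \<le> ennreal (t + k / 2 * measure M (ball y s))"
    proof -
      have "ennreal c * emeasure M (ball y s) = ennreal (c * measure M (ball y s))" if "0 \<le> c" for c
        using that by (simp add: emeasure_ball ennreal_mult)
      then have "ennreal (k * measure M (ball y s)) \<le> ennreal t + ennreal (k / 2 * measure M (ball y s))"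
        using \<open>ennreal k * emeasure M (ball y s) \<le> _\<close> \<open>0 < k\<close> by simp
      then show ?thesis using \<open>0 < k\<close> t by (subst ennreal_plus) auto
    qed
    then have 1: "k * measure M (ball y s) \<le> 2 * t"
      using \<open>0 < k\<close> t by (subst (asm) ennreal_le_iff) (auto simp: field_simps)
    have "measure M (ball y (3 * s)) \<le> measure M (ball y (2 ^ 2 * s))"
      using s by (intro measure_ball_mono) auto
    also have "\<dots> \<le> D\<^sup>2 * measure M (ball y s)" by (rule ball_double_pow) (rule s)
    finally have "k * measure M (ball y (3 * s)) \<le> k * (D\<^sup>2 * measure M (ball y s))"
      using \<open>0 < k\<close> by (intro mult_left_mono) auto
    also have "\<dots> = D\<^sup>2 * (k * measure M (ball y s))" by simp
    also have "\<dots> \<le> D\<^sup>2 * (2 * t)" by (intro mult_left_mono 1) auto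
    finally have "ennreal (k * measure M (ball y (3 * s))) \<le> ennreal (2 * D\<^sup>2 * t)"
      by (intro ennreal_leI) (simp add: algebra_simps)
    then show ?thesis using \<open>0 < k\<close> t by (simp add: emeasure_ball ennreal_mult)
  qed
  have "emeasure M K \<le> emeasure M (\<Union>(y, s)\<in>J. ball y (3 * s))"
  proof (rule emeasure_mono)
    show "K \<subseteq> (\<Union>(y, s)\<in>J. ball y (3 * s))"
    proof
      fix x assume "x \<in> K"
      then obtain z r where "(z, r) \<in> I" "x \<in> ball z r" using I(3) by blast
      moreover from this(1) obtain y s where "(y, s) \<in> J" "ball z r \<subseteq> ball y (3 * s)" using J(3) by blast
      ultimately show "x \<in> (\<Union>(y, s)\<in>J. ball y (3 * s))" by blast
    qed
  qed (use \<open>finite J\<close> in \<open>auto intro!: sets.finite_UN\<close>)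
  also have "\<dots> \<le> (\<Sum>i\<in>J. emeasure M (case i of (y, s) \<Rightarrow> ball y (3 * s)))"
    using \<open>finite J\<close> by (intro emeasure_subadditive_finite) auto
  finally have "ennreal k * emeasure M K \<le> ennreal k * (\<Sum>i\<in>J. emeasure M (case i of (y, s) \<Rightarrow> ball y (3 * s)))"
    by (rule mult_left_mono) simp
  also have "\<dots> \<le> (\<Sum>i\<in>J. ennreal (2 * D\<^sup>2) * (\<integral>\<^sup>+ x\<in>(case i of (y, s) \<Rightarrow> ball y s). g x \<partial>M))"
    unfolding sum_distrib_left using key by (intro sum_mono) auto
  also have "\<dots> = ennreal (2 * D\<^sup>2) * (\<Sum>i\<in>J. (\<integral>\<^sup>+ x\<in>(case i of (y, s) \<Rightarrow> ball y s). g x \<partial>M))"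
    by (simp add: sum_distrib_left)
  also have "(\<Sum>i\<in>J. (\<integral>\<^sup>+ x\<in>(case i of (y, s) \<Rightarrow> ball y s). g x \<partial>M)) =
      (\<integral>\<^sup>+ x. (\<Sum>i\<in>J. g x * indicator (case i of (y, s) \<Rightarrow> ball y s) x) \<partial>M)"
    by (intro nn_integral_sum[symmetric]) (auto simp: case_prod_beta)
  also have "\<dots> \<le> (\<integral>\<^sup>+ x. g x \<partial>M)"
  proof (rule nn_integral_mono)
    fix x
    have "(\<Sum>i\<in>J. indicator (case i of (y, s) \<Rightarrow> ball y s) x) =
        (indicator (\<Union>i\<in>J. case i of (y, s) \<Rightarrow> ball y s) x :: ennreal)"
      using \<open>finite J\<close> J(2) by (intro indicator_UN_disjoint[symmetric])
    then have "(\<Sum>i\<in>J. g x * indicator (case i of (y, s) \<Rightarrow> ball y s) x) =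
        g x * indicator (\<Union>i\<in>J. case i of (y, s) \<Rightarrow> ball y s) x"
      by (simp add: sum_distrib_left[symmetric])
    then show "(\<Sum>i\<in>J. g x * indicator (case i of (y, s) \<Rightarrow> ball y s) x) \<le> g x"
      by (auto simp: indicator_def)
  qed
  finally show ?thesis unfolding g_def by (simp add: mult_left_mono)
qed

end

section \<open>Proper spaces: compact exhaustions and levels at which the averages are rarely
  exceeded\<close>

locale complete_doubling_space = doubling_space M D
  for M :: "'a::complete_space measure" and D
begin

lemma compact_cball: "compact (cball (y :: 'a) A)"
proof (cases "0 < A")
  case True
  then show ?thesis
    unfolding compact_eq_totally_bounded complete_eq_closed
    using cball_totally_bounded by auto
next
  case False
  then have "cball y A = {} \<or> cball y A = {y}" by (cases "A = 0") auto
  then show ?thesis by auto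
qed

text \<open>Lets the finite covering argument reach open sets through continuity of the measure from
  below. The whole space is treated apart because the distance to its empty complement is 0 by
  convention.\<close>

lemma open_eq_UN_compact:
  fixes V :: "'a set"
  assumes "open V"
  obtains K :: "nat \<Rightarrow> 'a set" where "\<And>n. compact (K n)" "incseq K" "(\<Union>n. K n) = V"
proof (cases "V = UNIV")
  case True
  fix x0 :: 'a
  have "x \<in> (\<Union>n. cball x0 (real n))" for x
    using real_arch_simple[of "dist x0 x"] by auto
  then have "(\<Union>n. cball x0 (real n)) = V" using True by blast
  then show ?thesis by (intro that[of "\<lambda>n. cball x0 (real n)"]) (auto simp: compact_cball incseq_def)
next
  case False
  fix x0 :: 'a
  define K where "K n = cball x0 (real n) \<inter> {x. 1 \<le> real n * infdist x (- V)}" for n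
  show ?thesis
  proof
    show "compact (K n)" for n unfolding K_def
      by (intro compact_Int_closed compact_cball closed_Collect_le continuous_intros)
    show "incseq K"
    proof (rule incseq_SucI)
      fix n
      have "real n * infdist x (- V) \<le> real (Suc n) * infdist x (- V)" for x
        by (intro mult_right_mono) (auto simp: infdist_nonneg)
      then show "K n \<subseteq> K (Suc n)" unfolding K_def by (force intro: order_trans)
    qed
    show "(\<Union>n. K n) = V"
    proof (intro equalityI subsetI)
      fix x assume "x \<in> (\<Union>n. K n)"
      then obtain n where n: "1 \<le> real n * infdist x (- V)" unfolding K_def by auto
      show "x \<in> V"
      proof (rule ccontr)
        assume "x \<notin> V"
        then have "infdist x (- V) = 0" by (intro infdist_zero) simp
        with n show False by simp
      qed
    next
      fix x assume "x \<in> V"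
      then have pos: "infdist x (- V) > 0"
        using \<open>open V\<close> False infdist_nonneg[of x "- V"] in_closed_iff_infdist_zero[of "- V" x]
        by (auto simp: less_le closed_Compl)
      obtain n1 where n1: "dist x0 x \<le> real n1" using real_arch_simple by blast
      obtain n2 where n2: "1 < real n2 * infdist x (- V)" using ex_less_of_nat_mult[OF pos] by blast
      have "real n2 * infdist x (- V) \<le> real (max n1 n2) * infdist x (- V)"
        using pos by (intro mult_right_mono) auto
      then have "x \<in> K (max n1 n2)" unfolding K_def using n1 n2 by auto
      then show "x \<in> (\<Union>n. K n)" by blast
    qed
  qed
qed

lemma emeasure_high_average:
  assumes [measurable]: "h \<in> borel_measurable M" and fin: "(\<integral>\<^sup>+ x. h x \<partial>M) < \<infinity>" and "0 < k"
  shows "ennreal k * emeasure M (high_average h k) \<le>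
    ennreal (2 * D\<^sup>2) * (\<integral>\<^sup>+ x. h x * indicator {x. ennreal (k / 2) < h x} x \<partial>M)"
proof -
  obtain K :: "nat \<Rightarrow> 'a set" where K: "\<And>n. compact (K n)" "incseq K" "(\<Union>n. K n) = high_average h k"
    using open_eq_UN_compact[OF open_high_average] by metis
  have "emeasure M (high_average h k) = (SUP n. emeasure M (K n))"
    using K by (subst SUP_emeasure_incseq) (auto intro!: borel_in_sets borel_compact)
  then have "ennreal k * emeasure M (high_average h k) = (SUP n. ennreal k * emeasure M (K n))"
    by (simp add: SUP_mult_left_ennreal)
  also have "\<dots> \<le> ennreal (2 * D\<^sup>2) * (\<integral>\<^sup>+ x. h x * indicator {x. ennreal (k / 2) < h x} x \<partial>M)"
    using K by (intro SUP_least emeasure_high_average_compact assms) auto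
  finally show ?thesis .
qed

text \<open>The tails \<open>T n\<close> tend to 0 by dominated convergence. Both smallness
  statements are wanted at one level \<open>k\<close>: they are the two contributions to the energy
  of the weight on this set, from \<open>h\<close> itself and from a Lipschitz constant whose
  \<open>p\<close>-th power is of order \<open>k\<close>.\<close>

lemma high_average_small:
  assumes [measurable]: "h \<in> borel_measurable M" and fin: "(\<integral>\<^sup>+ x. h x \<partial>M) < \<infinity>" and "0 < e"
  obtains k :: real where "1 \<le> k" "ennreal k * emeasure M (high_average h k) \<le> ennreal e"
    "(\<integral>\<^sup>+ x\<in>high_average h k. h x \<partial>M) \<le> ennreal e"
proof -
  define T where "T n = (\<integral>\<^sup>+ x. h x * indicator {x. ennreal (real (Suc n) / 2) < h x} x \<partial>M)" for n
  have "(\<lambda>n. T n) \<longlonglongrightarrow> (\<integral>\<^sup>+ x. 0 \<partial>M)"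
    unfolding T_def
  proof (rule nn_integral_dominated_convergence[where w = h])
    have "AE x in M. h x \<noteq> \<infinity>" by (rule nn_integral_PInf_AE) (use fin in auto)
    then show "AE x in M. (\<lambda>n. h x * indicator {x. ennreal (real (Suc n) / 2) < h x} x) \<longlonglongrightarrow> 0"
    proof eventually_elim
      case (elim x)
      then obtain r where r: "0 \<le> r" "h x = ennreal r" by (cases "h x") auto
      obtain N where "2 * r \<le> real N" using real_arch_simple by blast
      then have "h x * indicator {x. ennreal (real (Suc n) / 2) < h x} x = 0" if "n \<ge> N" for n
        using that r by (auto simp: indicator_def ennreal_less_iff)
      then show ?case
        by (intro tendsto_eventually) (auto simp: eventually_sequentially)
    qed
  qed (use fin in \<open>auto simp: indicator_def\<close>)
  then have "T \<longlonglongrightarrow> 0" by simp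
  moreover have D: "0 < 2 * D\<^sup>2" using D_ge_1 by simp
  \<comment> \<open>The second entry of the minimum absorbs the constant of the weak type estimate
    and yields \<open>e / 2\<close> for the measure term; the first bounds the tail by
    \<open>e / 2\<close>, so that tail and measure term together stay below
    \<open>e\<close>.\<close>
  moreover have "0 < ennreal (min e (e / (2 * D\<^sup>2)) / 2)" using \<open>0 < e\<close> D by simp
  ultimately have "\<forall>\<^sub>F n in sequentially. T n < ennreal (min e (e / (2 * D\<^sup>2)) / 2)"
    by (intro order_tendstoD(2))
  then obtain n where n: "T n < ennreal (min e (e / (2 * D\<^sup>2)) / 2)"
    unfolding eventually_sequentially by blast
  define k where "k = real (Suc n)"
  have k: "1 \<le> k" unfolding k_def by simp
  have "ennreal k * emeasure M (high_average h k) \<le> ennreal (2 * D\<^sup>2) * T n"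
    unfolding T_def k_def by (intro emeasure_high_average fin) auto
  also have "\<dots> \<le> ennreal (2 * D\<^sup>2) * ennreal (e / (2 * D\<^sup>2) / 2)"
    using n by (intro mult_left_mono order_trans[OF less_imp_le[OF n]] ennreal_leI) auto
  also have "\<dots> = ennreal (e / 2)" using D \<open>0 < e\<close> by (subst ennreal_mult[symmetric]) auto
  finally have 1: "ennreal k * emeasure M (high_average h k) \<le> ennreal (e / 2)" .
  have [measurable]: "high_average h k \<in> sets M" using open_high_average by (rule open_in_sets)
  have "(\<integral>\<^sup>+ x\<in>high_average h k. h x \<partial>M) \<le>
      (\<integral>\<^sup>+ x\<in>high_average h k. h x * indicator {x. ennreal k < h x} x \<partial>M) + ennreal k * emeasure M (high_average h k)"
    using k by (intro set_nn_integral_split_le) auto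
  also have "\<dots> \<le> T n + ennreal (e / 2)"
  proof (rule add_mono[OF _ 1])
    show "(\<integral>\<^sup>+ x\<in>high_average h k. h x * indicator {x. ennreal k < h x} x \<partial>M) \<le> T n"
      unfolding T_def
    proof (rule nn_integral_mono)
      fix x
      have "ennreal (real (Suc n) / 2) \<le> ennreal k" unfolding k_def by (intro ennreal_leI) simp
      then show "h x * indicator {x. ennreal k < h x} x * indicator (high_average h k) x
        \<le> h x * indicator {x. ennreal (real (Suc n) / 2) < h x} x"
        by (auto simp: indicator_def)
    qed
  qed
  also have "\<dots> \<le> ennreal (e / 2) + ennreal (e / 2)"
    by (intro add_right_mono order_trans[OF less_imp_le[OF n]] ennreal_leI) simp
  also have "\<dots> = ennreal e" using \<open>0 < e\<close> by (subst ennreal_plus[symmetric]) auto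
  finally have 2: "(\<integral>\<^sup>+ x\<in>high_average h k. h x \<partial>M) \<le> ennreal e" .
  have "ennreal (e / 2) \<le> ennreal e" using \<open>0 < e\<close> by (intro ennreal_leI) simp
  then show thesis using that[OF k] 1 2 by (meson order_trans)
qed

end

section \<open>Arc length\<close>

definition partition_sum :: "(real \<Rightarrow> 'a::metric_space) \<Rightarrow> nat \<Rightarrow> (nat \<Rightarrow> real) \<Rightarrow> ennreal" where
  "partition_sum \<gamma> n t = (\<Sum>i<n. ennreal (dist (\<gamma> (t i)) (\<gamma> (t (Suc i)))))"

lemma partition_sum_le_curve_length:
  "t 0 = a \<Longrightarrow> t n = b \<Longrightarrow> mono_on {..n} t \<Longrightarrow> partition_sum \<gamma> n t \<le> curve_length \<gamma> a b"
  unfolding curve_length_def partition_sum_def by (rule SUP_upper2[of "(n, t)"]) auto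

lemma curve_length_leI:
  "(\<And>n t. t 0 = a \<Longrightarrow> t n = b \<Longrightarrow> mono_on {..n} t \<Longrightarrow> partition_sum \<gamma> n t \<le> c) \<Longrightarrow> curve_length \<gamma> a b \<le> c"
  unfolding curve_length_def partition_sum_def by (rule SUP_least) auto

lemma dist_le_curve_length:
  assumes "a \<le> b"
  shows "ennreal (dist (\<gamma> a) (\<gamma> b)) \<le> curve_length \<gamma> a b"
  using partition_sum_le_curve_length[of "\<lambda>i. if i = 0 then a else b" a 1 b \<gamma>] assms
  by (auto simp: partition_sum_def mono_on_def)

lemma curve_length_le_lipschitz:
  assumes "1-lipschitz_on {a..b} \<gamma>"
  shows "curve_length \<gamma> a b \<le> ennreal (b - a)"
proof (rule curve_length_leI)
  fix n and t :: "nat \<Rightarrow> real" assume t: "t 0 = a" "t n = b" "mono_on {..n} t"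
  have "t i \<in> {a..b}" if "i \<le> n" for i
    using t mono_onD[OF t(3), of 0 i] mono_onD[OF t(3), of i n] that by auto
  then have "dist (\<gamma> (t i)) (\<gamma> (t (Suc i))) \<le> t (Suc i) - t i" if "i < n" for i
    using lipschitz_onD[OF assms, of "t i" "t (Suc i)"] mono_onD[OF t(3), of i "Suc i"] that
    by (auto simp: dist_real_def)
  then have "(\<Sum>i<n. dist (\<gamma> (t i)) (\<gamma> (t (Suc i)))) \<le> (\<Sum>i<n. t (Suc i) - t i)"
    by (intro sum_mono) auto
  also have "\<dots> = b - a" using t by (simp add: sum_lessThan_telescope)
  finally show "partition_sum \<gamma> n t \<le> ennreal (b - a)"
    unfolding partition_sum_def by (simp add: ennreal_leI)
qed

text \<open>A monotone map carries partitions to partitions. Used once with the length function and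
  once with a right inverse of it, this gives both inequalities for the length of the reparametrized
  curve.\<close>

lemma curve_length_compose_le:
  assumes "mono_on {a..b} s" "\<And>t. t \<in> {a..b} \<Longrightarrow> \<gamma> t = \<delta> (s t)"
  shows "curve_length \<gamma> a b \<le> curve_length \<delta> (s a) (s b)"
proof (rule curve_length_leI)
  fix n and t :: "nat \<Rightarrow> real" assume t: "t 0 = a" "t n = b" "mono_on {..n} t"
  have I: "t i \<in> {a..b}" if "i \<le> n" for i
    using t mono_onD[OF t(3), of 0 i] mono_onD[OF t(3), of i n] that by auto
  then have "partition_sum \<gamma> n t = partition_sum \<delta> n (\<lambda>i. s (t i))"
    unfolding partition_sum_def using assms(2) by (intro sum.cong) auto
  also have "\<dots> \<le> curve_length \<delta> (s a) (s b)"
  proof (rule partition_sum_le_curve_length)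
    show "mono_on {..n} (\<lambda>i. s (t i))"
      using I t(3) assms(1) by (auto simp: mono_on_def)
  qed (use t in auto)
  finally show "partition_sum \<gamma> n t \<le> curve_length \<delta> (s a) (s b)" .
qed

lemma curve_length_add:
  assumes "a \<le> b" "b \<le> c"
  shows "curve_length \<gamma> a c = curve_length \<gamma> a b + curve_length \<gamma> b c"
proof (rule antisym)
  show "curve_length \<gamma> a c \<le> curve_length \<gamma> a b + curve_length \<gamma> b c"
  proof (rule curve_length_leI)
    fix n and t :: "nat \<Rightarrow> real" assume t: "t 0 = a" "t n = c" "mono_on {..n} t"
    \<comment> \<open>Clamping the partition points to either side of \<open>b\<close> changes only
      the interval that contains \<open>b\<close>, and there the triangle inequality
      applies.\<close>
    have "partition_sum \<gamma> n t \<le> partition_sum \<gamma> n (\<lambda>i. min (t i) b) + partition_sum \<gamma> n (\<lambda>i. max (t i) b)"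
      unfolding partition_sum_def sum.distrib[symmetric]
    proof (rule sum_mono)
      fix i assume "i \<in> {..<n}"
      then have "t i \<le> t (Suc i)" using mono_onD[OF t(3), of i "Suc i"] by auto
      then have "dist (\<gamma> (t i)) (\<gamma> (t (Suc i))) \<le> dist (\<gamma> (min (t i) b)) (\<gamma> (min (t (Suc i)) b))
          + dist (\<gamma> (max (t i) b)) (\<gamma> (max (t (Suc i)) b))"
        using dist_triangle[of "\<gamma> (t i)" "\<gamma> (t (Suc i))" "\<gamma> b"] by (auto simp: min_def max_def)
      then show "ennreal (dist (\<gamma> (t i)) (\<gamma> (t (Suc i)))) \<le> ennreal (dist (\<gamma> (min (t i) b)) (\<gamma> (min (t (Suc i)) b)))
          + ennreal (dist (\<gamma> (max (t i) b)) (\<gamma> (max (t (Suc i)) b)))"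
        by (simp add: ennreal_leI flip: ennreal_plus)
    qed
    also have "\<dots> \<le> curve_length \<gamma> a b + curve_length \<gamma> b c"
      using t assms by (intro add_mono partition_sum_le_curve_length) (auto simp: mono_on_def min_def max_def intro: order_trans)
    finally show "partition_sum \<gamma> n t \<le> curve_length \<gamma> a b + curve_length \<gamma> b c" .
  qed
  have step: "partition_sum \<gamma> n t + partition_sum \<gamma> m u \<le> curve_length \<gamma> a c"
    if t: "t 0 = a" "t n = b" "mono_on {..n} t" and u: "u 0 = b" "u m = c" "mono_on {..m} u" for n t m u
  proof -
    \<comment> \<open>The two partitions share the point \<open>b\<close>, which is both
      \<open>t n\<close> and \<open>u 0\<close>; the second one therefore resumes at index
      \<open>n\<close>.\<close>
    define v where "v i = (if i \<le> n then t i else u (i - n))" for i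
    have v: "v (n + i) = u i" for i unfolding v_def using t u by auto
    have "partition_sum \<gamma> (n + m) v = partition_sum \<gamma> n v + (\<Sum>i<m. ennreal (dist (\<gamma> (v (n + i))) (\<gamma> (v (n + Suc i)))))"
      unfolding partition_sum_def by (induction m) (auto simp: add.assoc)
    also have "(\<Sum>i<m. ennreal (dist (\<gamma> (v (n + i))) (\<gamma> (v (n + Suc i))))) = partition_sum \<gamma> m u"
      unfolding v partition_sum_def ..
    also have "partition_sum \<gamma> n v = partition_sum \<gamma> n t"
      unfolding partition_sum_def by (intro sum.cong) (auto simp: v_def)
    finally have "partition_sum \<gamma> n t + partition_sum \<gamma> m u = partition_sum \<gamma> (n + m) v" by simp
    also have "\<dots> \<le> curve_length \<gamma> a c"
    proof (rule partition_sum_le_curve_length)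
      show "v 0 = a" "v (n + m) = c" using t u v[of m] by (auto simp: v_def)
      show "mono_on {..n + m} v"
      proof (rule mono_onI)
        fix i j assume ij: "i \<in> {..n + m}" "j \<in> {..n + m}" "i \<le> j"
        consider "j \<le> n" | "i \<le> n" "n < j" | "n < i" using ij by linarith
        then show "v i \<le> v j"
        proof cases
          case 1 then show ?thesis using ij mono_onD[OF t(3), of i j] by (auto simp: v_def)
        next
          case 2
          have "t i \<le> b" using mono_onD[OF t(3), of i n] 2 t by auto
          also have "b \<le> u (j - n)" using mono_onD[OF u(3), of 0 "j - n"] 2 u ij by auto
          finally show ?thesis using 2 by (simp add: v_def)
        next
          case 3 then show ?thesis using ij mono_onD[OF u(3), of "i - n" "j - n"] by (auto simp: v_def)
        qed
      qed
    qed
    finally show ?thesis .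
  qed
  have ne: "{(n::nat, t::nat \<Rightarrow> real). t 0 = a \<and> t n = b \<and> mono_on {..n} t} \<noteq> {}" if "a \<le> b" for a b
  proof -
    have "(1, \<lambda>i. if i = 0 then a else b) \<in> {(n::nat, t::nat \<Rightarrow> real). t 0 = a \<and> t n = b \<and> mono_on {..n} t}"
      using that by (auto simp: mono_on_def)
    then show ?thesis by blast
  qed
  have "partition_sum \<gamma> n t + curve_length \<gamma> b c \<le> curve_length \<gamma> a c"
    if t: "t 0 = a" "t n = b" "mono_on {..n} t" for n t
  proof -
    have "partition_sum \<gamma> n t + curve_length \<gamma> b c =
      (SUP (m, u) \<in> {(n::nat, t::nat \<Rightarrow> real). t 0 = b \<and> t n = c \<and> mono_on {..n} t}. partition_sum \<gamma> n t + partition_sum \<gamma> m u)"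
      unfolding curve_length_def partition_sum_def[symmetric] case_prod_beta
      by (rule ennreal_SUP_add_right) (use ne[OF assms(2)] in \<open>simp add: case_prod_beta\<close>)
    also have "\<dots> \<le> curve_length \<gamma> a c" using step[OF t] by (intro SUP_least) auto
    finally show ?thesis .
  qed
  then have "(SUP (n, t) \<in> {(n::nat, t::nat \<Rightarrow> real). t 0 = a \<and> t n = b \<and> mono_on {..n} t}.
      partition_sum \<gamma> n t + curve_length \<gamma> b c) \<le> curve_length \<gamma> a c"
    by (intro SUP_least) auto
  then show "curve_length \<gamma> a b + curve_length \<gamma> b c \<le> curve_length \<gamma> a c"
    unfolding curve_length_def[of \<gamma> a b] partition_sum_def[symmetric] case_prod_beta
    by (subst ennreal_SUP_add_left[symmetric]) (use ne[OF assms(1)] in \<open>simp_all add: case_prod_beta\<close>)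
qed

lemma arc_curve_lipschitz:
  assumes "arc_curve \<gamma> l"
  shows "1-lipschitz_on {0..l} \<gamma>"
proof (rule lipschitz_onI)
  have *: "dist (\<gamma> s) (\<gamma> t) \<le> t - s" if "0 \<le> s" "s \<le> t" "t \<le> l" for s t
  proof -
    have "ennreal (dist (\<gamma> s) (\<gamma> t)) \<le> ennreal (t - s)"
      using dist_le_curve_length[of s t \<gamma>] assms that unfolding arc_curve_def by metis
    then show ?thesis using that by (subst (asm) ennreal_le_iff) auto
  qed
  show "dist (\<gamma> s) (\<gamma> t) \<le> 1 * dist s t" if "s \<in> {0..l}" "t \<in> {0..l}" for s t
    using that *[of s t] *[of t s] by (cases "s \<le> t") (auto simp: dist_real_def dist_commute)
qed simp

lemma arc_curve_pos: "arc_curve \<gamma> l \<Longrightarrow> 0 < l"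
proof (rule ccontr)
  assume "arc_curve \<gamma> l" "\<not> 0 < l"
  then have "{0..l} = {} \<or> {0..l} = {0}" by (cases "l = 0") auto
  then have "\<gamma> constant_on {0..l}" by (auto simp: constant_on_def)
  with \<open>arc_curve \<gamma> l\<close> show False by (simp add: arc_curve_def)
qed

text \<open>\<open>s\<close> is the length function. It need not be injective, but the curve is
  constant on its fibres, so \<open>\<delta>\<close> does not depend on the choice of the right
  inverse \<open>\<sigma>\<close>. The Lipschitz bound on \<open>s\<close> is what keeps weighted
  integrals from growing under the change of parameter.\<close>

lemma arc_length_reparametrization:
  fixes \<gamma> :: "real \<Rightarrow> 'a::metric_space"
  assumes \<gamma>: "1-lipschitz_on {0..T} \<gamma>" and T: "0 \<le> T" and nc: "\<not> \<gamma> constant_on {0..T}"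
  obtains \<delta> l s where "arc_curve \<delta> l" "mono_on {0..T} s" "1-lipschitz_on {0..T} s" "s 0 = 0" "s T = l"
    "\<And>t. t \<in> {0..T} \<Longrightarrow> \<gamma> t = \<delta> (s t)"
proof -
  define s where "s t = enn2real (curve_length \<gamma> 0 t)" for t
  have le: "curve_length \<gamma> a b \<le> ennreal (b - a)" if "0 \<le> a" "b \<le> T" for a b
    using that by (intro curve_length_le_lipschitz lipschitz_on_subset[OF \<gamma>]) auto
  have Ls: "curve_length \<gamma> 0 t = ennreal (s t)" if "t \<in> {0..T}" for t
    unfolding s_def using le[of 0 t] that by (intro ennreal_enn2real[symmetric]) (auto simp: less_top intro: le_less_trans)
  have s0: "0 \<le> s t" for t unfolding s_def by simp
  have Lst: "curve_length \<gamma> a b = ennreal (s b - s a)" "s a \<le> s b" if "0 \<le> a" "a \<le> b" "b \<le> T" for a b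
  proof -
    have *: "ennreal (s b) = ennreal (s a) + curve_length \<gamma> a b"
      using curve_length_add[of 0 a b \<gamma>] that Ls[of a] Ls[of b] by simp
    obtain r where r: "0 \<le> r" "curve_length \<gamma> a b = ennreal r"
      using le[OF \<open>0 \<le> a\<close> \<open>b \<le> T\<close>] by (cases "curve_length \<gamma> a b") (auto simp: top_unique)
    then have "s b = s a + r"
      using * s0[of a] s0[of b] by (simp flip: ennreal_plus)
    then show "curve_length \<gamma> a b = ennreal (s b - s a)" "s a \<le> s b" using r by auto
  qed
  have sle: "s b - s a \<le> b - a" if "0 \<le> a" "a \<le> b" "b \<le> T" for a b
    using le[of a b] Lst[OF that] that by (auto simp: ennreal_le_iff2)
  have s_mono: "mono_on {0..T} s" using Lst(2) by (auto intro!: mono_onI)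
  have s_lip: "1-lipschitz_on {0..T} s"
  proof (rule lipschitz_onI)
    show "dist (s a) (s b) \<le> 1 * dist a b" if "a \<in> {0..T}" "b \<in> {0..T}" for a b
      using that sle[of a b] sle[of b a] Lst(2)[of a b] Lst(2)[of b a]
      by (cases "a \<le> b") (auto simp: dist_real_def)
  qed simp
  have s_zero: "s 0 = 0" using le[of 0 0] T Ls[of 0] s0[of 0] by simp
  define l where "l = s T"
  have "\<exists>t\<in>{0..T}. s t = u" if "u \<in> {0..l}" for u
    using IVT'[of s 0 u T] that T s_zero lipschitz_on_continuous_on[OF s_lip] unfolding l_def by auto
  then obtain \<sigma> where \<sigma>: "\<And>u. u \<in> {0..l} \<Longrightarrow> \<sigma> u \<in> {0..T}" "\<And>u. u \<in> {0..l} \<Longrightarrow> s (\<sigma> u) = u"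
    by metis
  define \<delta> where "\<delta> u = \<gamma> (\<sigma> u)" for u
  have sl: "s t \<in> {0..l}" if "t \<in> {0..T}" for t
    using that mono_onD[OF s_mono, of 0 t] mono_onD[OF s_mono, of t T] s_zero unfolding l_def by auto
  have same: "\<gamma> a = \<gamma> b" if "a \<in> {0..T}" "b \<in> {0..T}" "s a = s b" for a b
  proof -
    have "\<gamma> a = \<gamma> b" if "a \<in> {0..T}" "b \<in> {0..T}" "s a = s b" "a \<le> b" for a b
      using dist_le_curve_length[of a b \<gamma>] Lst(1)[of a b] that by simp
    then show ?thesis using that by (metis linear)
  qed
  have \<gamma>\<delta>: "\<gamma> t = \<delta> (s t)" if "t \<in> {0..T}" for t
    unfolding \<delta>_def using that \<sigma>[OF sl[OF that]] by (intro same) auto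
  have \<sigma>_mono: "mono_on {0..l} \<sigma>"
  proof (rule mono_onI, rule ccontr)
    fix u v assume uv: "u \<in> {0..l}" "v \<in> {0..l}" "u \<le> v" "\<not> \<sigma> u \<le> \<sigma> v"
    then have "v \<le> u" using mono_onD[OF s_mono, of "\<sigma> v" "\<sigma> u"] \<sigma> by auto
    then show False using uv by auto
  qed
  have len: "curve_length \<delta> u v = ennreal (v - u)" if "0 \<le> u" "u \<le> v" "v \<le> l" for u v
  proof (rule antisym)
    have uv: "u \<in> {0..l}" "v \<in> {0..l}" "\<sigma> u \<le> \<sigma> v" using that mono_onD[OF \<sigma>_mono, of u v] by auto
    have 1: "curve_length \<gamma> (\<sigma> u) (\<sigma> v) = ennreal (v - u)"
      using Lst(1)[of "\<sigma> u" "\<sigma> v"] \<sigma> uv by simp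
    have "curve_length \<delta> u v \<le> curve_length \<gamma> (\<sigma> u) (\<sigma> v)"
      using that by (intro curve_length_compose_le mono_on_subset[OF \<sigma>_mono]) (auto simp: \<delta>_def)
    then show "curve_length \<delta> u v \<le> ennreal (v - u)" using 1 by simp
    have "curve_length \<gamma> (\<sigma> u) (\<sigma> v) \<le> curve_length \<delta> (s (\<sigma> u)) (s (\<sigma> v))"
      using \<sigma>(1)[OF uv(1)] \<sigma>(1)[OF uv(2)]
      by (intro curve_length_compose_le mono_on_subset[OF s_mono]) (auto intro!: \<gamma>\<delta>)
    then show "ennreal (v - u) \<le> curve_length \<delta> u v" using 1 \<sigma>(2) uv by simp
  qed
  have "1-lipschitz_on {0..l} \<delta>"
  proof (rule lipschitz_onI)
    have *: "dist (\<delta> a) (\<delta> b) \<le> b - a" if "0 \<le> a" "a \<le> b" "b \<le> l" for a b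
      using dist_le_curve_length[of a b \<delta>] len[OF that] that by (auto simp: ennreal_le_iff2)
    show "dist (\<delta> a) (\<delta> b) \<le> 1 * dist a b" if "a \<in> {0..l}" "b \<in> {0..l}" for a b
      using that *[of a b] *[of b a] by (cases "a \<le> b") (auto simp: dist_real_def dist_commute)
  qed simp
  then have "continuous_on {0..l} \<delta>" by (rule lipschitz_on_continuous_on)
  moreover have "\<not> \<delta> constant_on {0..l}"
    using nc \<gamma>\<delta> sl unfolding constant_on_def by metis
  ultimately have "arc_curve \<delta> l" using len unfolding arc_curve_def by blast
  then show thesis using s_mono s_lip s_zero \<gamma>\<delta> by (intro that) (auto simp: l_def)
qed


section \<open>Integrals along curves under a change of parameter\<close>

lemma local_to_global_mono:
  fixes \<phi> :: "real \<Rightarrow> real"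
  assumes "a \<le> b" "0 < \<eta>"
    and loc: "\<And>s t. a \<le> s \<Longrightarrow> s \<le> t \<Longrightarrow> t \<le> b \<Longrightarrow> t - s < \<eta> \<Longrightarrow> \<phi> t \<le> \<phi> s"
  shows "\<phi> b \<le> \<phi> a"
proof -
  obtain m where m: "(b - a) / \<eta> < real m" using reals_Archimedean2 by blast
  have "0 \<le> (b - a) / \<eta>" using assms by simp
  then have m0: "0 < real m" using m by linarith
  define p where "p i = a + real i * ((b - a) / m)" for i
  have "\<phi> (p i) \<le> \<phi> a" if "i \<le> m" for i
    using that
  proof (induction i)
    case (Suc i)
    have "real (Suc i) * ((b - a) / m) \<le> real m * ((b - a) / m)"
      using Suc.prems assms(1) by (intro mult_right_mono) auto
    then have "p (Suc i) \<le> b" using m0 unfolding p_def by simp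
    moreover have "p (Suc i) - p i = (b - a) / m" unfolding p_def by (simp add: distrib_right del: times_divide_eq_right)
    moreover have "(b - a) / m < \<eta>" using m m0 assms by (simp add: field_simps)
    moreover have "a \<le> p i" "0 \<le> (b - a) / m" using assms(1) unfolding p_def by auto
    ultimately have "\<phi> (p (Suc i)) \<le> \<phi> (p i)" by (intro loc) auto
    then show ?case using Suc by simp
  qed (simp add: p_def)
  from this[of m] show ?thesis using m0 by (simp add: p_def)
qed

text \<open>Subtracting from \<open>u\<close> the integral of \<open>k\<close> and the slack
  \<open>2 * \<epsilon> * t\<close> leaves a function that does not increase over short distances,
  hence not at all. One \<open>\<epsilon>\<close> pays for the local bound, the other for the
  oscillation of \<open>k\<close>. Nothing is differentiated, so this applies to chain infima along
  curves.\<close>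

lemma increment_le_integral:
  fixes k u :: "real \<Rightarrow> real"
  assumes "a \<le> b" and k: "continuous_on {a..b} k"
    and loc: "\<And>\<epsilon>. 0 < \<epsilon> \<Longrightarrow> \<exists>\<eta>>0. \<forall>s t. a \<le> s \<longrightarrow> s \<le> t \<longrightarrow> t \<le> b \<longrightarrow> t - s < \<eta> \<longrightarrow> u t - u s \<le> (k s + \<epsilon>) * (t - s)"
  shows "u b - u a \<le> integral {a..b} k"
proof (rule field_le_epsilon)
  fix e :: real assume "0 < e"
  \<comment> \<open>The added 1 keeps the denominator positive when \<open>a = b\<close>.\<close>
  define \<epsilon> where "\<epsilon> = e / (2 * (b - a + 1))"
  have "0 < \<epsilon>" unfolding \<epsilon>_def using \<open>0 < e\<close> \<open>a \<le> b\<close> by simp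
  obtain \<eta>1 where \<eta>1: "\<eta>1 > 0" "\<And>s t. a \<le> s \<Longrightarrow> s \<le> t \<Longrightarrow> t \<le> b \<Longrightarrow> t - s < \<eta>1 \<Longrightarrow> u t - u s \<le> (k s + \<epsilon>) * (t - s)"
    using loc[OF \<open>0 < \<epsilon>\<close>] by blast
  have "uniformly_continuous_on {a..b} k" using k by (intro compact_uniformly_continuous) auto
  then obtain \<eta>2 where \<eta>2: "\<eta>2 > 0" "\<And>s t. s \<in> {a..b} \<Longrightarrow> t \<in> {a..b} \<Longrightarrow> \<bar>t - s\<bar> < \<eta>2 \<Longrightarrow> \<bar>k t - k s\<bar> < \<epsilon>"
    using \<open>0 < \<epsilon>\<close> unfolding uniformly_continuous_on_def dist_real_def by metis
  define \<phi> where "\<phi> t = u t - integral {a..t} k - 2 * \<epsilon> * t" for t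
  have "\<phi> b \<le> \<phi> a"
  proof (rule local_to_global_mono[OF \<open>a \<le> b\<close>, of "min \<eta>1 \<eta>2"])
    fix s t assume st: "a \<le> s" "s \<le> t" "t \<le> b" "t - s < min \<eta>1 \<eta>2"
    have int: "k integrable_on {a..t}"
      using st by (intro integrable_continuous_real continuous_on_subset[OF k]) auto
    have "(k s - \<epsilon>) * (t - s) = integral {s..t} (\<lambda>_. k s - \<epsilon>)" using st by simp
    also have "\<dots> \<le> integral {s..t} k"
    proof (rule integral_le)
      show "k integrable_on {s..t}"
        using st by (intro integrable_continuous_real continuous_on_subset[OF k]) auto
      show "k s - \<epsilon> \<le> k r" if "r \<in> {s..t}" for r
        using \<eta>2(2)[of s r] that st by auto
    qed auto
    also have "\<dots> = integral {a..t} k - integral {a..s} k"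
      using Henstock_Kurzweil_Integration.integral_combine[OF st(1,2) int] by simp
    finally show "\<phi> t \<le> \<phi> s" using \<eta>1(2)[of s t] st unfolding \<phi>_def by (simp add: algebra_simps)
  qed (use \<eta>1 \<eta>2 in auto)
  then have "u b - u a \<le> integral {a..b} k + 2 * \<epsilon> * (b - a)"
    unfolding \<phi>_def by (simp add: algebra_simps)
  also have "2 * \<epsilon> * (b - a) \<le> e"
    using \<open>0 < e\<close> \<open>a \<le> b\<close> unfolding \<epsilon>_def by (simp add: field_simps)
  finally show "u b - u a \<le> integral {a..b} k + e" by simp
qed

lemma nn_integral_interval_continuous:
  fixes k :: "real \<Rightarrow> real"
  assumes "continuous_on {a..b} k" "\<And>t. t \<in> {a..b} \<Longrightarrow> 0 \<le> k t"
  shows "(\<integral>\<^sup>+ t\<in>{a..b}. ennreal (k t) \<partial>lborel) = ennreal (integral {a..b} k)"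
  using assms by (intro nn_integral_has_integral_lebesgue' integrable_integral integrable_continuous_real)

lemma curve_integral_measurable:
  fixes \<gamma> :: "real \<Rightarrow> 'a::metric_space" and w :: "'a \<Rightarrow> ennreal"
  assumes "continuous_on {a..b} \<gamma>" "w \<in> borel_measurable borel"
  shows "(\<lambda>t. w (\<gamma> t) * indicator {a..b} t) \<in> borel_measurable lborel"
proof -
  have "(\<lambda>t. w (\<gamma> t)) \<in> borel_measurable (restrict_space borel {a..b})"
    using measurable_compose[OF borel_measurable_continuous_on_restrict[OF assms(1)] assms(2)] .
  then show ?thesis
    by (subst (asm) borel_measurable_restrict_space_iff_ennreal) auto
qed

text \<open>A substitution rule without derivatives of \<open>s\<close>: the integral of
  \<open>W\<close> along \<open>\<delta>\<close> up to time \<open>s t\<close> grows with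
  \<open>t\<close> at a rate of at most \<open>W (\<gamma> t)\<close>, because \<open>s\<close> is
  1-Lipschitz.\<close>

lemma curve_integral_reparametrization_le:
  fixes W :: "'a::metric_space \<Rightarrow> real"
  assumes W: "continuous_on UNIV W" "\<And>x. 0 \<le> W x" and "0 \<le> T"
    and s: "mono_on {0..T} s" "1-lipschitz_on {0..T} s" "s 0 = 0" "s T = l"
    and \<delta>: "continuous_on {0..l} \<delta>" and \<gamma>: "\<And>t. t \<in> {0..T} \<Longrightarrow> \<gamma> t = \<delta> (s t)"
  shows "curve_integral (\<lambda>x. ennreal (W x)) \<delta> l \<le> curve_integral (\<lambda>x. ennreal (W x)) \<gamma> T"
proof -
  have sl: "s t \<in> {0..l}" if "t \<in> {0..T}" for t
    using that mono_onD[OF s(1), of 0 t] mono_onD[OF s(1), of t T] s by auto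
  have sd: "s t - s r \<le> t - r" if "0 \<le> r" "r \<le> t" "t \<le> T" for r t
    using lipschitz_onD[OF s(2), of r t] that by (auto simp: dist_real_def)
  have W\<delta>: "continuous_on {0..l} (\<lambda>t. W (\<delta> t))"
    by (rule continuous_on_compose2[OF W(1) \<delta>]) auto
  have "continuous_on {0..T} (\<lambda>t. W (\<delta> (s t)))"
    using sl by (intro continuous_on_compose2[OF W\<delta> lipschitz_on_continuous_on[OF s(2)]]) auto
  then have W\<gamma>: "continuous_on {0..T} (\<lambda>t. W (\<gamma> t))"
    using \<gamma> by (subst continuous_on_cong[OF refl, of _ _ "\<lambda>t. W (\<delta> (s t))"]) auto
  define u where "u t = integral {0..s t} (\<lambda>r. W (\<delta> r))" for t
  have "u T - u 0 \<le> integral {0..T} (\<lambda>t. W (\<gamma> t))"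
  proof (rule increment_le_integral[OF \<open>0 \<le> T\<close> W\<gamma>])
    fix \<epsilon> :: real assume "0 < \<epsilon>"
    have "uniformly_continuous_on {0..l} (\<lambda>r. W (\<delta> r))" using W\<delta> by (intro compact_uniformly_continuous) auto
    then obtain \<eta> where \<eta>: "\<eta> > 0" "\<And>r t. r \<in> {0..l} \<Longrightarrow> t \<in> {0..l} \<Longrightarrow> \<bar>t - r\<bar> < \<eta> \<Longrightarrow> \<bar>W (\<delta> t) - W (\<delta> r)\<bar> < \<epsilon>"
      using \<open>0 < \<epsilon>\<close> unfolding uniformly_continuous_on_def dist_real_def by metis
    have "u t - u r \<le> (W (\<gamma> r) + \<epsilon>) * (t - r)" if rt: "0 \<le> r" "r \<le> t" "t \<le> T" "t - r < \<eta>" for r t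
    proof -
      have srt: "s r \<le> s t" "0 \<le> s r" "s t \<le> l" "s t - s r < \<eta>"
        using mono_onD[OF s(1), of r t] sl[of r] sl[of t] sd[of r t] rt by auto
      have "u t - u r = integral {s r..s t} (\<lambda>r. W (\<delta> r))"
        unfolding u_def
        using Henstock_Kurzweil_Integration.integral_combine[OF srt(2,1), of "\<lambda>r. W (\<delta> r)"]
          integrable_continuous_real[OF continuous_on_subset[OF W\<delta>, of "{0..s t}"]] srt
        by auto
      also have "\<dots> \<le> integral {s r..s t} (\<lambda>_. W (\<gamma> r) + \<epsilon>)"
      proof (rule integral_le)
        show "(\<lambda>r. W (\<delta> r)) integrable_on {s r..s t}"
          using srt by (intro integrable_continuous_real continuous_on_subset[OF W\<delta>]) auto
        show "W (\<delta> q) \<le> W (\<gamma> r) + \<epsilon>" if "q \<in> {s r..s t}" for q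
          using \<eta>(2)[of "s r" q] that srt \<gamma>[of r] rt by auto
      qed auto
      also have "\<dots> = (W (\<gamma> r) + \<epsilon>) * (s t - s r)" using srt by simp
      also have "\<dots> \<le> (W (\<gamma> r) + \<epsilon>) * (t - r)"
        using W(2)[of "\<gamma> r"] \<open>0 < \<epsilon>\<close> sd[of r t] rt by (intro mult_left_mono) auto
      finally show ?thesis .
    qed
    then show "\<exists>\<eta>>0. \<forall>r t. 0 \<le> r \<longrightarrow> r \<le> t \<longrightarrow> t \<le> T \<longrightarrow> t - r < \<eta> \<longrightarrow> u t - u r \<le> (W (\<gamma> r) + \<epsilon>) * (t - r)"
      using \<eta>(1) by blast
  qed
  then have "integral {0..l} (\<lambda>r. W (\<delta> r)) \<le> integral {0..T} (\<lambda>t. W (\<gamma> t))"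
    unfolding u_def using s by simp
  then show ?thesis
    unfolding curve_integral_def
    using W\<delta> W\<gamma> W(2) by (subst (1 2) nn_integral_interval_continuous) (auto intro: ennreal_leI)
qed

text \<open>A lower semicontinuous weight is carried as an increasing sequence of continuous
  functions, not just as its supremum \<open>weight W\<close>: chain infima are formed with the
  individual \<open>W n\<close>, whose continuity makes them continuous.\<close>

definition weight_seq :: "(nat \<Rightarrow> 'a::metric_space \<Rightarrow> real) \<Rightarrow> bool" where
  "weight_seq W \<longleftrightarrow> (\<forall>n. continuous_on UNIV (W n)) \<and> (\<forall>n x. 0 \<le> W n x) \<and> (\<forall>x. incseq (\<lambda>n. W n x))"

definition weight :: "(nat \<Rightarrow> 'a::metric_space \<Rightarrow> real) \<Rightarrow> 'a \<Rightarrow> ennreal" where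
  "weight W x = (SUP n. ennreal (W n x))"

lemma weight_seqD:
  assumes "weight_seq W"
  shows "continuous_on UNIV (W n)" "0 \<le> W n x" "n \<le> m \<Longrightarrow> W n x \<le> W m x" "W n \<in> borel_measurable borel"
  using assms by (auto simp: weight_seq_def incseq_def intro: borel_measurable_continuous_onI)

lemma borel_measurable_weight: "weight_seq W \<Longrightarrow> weight W \<in> borel_measurable borel"
  unfolding weight_def by (intro borel_measurable_SUP measurable_compose[OF weight_seqD(4) measurable_ennreal]) auto

lemma weight_upper: "ennreal (W n x) \<le> weight W x"
  unfolding weight_def by (rule SUP_upper) simp

lemma curve_integral_weight:
  assumes W: "weight_seq W" and \<gamma>: "continuous_on {0..T} \<gamma>"
  shows "curve_integral (weight W) \<gamma> T = (SUP n. curve_integral (\<lambda>x. ennreal (W n x)) \<gamma> T)"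
proof -
  have "curve_integral (weight W) \<gamma> T = (\<integral>\<^sup>+ t. (SUP n. ennreal (W n (\<gamma> t)) * indicator {0..T} t) \<partial>lborel)"
    unfolding curve_integral_def weight_def by (intro nn_integral_cong) (auto simp: indicator_def)
  also have "\<dots> = (SUP n. curve_integral (\<lambda>x. ennreal (W n x)) \<gamma> T)"
    unfolding curve_integral_def
  proof (rule nn_integral_monotone_convergence_SUP)
    show "incseq (\<lambda>n t. ennreal (W n (\<gamma> t)) * indicator {0..T} t)"
      using weight_seqD(3)[OF W] by (auto simp: incseq_def le_fun_def intro!: mult_right_mono ennreal_leI)
    show "(\<lambda>t. ennreal (W n (\<gamma> t)) * indicator {0..T} t) \<in> borel_measurable lborel" for n
      using weight_seqD(4)[OF W] by (intro curve_integral_measurable[OF \<gamma>, of "\<lambda>x. ennreal (W n x)"]) auto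
  qed
  finally show ?thesis .
qed

text \<open>The bridge from Lipschitz curves, which are easy to concatenate and to obtain as limits,
  to the arc-length curves of which path openness speaks. Of \<open>s\<close> mainly the continuity
  is retained; it suffices to follow points of the original curve.\<close>

lemma ex_arc_curve_reparametrization:
  fixes \<gamma> :: "real \<Rightarrow> 'a::metric_space"
  assumes W: "weight_seq W" and \<gamma>: "1-lipschitz_on {0..T} \<gamma>" and T: "0 \<le> T" and nc: "\<not> \<gamma> constant_on {0..T}"
  obtains \<delta> l s where "arc_curve \<delta> l" "continuous_on {0..T} s" "s 0 = 0" "s ` {0..T} \<subseteq> {0..l}"
    "\<And>t. t \<in> {0..T} \<Longrightarrow> \<gamma> t = \<delta> (s t)" "curve_integral (weight W) \<delta> l \<le> curve_integral (weight W) \<gamma> T"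
proof -
  obtain \<delta> l s where *: "arc_curve \<delta> l" "mono_on {0..T} s" "1-lipschitz_on {0..T} s" "s 0 = 0" "s T = l"
    "\<And>t. t \<in> {0..T} \<Longrightarrow> \<gamma> t = \<delta> (s t)"
    using arc_length_reparametrization[OF \<gamma> T nc] by metis
  have \<delta>: "continuous_on {0..l} \<delta>" using *(1) by (simp add: arc_curve_def)
  have "curve_integral (weight W) \<delta> l \<le> curve_integral (weight W) \<gamma> T"
    unfolding curve_integral_weight[OF W \<delta>] curve_integral_weight[OF W lipschitz_on_continuous_on[OF \<gamma>]]
    using weight_seqD[OF W] T * \<delta> by (intro SUP_mono' curve_integral_reparametrization_le) auto
  moreover have "s ` {0..T} \<subseteq> {0..l}"
    using mono_onD[OF *(2), of 0] mono_onD[OF *(2), of _ T] *(4,5) T by auto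
  ultimately show thesis using * by (intro that[of \<delta> l s]) (auto intro: lipschitz_on_continuous_on)
qed

section \<open>Chains\<close>

definition is_chain :: "real \<Rightarrow> 'a::metric_space set \<Rightarrow> 'a \<Rightarrow> nat \<Rightarrow> (nat \<Rightarrow> 'a) \<Rightarrow> bool" where
  "is_chain \<delta> F x m c \<longleftrightarrow> c 0 = x \<and> c m \<in> F \<and> (\<forall>i<m. dist (c i) (c (Suc i)) < \<delta>)"

text \<open>A Riemann sum with the weight taken at the start of each jump, so that prepending a
  point costs an amount depending only on the weight there and the length of the jump.\<close>

definition chain_cost :: "('a::metric_space \<Rightarrow> real) \<Rightarrow> nat \<Rightarrow> (nat \<Rightarrow> 'a) \<Rightarrow> real" where
  "chain_cost W m c = (\<Sum>i<m. W (c i) * dist (c i) (c (Suc i)))"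

text \<open>The cap \<open>N\<close> also keeps the set nonempty when no chain reaches
  \<open>F\<close>.\<close>

definition chain_inf :: "real \<Rightarrow> ('a::metric_space \<Rightarrow> real) \<Rightarrow> real \<Rightarrow> 'a set \<Rightarrow> 'a \<Rightarrow> real" where
  "chain_inf N W \<delta> F x = Inf (insert N {chain_cost W m c | m c. is_chain \<delta> F x m c})"

lemma chain_cost_nonneg: "(\<And>x. 0 \<le> W x) \<Longrightarrow> 0 \<le> chain_cost W m c"
  unfolding chain_cost_def by (intro sum_nonneg mult_nonneg_nonneg) auto

lemma chain_inf_greatest:
  assumes "b \<le> N" "\<And>m c. is_chain \<delta> F x m c \<Longrightarrow> b \<le> chain_cost W m c"
  shows "b \<le> chain_inf N W \<delta> F x"
  unfolding chain_inf_def using assms by (intro cInf_greatest) auto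

lemma chain_inf_bdd: "(\<And>x. 0 \<le> W x) \<Longrightarrow> bdd_below (insert N {chain_cost W m c | m c. is_chain \<delta> F x m c})"
  using chain_cost_nonneg[of W] by (intro bdd_belowI[of _ "min N 0"]) (auto simp: min_le_iff_disj)

lemma chain_inf_le_N: "(\<And>x. 0 \<le> W x) \<Longrightarrow> chain_inf N W \<delta> F x \<le> N"
  unfolding chain_inf_def by (intro cInf_lower chain_inf_bdd) auto

lemma chain_inf_le_cost: "(\<And>x. 0 \<le> W x) \<Longrightarrow> is_chain \<delta> F x m c \<Longrightarrow> chain_inf N W \<delta> F x \<le> chain_cost W m c"
  unfolding chain_inf_def by (intro cInf_lower chain_inf_bdd) auto

lemma chain_inf_nonneg: "(\<And>x. 0 \<le> W x) \<Longrightarrow> 0 \<le> N \<Longrightarrow> 0 \<le> chain_inf N W \<delta> F x"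
  by (rule chain_inf_greatest) (auto simp: chain_cost_nonneg)

lemma chain_inf_eq_0: "(\<And>x. 0 \<le> W x) \<Longrightarrow> 0 \<le> N \<Longrightarrow> x \<in> F \<Longrightarrow> chain_inf N W \<delta> F x = 0"
  using chain_inf_le_cost[of W \<delta> F x 0 "\<lambda>_. x" N] chain_inf_nonneg[of W N \<delta> F x]
  by (auto simp: is_chain_def chain_cost_def)

lemma chain_inf_step:
  assumes "\<And>x. 0 \<le> W x" "dist x y < \<delta>"
  shows "chain_inf N W \<delta> F x \<le> W x * dist x y + chain_inf N W \<delta> F y"
proof -
  have "chain_inf N W \<delta> F x - W x * dist x y \<le> chain_inf N W \<delta> F y"
  proof (rule chain_inf_greatest)
    show "chain_inf N W \<delta> F x - W x * dist x y \<le> N"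
      using chain_inf_le_N[of W N \<delta> F x, OF assms(1)] mult_nonneg_nonneg[OF assms(1)[of x] zero_le_dist[of x y]] by linarith
    fix m c assume c: "is_chain \<delta> F y m c"
    define d where "d = case_nat x c"
    have "is_chain \<delta> F x (Suc m) d"
      using c assms(2) unfolding is_chain_def d_def by (auto simp: less_Suc_eq_0_disj)
    then have "chain_inf N W \<delta> F x \<le> chain_cost W (Suc m) d" using assms by (intro chain_inf_le_cost)
    also have "\<dots> = W x * dist x y + chain_cost W m c"
      using c unfolding chain_cost_def d_def is_chain_def by (subst sum.lessThan_Suc_shift) auto
    finally show "chain_inf N W \<delta> F x - W x * dist x y \<le> chain_cost W m c" by simp
  qed
  then show ?thesis by simp
qed

lemma chain_inf_mono:
  assumes "\<And>x. 0 \<le> W x" "\<And>x. W x \<le> W' x" "\<delta>' \<le> \<delta>"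
  shows "chain_inf N W \<delta> F x \<le> chain_inf N W' \<delta>' F x"
proof (rule chain_inf_greatest)
  show "chain_inf N W \<delta> F x \<le> N" using assms by (intro chain_inf_le_N)
  fix m c assume "is_chain \<delta>' F x m c"
  then have "is_chain \<delta> F x m c" using assms(3) unfolding is_chain_def by force
  then have "chain_inf N W \<delta> F x \<le> chain_cost W m c" using assms by (intro chain_inf_le_cost)
  also have "\<dots> \<le> chain_cost W' m c"
    unfolding chain_cost_def using assms by (intro sum_mono mult_right_mono) auto
  finally show "chain_inf N W \<delta> F x \<le> chain_cost W' m c" .
qed

text \<open>Points closer than \<open>\<delta>\<close> are joined by one jump in either direction,
  and near \<open>x\<close> the weight stays below \<open>W x + 1\<close>.\<close>

lemma continuous_on_chain_inf:
  assumes W: "continuous_on UNIV W" "\<And>x. 0 \<le> W x" and "0 < \<delta>"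
  shows "continuous_on UNIV (chain_inf N W \<delta> F)"
proof -
  have "isCont (chain_inf N W \<delta> F) x" for x
  proof -
    have "isCont W x" using W(1) by (simp add: continuous_on_eq_continuous_at)
    then have "\<forall>\<^sub>F y in at x. W y < W x + 1"
      unfolding isCont_def by (rule order_tendstoD) simp
    moreover have "\<forall>\<^sub>F y in at x. dist y x < \<delta>"
      using \<open>0 < \<delta>\<close> by (auto simp: eventually_at)
    ultimately have "\<forall>\<^sub>F y in at x. dist (chain_inf N W \<delta> F y) (chain_inf N W \<delta> F x) \<le> (W x + 1) * dist y x"
    proof eventually_elim
      case (elim y)
      have "W y * dist y x \<le> (W x + 1) * dist y x" "W x * dist y x \<le> (W x + 1) * dist y x"
        using elim by (auto intro!: mult_right_mono)
      then show ?case
        using chain_inf_step[of W x y \<delta> N F] chain_inf_step[of W y x \<delta> N F] elim W(2)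
        by (auto simp: dist_real_def dist_commute abs_le_iff)
    qed
    moreover have "((\<lambda>y. (W x + 1) * dist y x) \<longlongrightarrow> 0) (at x)"
      by (rule tendsto_eq_intros refl | simp)+
    ultimately have "((\<lambda>y. dist (chain_inf N W \<delta> F y) (chain_inf N W \<delta> F x)) \<longlongrightarrow> 0) (at x)"
    proof -
      assume "\<forall>\<^sub>F y in at x. dist (chain_inf N W \<delta> F y) (chain_inf N W \<delta> F x) \<le> (W x + 1) * dist y x"
      then have "\<forall>\<^sub>F y in at x. norm (dist (chain_inf N W \<delta> F y) (chain_inf N W \<delta> F x)) \<le> (W x + 1) * dist y x"
        by simp
      moreover assume "((\<lambda>y. (W x + 1) * dist y x) \<longlongrightarrow> 0) (at x)"
      ultimately show ?thesis by (rule Lim_null_comparison)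
    qed
    then show ?thesis unfolding isCont_def by (rule iffD2[OF tendsto_dist_iff])
  qed
  then show ?thesis by (simp add: continuous_on_eq_continuous_at)
qed

text \<open>Short pieces of a 1-Lipschitz curve are admissible jumps, which bounds the increments
  over short times by weight times duration; \<open>increment_le_integral\<close> adds them
  up.\<close>

lemma chain_inf_gradient:
  fixes \<gamma> :: "real \<Rightarrow> 'a::metric_space"
  assumes W: "continuous_on UNIV W" "\<And>x. 0 \<le> W x" and "0 < \<delta>" "a \<le> b" and \<gamma>: "1-lipschitz_on {a..b} \<gamma>"
  shows "ennreal \<bar>chain_inf N W \<delta> F (\<gamma> a) - chain_inf N W \<delta> F (\<gamma> b)\<bar> \<le> (\<integral>\<^sup>+ t\<in>{a..b}. ennreal (W (\<gamma> t)) \<partial>lborel)"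
proof -
  define v where "v t = chain_inf N W \<delta> F (\<gamma> t)" for t
  have W\<gamma>: "continuous_on {a..b} (\<lambda>t. W (\<gamma> t))"
    by (rule continuous_on_compose2[OF W(1) lipschitz_on_continuous_on[OF \<gamma>]]) auto
  have loc: "v s - v t \<le> W (\<gamma> s) * \<bar>t - s\<bar>" if "s \<in> {a..b}" "t \<in> {a..b}" "\<bar>t - s\<bar> < \<delta>" for s t
  proof -
    have d: "dist (\<gamma> s) (\<gamma> t) \<le> \<bar>t - s\<bar>" using lipschitz_onD[OF \<gamma>, of s t] that by (auto simp: dist_real_def)
    then have "v s - v t \<le> W (\<gamma> s) * dist (\<gamma> s) (\<gamma> t)"
      using chain_inf_step[of W "\<gamma> s" "\<gamma> t" \<delta> N F] W(2) that unfolding v_def by simp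
    also have "\<dots> \<le> W (\<gamma> s) * \<bar>t - s\<bar>" using d W(2) by (intro mult_left_mono)
    finally show ?thesis .
  qed
  have "- v b - - v a \<le> integral {a..b} (\<lambda>t. W (\<gamma> t))"
  proof (rule increment_le_integral[OF \<open>a \<le> b\<close> W\<gamma>])
    fix \<epsilon> :: real assume "0 < \<epsilon>"
    have "- v t - - v s \<le> (W (\<gamma> s) + \<epsilon>) * (t - s)" if st: "a \<le> s" "s \<le> t" "t \<le> b" "t - s < \<delta>" for s t
    proof -
      have "W (\<gamma> s) * (t - s) \<le> (W (\<gamma> s) + \<epsilon>) * (t - s)" using st \<open>0 < \<epsilon>\<close> by (intro mult_right_mono) auto
      then show ?thesis using loc[of s t] st by auto
    qed
    then show "\<exists>\<eta>>0. \<forall>s t. a \<le> s \<longrightarrow> s \<le> t \<longrightarrow> t \<le> b \<longrightarrow> t - s < \<eta> \<longrightarrow> - v t - - v s \<le> (W (\<gamma> s) + \<epsilon>) * (t - s)"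
      using \<open>0 < \<delta>\<close> by blast
  qed
  moreover have "v b - v a \<le> integral {a..b} (\<lambda>t. W (\<gamma> t))"
  proof (rule increment_le_integral[OF \<open>a \<le> b\<close> W\<gamma>])
    fix \<epsilon> :: real assume "0 < \<epsilon>"
    have "uniformly_continuous_on {a..b} (\<lambda>r. W (\<gamma> r))" using W\<gamma> by (intro compact_uniformly_continuous) auto
    then obtain \<eta> where \<eta>: "\<eta> > 0" "\<And>r t. r \<in> {a..b} \<Longrightarrow> t \<in> {a..b} \<Longrightarrow> \<bar>t - r\<bar> < \<eta> \<Longrightarrow> \<bar>W (\<gamma> t) - W (\<gamma> r)\<bar> < \<epsilon>"
      using \<open>0 < \<epsilon>\<close> unfolding uniformly_continuous_on_def dist_real_def by metis
    have "v t - v s \<le> (W (\<gamma> s) + \<epsilon>) * (t - s)" if st: "a \<le> s" "s \<le> t" "t \<le> b" "t - s < min \<delta> \<eta>" for s t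
    proof -
      \<comment> \<open>In this direction the jump starts at the later time \<open>t\<close>, and
        the weight there has to be compared with the one at \<open>s\<close>.\<close>
      have "W (\<gamma> t) \<le> W (\<gamma> s) + \<epsilon>" using \<eta>(2)[of s t] st by auto
      then have "W (\<gamma> t) * (t - s) \<le> (W (\<gamma> s) + \<epsilon>) * (t - s)" using st by (intro mult_right_mono) auto
      then show ?thesis using loc[of t s] st by auto
    qed
    then show "\<exists>\<eta>>0. \<forall>s t. a \<le> s \<longrightarrow> s \<le> t \<longrightarrow> t \<le> b \<longrightarrow> t - s < \<eta> \<longrightarrow> v t - v s \<le> (W (\<gamma> s) + \<epsilon>) * (t - s)"
      using \<open>0 < \<delta>\<close> \<eta>(1) by (intro exI[of _ "min \<delta> \<eta>"]) simp
  qed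
  ultimately have "\<bar>v a - v b\<bar> \<le> integral {a..b} (\<lambda>t. W (\<gamma> t))" by linarith
  then show ?thesis
    unfolding v_def using nn_integral_interval_continuous[OF W\<gamma> W(2)] by (simp add: ennreal_leI)
qed

text \<open>The chain is read as a step function of the distance travelled: it waits at
  \<open>c i\<close> for as long as the next jump is. The cost thereby becomes the integral of a
  function \<open>g\<close> dominating the weight along the way, to which Fatou's lemma can be
  applied.\<close>

lemma chain_step_function:
  fixes c :: "nat \<Rightarrow> 'a::metric_space"
  assumes W: "\<And>x. 0 \<le> W x" and c: "\<And>i. i < m \<Longrightarrow> dist (c i) (c (Suc i)) < \<delta>" and "0 < \<delta>"
  defines "L \<equiv> \<Sum>i<m. dist (c i) (c (Suc i))"
  obtains \<gamma> g where "\<gamma> 0 = c 0" "\<And>t. 0 \<le> t \<Longrightarrow> dist (c 0) (\<gamma> t) \<le> L"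
    "\<And>s t. 0 \<le> s \<Longrightarrow> s \<le> t \<Longrightarrow> dist (\<gamma> s) (\<gamma> t) \<le> t - s + \<delta>" "\<gamma> L = c m"
    "g \<in> borel_measurable borel" "(\<integral>\<^sup>+ t. g t \<partial>lborel) \<le> ennreal (chain_cost W m c)"
    "\<And>t. 0 \<le> t \<Longrightarrow> t < L \<Longrightarrow> ennreal (W (\<gamma> t)) \<le> g t"
proof -
  define S where "S i = (\<Sum>j<i. dist (c j) (c (Suc j)))" for i
  have S_Suc: "S (Suc i) = S i + dist (c i) (c (Suc i))" for i unfolding S_def by simp
  have S0: "S 0 = 0" unfolding S_def by simp
  have SL: "S m = L" unfolding S_def L_def ..
  have S_dist: "dist (c i) (c j) \<le> S j - S i" if "i \<le> j" for i j
    using that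
  proof (induction rule: dec_induct)
    case (step n)
    then show ?case using dist_triangle[of "c i" "c (Suc n)" "c n"] by (simp add: S_Suc)
  qed simp
  have S_mono: "S i \<le> S j" if "i \<le> j" for i j
    using S_dist[OF that] zero_le_dist[of "c i" "c j"] by linarith
  \<comment> \<open>The greatest index skips over repeated points of the chain; from time
    \<open>L\<close> on the step function stays at \<open>c m\<close>.\<close>
  define idx where "idx t = (GREATEST i. i \<le> m \<and> S i \<le> t)" for t
  have idx: "idx t \<le> m" "S (idx t) \<le> t" if "0 \<le> t" for t
    using GreatestI_nat[of "\<lambda>i. i \<le> m \<and> S i \<le> t" 0 m] that S0 unfolding idx_def by auto
  have idx_ge: "i \<le> idx t" if "i \<le> m" "S i \<le> t" for i t
    unfolding idx_def using Greatest_le_nat[of "\<lambda>i. i \<le> m \<and> S i \<le> t" i m] that by auto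
  have idx_less: "t < S (Suc (idx t))" if "0 \<le> t" "idx t < m" for t
    using idx_ge[of "Suc (idx t)" t] that by force
  define \<gamma> where "\<gamma> t = c (idx t)" for t
  define g where "g t = (\<Sum>i<m. ennreal (W (c i)) * indicator {S i..<S (Suc i)} t)" for t
  show thesis
  proof
    have "dist (c 0) (c (idx 0)) \<le> 0" using S_dist[of 0 "idx 0", OF le0] idx(2)[of 0, OF order_refl] S0 by linarith
    then show "\<gamma> 0 = c 0" unfolding \<gamma>_def by simp
    show "dist (c 0) (\<gamma> t) \<le> L" if "0 \<le> t" for t
      using S_dist[of 0 "idx t"] S_mono[of "idx t" m] idx[OF that] S0 SL unfolding \<gamma>_def by simp
    show "\<gamma> L = c m"
      using idx[of L] idx_ge[of m L] S_mono[of 0 m] SL S0 unfolding \<gamma>_def by simp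
    show "dist (\<gamma> s) (\<gamma> t) \<le> t - s + \<delta>" if st: "0 \<le> s" "s \<le> t" for s t
    proof -
      have le: "idx s \<le> idx t" using idx[of s] st by (intro idx_ge) auto
      show ?thesis
      proof (cases "idx s = idx t")
        case True then show ?thesis using st \<open>0 < \<delta>\<close> unfolding \<gamma>_def by simp
      next
        case False
        then have "idx s < m" using le idx(1)[of t] st by linarith
        then show ?thesis
          using S_dist[OF le] idx(2)[of t] idx_less[of s] S_Suc[of "idx s"] c[of "idx s"] st
          unfolding \<gamma>_def by auto
      qed
    qed
    show "g \<in> borel_measurable borel" unfolding g_def by measurable
    have "(\<integral>\<^sup>+ t. g t \<partial>lborel) = (\<Sum>i<m. \<integral>\<^sup>+ t. ennreal (W (c i)) * indicator {S i..<S (Suc i)} t \<partial>lborel)"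
      unfolding g_def by (rule nn_integral_sum) auto
    also have "\<dots> = (\<Sum>i<m. ennreal (W (c i) * dist (c i) (c (Suc i))))"
      using S_mono[of _ "Suc _"] W
      by (intro sum.cong refl) (simp add: nn_integral_cmult_indicator S_Suc ennreal_mult)
    also have "\<dots> = ennreal (chain_cost W m c)"
      unfolding chain_cost_def using W by (intro sum_ennreal) auto
    finally show "(\<integral>\<^sup>+ t. g t \<partial>lborel) \<le> ennreal (chain_cost W m c)" by simp
    show "ennreal (W (\<gamma> t)) \<le> g t" if t: "0 \<le> t" "t < L" for t
    proof -
      have "idx t \<noteq> m" using idx[OF t(1)] t(2) SL by auto
      then have i: "idx t < m" using idx(1)[OF t(1)] by simp
      have "ennreal (W (\<gamma> t)) = ennreal (W (c (idx t))) * indicator {S (idx t)..<S (Suc (idx t))} t"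
        using idx[OF t(1)] idx_less[OF t(1) i] unfolding \<gamma>_def by simp
      also have "\<dots> \<le> g t"
        unfolding g_def
        by (rule member_le_sum[of "idx t" "{..<m}" "\<lambda>i. ennreal (W (c i)) * indicator {S i..<S (Suc i)} t"]) (use i in auto)
      finally show ?thesis .
    qed
  qed
qed


section \<open>From chains to a limit curve\<close>

lemma diagonal_subsequence:
  fixes f :: "nat \<Rightarrow> nat \<Rightarrow> 'a::metric_space"
  assumes "compact K" "\<And>n k. f n k \<in> K"
  obtains r where "strict_mono r" "\<And>k. convergent (\<lambda>i. f (r i) k)"
proof -
  interpret subseqs "\<lambda>k s. convergent (\<lambda>i. f (s i) k)"
  proof
    fix k and s :: "nat \<Rightarrow> nat"
    have "\<forall>n. f (s n) k \<in> K" using assms by blast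
    then obtain l r' where "strict_mono r'" "((\<lambda>n. f (s n) k) \<circ> r') \<longlonglongrightarrow> l"
      using compact_imp_seq_compact[OF assms(1)] unfolding seq_compact_def by meson
    then show "\<exists>r'. strict_mono r' \<and> convergent (\<lambda>i. f ((s \<circ> r') i) k)"
      by (auto simp: o_def convergent_def)
  qed
  have "convergent (\<lambda>i. f ((diagseq \<circ> ((+) (Suc k))) i) k)" for k
  proof (rule diagseq_holds)
    fix r s :: "nat \<Rightarrow> nat" and n assume "strict_mono r" "convergent (\<lambda>i. f (s i) n)"
    then show "convergent (\<lambda>i. f ((s \<circ> r) i) n)"
      using convergent_subseq_convergent[of "\<lambda>i. f (s i) n" r] by (simp add: o_def)
  qed
  then have "convergent (\<lambda>i. f (diagseq (i + Suc k)) k)" for k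
    unfolding o_def by (subst add.commute)
  then have "convergent (\<lambda>i. f (diagseq i) k)" for k
    using convergent_ignore_initial_segment[of "\<lambda>i. f (diagseq i) k" "Suc k"] by simp
  then show thesis using that subseq_diagseq by blast
qed

text \<open>Arzela-Ascoli for step functions that are 1-Lipschitz up to an error
  \<open>\<delta> n\<close> tending to 0. The weights are at least 1, so the lengths are at most
  \<open>a + 1\<close> and everything stays in one compact ball. Convergence on the rationals
  extends to all times by the approximate Lipschitz bound and completeness, and Fatou's lemma
  controls the weighted integral.\<close>

lemma chains_limit_curve:
  fixes W :: "nat \<Rightarrow> 'a::complete_space \<Rightarrow> real"
  assumes proper: "\<And>y r. compact (cball (y :: 'a) r)"
    and W: "weight_seq W" "\<And>n x. 1 \<le> W n x" and "closed F" "a < N" "0 \<le> N"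
    and a: "\<And>n. chain_inf N (W n) (1 / real (Suc n)) F x \<le> a"
  obtains \<gamma> T where "0 \<le> T" "1-lipschitz_on {0..T} \<gamma>" "\<gamma> 0 = x" "\<gamma> T \<in> F"
    "curve_integral (weight W) \<gamma> T \<le> ennreal a"
proof -
  define \<delta> where "\<delta> n = 1 / real (Suc n)" for n
  have \<delta>0: "0 < \<delta> n" "\<delta> n \<le> 1" for n unfolding \<delta>_def by auto
  have \<delta>_lim: "\<delta> \<longlonglongrightarrow> 0" unfolding \<delta>_def by (rule LIMSEQ_Suc[OF lim_1_over_n])
  have W0: "0 \<le> W n y" for n y using weight_seqD(2)[OF W(1)] .
  have a0: "0 \<le> a" using a[of 0] chain_inf_nonneg[of "W 0" N "1 / real (Suc 0)" F x] W0 \<open>0 \<le> N\<close> by fastforce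
  \<comment> \<open>Because \<open>a < N\<close>, the infimum is not merely the cap, and chains that
    almost attain it exist.\<close>
  have "\<exists>m c. is_chain (\<delta> n) F x m c \<and> chain_cost (W n) m c < a + \<delta> n" for n
  proof (rule ccontr)
    assume *: "\<nexists>m c. is_chain (\<delta> n) F x m c \<and> chain_cost (W n) m c < a + \<delta> n"
    have "min N (a + \<delta> n) \<le> chain_inf N (W n) (\<delta> n) F x"
      using * by (intro chain_inf_greatest) (auto simp: not_less min_le_iff_disj)
    also have "\<dots> \<le> a" using a[of n] unfolding \<delta>_def .
    finally show False using \<open>a < N\<close> \<delta>0[of n] by auto
  qed
  then obtain m c where mc: "\<And>n. is_chain (\<delta> n) F x (m n) (c n)" "\<And>n. chain_cost (W n) (m n) (c n) < a + \<delta> n"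
    by metis
  define L where "L n = (\<Sum>i<m n. dist (c n i) (c n (Suc i)))" for n
  have L0: "0 \<le> L n" for n unfolding L_def by (intro sum_nonneg) auto
  have LA: "L n \<le> a + 1" for n
  proof -
    have "L n \<le> chain_cost (W n) (m n) (c n)"
      unfolding L_def chain_cost_def using W(2) by (intro sum_mono) (simp add: mult_left_le_one_le mult_le_cancel_right1)
    then show ?thesis using mc(2)[of n] \<delta>0[of n] by linarith
  qed
  have "\<exists>\<gamma> g. \<gamma> 0 = x \<and> (\<forall>t\<ge>0. dist x (\<gamma> t) \<le> L n) \<and>
    (\<forall>s t. 0 \<le> s \<longrightarrow> s \<le> t \<longrightarrow> dist (\<gamma> s) (\<gamma> t) \<le> t - s + \<delta> n) \<and> \<gamma> (L n) \<in> F \<and>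
    g \<in> borel_measurable borel \<and> (\<integral>\<^sup>+ t. g t \<partial>lborel) \<le> ennreal (a + \<delta> n) \<and>
    (\<forall>t. 0 \<le> t \<longrightarrow> t < L n \<longrightarrow> ennreal (W n (\<gamma> t)) \<le> g t)" for n
  proof -
    have step: "dist (c n i) (c n (Suc i)) < \<delta> n" if "i < m n" for i
      using mc(1)[of n] that by (simp add: is_chain_def)
    have ends: "c n 0 = x" "c n (m n) \<in> F" using mc(1)[of n] by (auto simp: is_chain_def)
    show ?thesis
    proof (rule chain_step_function[of "W n" "m n" "c n" "\<delta> n", OF W0 step \<delta>0(1), folded L_def])
      fix \<gamma> g assume \<gamma>: "\<gamma> 0 = c n 0" "\<And>t. 0 \<le> t \<Longrightarrow> dist (c n 0) (\<gamma> t) \<le> L n"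
      "\<And>s t. 0 \<le> s \<Longrightarrow> s \<le> t \<Longrightarrow> dist (\<gamma> s) (\<gamma> t) \<le> t - s + \<delta> n" "\<gamma> (L n) = c n (m n)"
      "g \<in> borel_measurable borel" "(\<integral>\<^sup>+ t. g t \<partial>lborel) \<le> ennreal (chain_cost (W n) (m n) (c n))"
      "\<And>t. 0 \<le> t \<Longrightarrow> t < L n \<Longrightarrow> ennreal (W n (\<gamma> t)) \<le> g t"
    have "ennreal (chain_cost (W n) (m n) (c n)) \<le> ennreal (a + \<delta> n)"
      using mc(2)[of n] by (intro ennreal_leI) simp
    with \<gamma>(6) have "(\<integral>\<^sup>+ t. g t \<partial>lborel) \<le> ennreal (a + \<delta> n)" by (rule order_trans)
    then show ?thesis using \<gamma> ends by (intro exI[of _ \<gamma>] exI[of _ g]) simp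
    qed
  qed
  then obtain \<Gamma> g where \<Gamma>: "\<And>n. \<Gamma> n 0 = x" "\<And>n t. 0 \<le> t \<Longrightarrow> dist x (\<Gamma> n t) \<le> L n"
    "\<And>n s t. 0 \<le> s \<Longrightarrow> s \<le> t \<Longrightarrow> dist (\<Gamma> n s) (\<Gamma> n t) \<le> t - s + \<delta> n" "\<And>n. \<Gamma> n (L n) \<in> F"
    "\<And>n. g n \<in> borel_measurable borel" "\<And>n. (\<integral>\<^sup>+ t. g n t \<partial>lborel) \<le> ennreal (a + \<delta> n)"
    "\<And>n t. 0 \<le> t \<Longrightarrow> t < L n \<Longrightarrow> ennreal (W n (\<Gamma> n t)) \<le> g n t"
    by metis
  have \<Gamma>3: "dist (\<Gamma> n s) (\<Gamma> n t) \<le> \<bar>t - s\<bar> + \<delta> n" if "0 \<le> s" "0 \<le> t" for n s t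
    using \<Gamma>(3)[of s t n] \<Gamma>(3)[of t s n] that by (cases "s \<le> t") (auto simp: dist_commute)
  have "\<forall>n. L n \<in> {0..a + 1}" using L0 LA by auto
  then obtain T r1 where T: "T \<in> {0..a + 1}" "strict_mono r1" "(L \<circ> r1) \<longlonglongrightarrow> T"
    using compact_imp_seq_compact[OF compact_Icc[of 0 "a + 1"]] unfolding seq_compact_def by blast
  \<comment> \<open>An enumeration, with repetitions, of the nonnegative rationals; the absolute
    value keeps all times in the range where \<open>\<Gamma>\<close> is controlled.\<close>
  define q :: "nat \<Rightarrow> real" where "q k = \<bar>of_rat (nat_to_rat_surj k)\<bar>" for k
  obtain r2 where r2: "strict_mono r2" "\<And>k. convergent (\<lambda>i. \<Gamma> (r1 (r2 i)) (q k))"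
  proof (rule diagonal_subsequence[of "cball x (a + 1)" "\<lambda>n k. \<Gamma> (r1 n) (q k)"])
    show "\<Gamma> (r1 n) (q k) \<in> cball x (a + 1)" for n k
      using \<Gamma>(2)[of "q k" "r1 n"] LA[of "r1 n"] unfolding q_def by simp
  qed (auto intro: proper)
  define r where "r i = r1 (r2 i)" for i
  have r: "strict_mono r" unfolding r_def using T(2) r2(1) by (auto simp: strict_mono_def)
  have Lr: "(\<lambda>i. L (r i)) \<longlonglongrightarrow> T"
    using LIMSEQ_subseq_LIMSEQ[OF T(3) r2(1)] by (simp add: o_def r_def)
  have \<delta>r: "(\<lambda>i. \<delta> (r i)) \<longlonglongrightarrow> 0"
    using LIMSEQ_subseq_LIMSEQ[OF \<delta>_lim r] by (simp add: o_def)
  have conv: "convergent (\<lambda>i. \<Gamma> (r i) t)" if "0 \<le> t" for t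
  proof (rule Cauchy_convergent, rule metric_CauchyI)
    fix e :: real assume "0 < e"
    obtain p where p: "p \<in> \<rat>" "t < p" "p < t + e / 8"
      using Rats_dense_in_real[of t "t + e / 8"] \<open>0 < e\<close> by auto
    then obtain k where "of_rat (nat_to_rat_surj k) = p"
      using surj_nat_to_rat_surj by (metis Rats_cases surjD)
    then have k: "q k = p" using p that unfolding q_def by auto
    have "Cauchy (\<lambda>i. \<Gamma> (r i) p)"
      using r2(2)[of k] unfolding k r_def[symmetric] by (rule convergent_Cauchy)
    then obtain n1 where n1: "\<And>i j. i \<ge> n1 \<Longrightarrow> j \<ge> n1 \<Longrightarrow> dist (\<Gamma> (r i) p) (\<Gamma> (r j) p) < e / 4"
      using metric_CauchyD[of _ "e / 4"] \<open>0 < e\<close> by force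
    obtain n2 where n2: "\<And>i. i \<ge> n2 \<Longrightarrow> \<delta> (r i) < e / 8"
      using order_tendstoD(2)[OF \<delta>r, of "e / 8"] \<open>0 < e\<close> unfolding eventually_sequentially by auto
    have "dist (\<Gamma> (r i) t) (\<Gamma> (r j) t) < e" if "i \<ge> max n1 n2" "j \<ge> max n1 n2" for i j
    proof -
      have "dist (\<Gamma> (r i) t) (\<Gamma> (r j) t) \<le> dist (\<Gamma> (r i) t) (\<Gamma> (r i) p) + dist (\<Gamma> (r i) p) (\<Gamma> (r j) p) + dist (\<Gamma> (r j) t) (\<Gamma> (r j) p)"
        by metric
      then show ?thesis
        using \<Gamma>3[of t p "r i"] \<Gamma>3[of t p "r j"] n1[of i j] n2[of i] n2[of j] that p \<open>0 \<le> t\<close> by auto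
    qed
    then show "\<exists>M. \<forall>i\<ge>M. \<forall>j\<ge>M. dist (\<Gamma> (r i) t) (\<Gamma> (r j) t) < e" by blast
  qed
  define \<gamma> where "\<gamma> t = lim (\<lambda>i. \<Gamma> (r i) t)" for t
  have lim: "(\<lambda>i. \<Gamma> (r i) t) \<longlonglongrightarrow> \<gamma> t" if "0 \<le> t" for t
    using conv[OF that] unfolding \<gamma>_def by (simp add: convergent_LIMSEQ_iff)
  have T0: "0 \<le> T" using T(1) by simp
  have lip: "1-lipschitz_on {0..T} \<gamma>"
  proof (rule lipschitz_onI)
    fix s t assume st: "s \<in> {0..T}" "t \<in> {0..T}"
    have "dist (\<gamma> s) (\<gamma> t) \<le> \<bar>t - s\<bar> + 0"
    proof (rule LIMSEQ_le)
      show "(\<lambda>i. dist (\<Gamma> (r i) s) (\<Gamma> (r i) t)) \<longlonglongrightarrow> dist (\<gamma> s) (\<gamma> t)"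
        using st by (intro tendsto_dist lim) auto
      show "(\<lambda>i. \<bar>t - s\<bar> + \<delta> (r i)) \<longlonglongrightarrow> \<bar>t - s\<bar> + 0" by (intro tendsto_add tendsto_const \<delta>r)
    qed (use \<Gamma>3 st in auto)
    then show "dist (\<gamma> s) (\<gamma> t) \<le> 1 * dist s t" by (simp add: dist_real_def)
  qed simp
  have end_F: "\<gamma> T \<in> F"
  proof (rule closed_sequentially[OF \<open>closed F\<close>])
    show "\<Gamma> (r i) (L (r i)) \<in> F" for i by (rule \<Gamma>)
    have "(\<lambda>i. dist (\<Gamma> (r i) (L (r i))) (\<gamma> T)) \<longlonglongrightarrow> 0"
    proof (rule Lim_null_comparison)
      show "\<forall>\<^sub>F i in sequentially. norm (dist (\<Gamma> (r i) (L (r i))) (\<gamma> T)) \<le>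
          (\<bar>T - L (r i)\<bar> + \<delta> (r i)) + dist (\<Gamma> (r i) T) (\<gamma> T)"
      proof (rule always_eventually, rule allI)
        fix i
        have "dist (\<Gamma> (r i) (L (r i))) (\<gamma> T) \<le> dist (\<Gamma> (r i) (L (r i))) (\<Gamma> (r i) T) + dist (\<Gamma> (r i) T) (\<gamma> T)"
          by (rule dist_triangle)
        then show "norm (dist (\<Gamma> (r i) (L (r i))) (\<gamma> T)) \<le>
          (\<bar>T - L (r i)\<bar> + \<delta> (r i)) + dist (\<Gamma> (r i) T) (\<gamma> T)"
          using \<Gamma>3[of "L (r i)" T "r i"] L0[of "r i"] T0 by simp
      qed
      have "(\<lambda>i. (\<bar>T - L (r i)\<bar> + \<delta> (r i)) + dist (\<Gamma> (r i) T) (\<gamma> T)) \<longlonglongrightarrow> (\<bar>T - T\<bar> + 0) + dist (\<gamma> T) (\<gamma> T)"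
        by (intro tendsto_intros Lr \<delta>r lim T0)
      then show "(\<lambda>i. (\<bar>T - L (r i)\<bar> + \<delta> (r i)) + dist (\<Gamma> (r i) T) (\<gamma> T)) \<longlonglongrightarrow> 0" by simp
    qed
    then show "(\<lambda>i. \<Gamma> (r i) (L (r i))) \<longlonglongrightarrow> \<gamma> T" by (rule iffD2[OF tendsto_dist_iff])
  qed
  have "curve_integral (weight W) \<gamma> T \<le> (\<integral>\<^sup>+ t. liminf (\<lambda>i. g (r i) t) \<partial>lborel)"
    unfolding curve_integral_def
  proof (rule nn_integral_mono_AE)
    \<comment> \<open>At \<open>t = T\<close> the lengths \<open>L (r i)\<close> may never exceed
      \<open>t\<close>, and then \<open>g\<close> gives no bound; that single time is null.\<close>
    show "AE t in lborel. weight W (\<gamma> t) * indicator {0..T} t \<le> liminf (\<lambda>i. g (r i) t)"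
      using AE_lborel_singleton[of T]
    proof eventually_elim
      case (elim t)
      show ?case
      proof (cases "t \<in> {0..T}")
        case True
        then have t: "0 \<le> t" "t < T" using elim by auto
        have "ennreal (W k (\<gamma> t)) \<le> liminf (\<lambda>i. g (r i) t)" for k
        proof -
          have "isCont (W k) (\<gamma> t)"
            using weight_seqD(1)[OF W(1)] by (simp add: continuous_on_eq_continuous_at)
          from isCont_tendsto_compose[OF this lim[OF t(1)]]
          have "(\<lambda>i. ennreal (W k (\<Gamma> (r i) t))) \<longlonglongrightarrow> ennreal (W k (\<gamma> t))" by (rule tendsto_ennrealI)
          then have "ennreal (W k (\<gamma> t)) = liminf (\<lambda>i. ennreal (W k (\<Gamma> (r i) t)))"
            by (intro lim_imp_Liminf[symmetric]) auto
          also have "\<dots> \<le> liminf (\<lambda>i. g (r i) t)"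
          proof (rule Liminf_mono)
            have "\<forall>\<^sub>F i in sequentially. t < L (r i)" by (rule order_tendstoD(1)[OF Lr t(2)])
            then show "\<forall>\<^sub>F i in sequentially. ennreal (W k (\<Gamma> (r i) t)) \<le> g (r i) t"
              using eventually_ge_at_top[of k]
            proof eventually_elim
              case (elim i)
              \<comment> \<open>Passing to the limit with \<open>k\<close> fixed and only afterwards
                taking the supremum over \<open>k\<close> is how lower semicontinuity of
                \<open>weight W\<close> is used.\<close>
              have "k \<le> r i" using elim(2) seq_suble[OF r, of i] by linarith
              then have "ennreal (W k (\<Gamma> (r i) t)) \<le> ennreal (W (r i) (\<Gamma> (r i) t))"
                by (intro ennreal_leI weight_seqD(3)[OF W(1)])
              also have "\<dots> \<le> g (r i) t" using t elim by (intro \<Gamma>(7)) auto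
              finally show ?case .
            qed
          qed
          finally show ?thesis .
        qed
        then have "weight W (\<gamma> t) \<le> liminf (\<lambda>i. g (r i) t)" unfolding weight_def by (intro SUP_least)
        then show ?thesis using True by simp
      qed simp
    qed
  qed
  also have "\<dots> \<le> liminf (\<lambda>i. \<integral>\<^sup>+ t. g (r i) t \<partial>lborel)"
    using \<Gamma>(5) by (intro nn_integral_liminf) auto
  also have "\<dots> \<le> liminf (\<lambda>i. ennreal (a + \<delta> (r i)))"
    using \<Gamma>(6) by (intro Liminf_mono always_eventually allI)
  also have "\<dots> = ennreal (a + 0)"
    by (intro lim_imp_Liminf tendsto_ennrealI tendsto_add tendsto_const \<delta>r) simp
  finally have "curve_integral (weight W) \<gamma> T \<le> ennreal a" by simp
  moreover have "\<gamma> 0 = x" unfolding \<gamma>_def \<Gamma>(1) by simp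
  ultimately show thesis using that T0 lip end_F by blast
qed

section \<open>Connecting points by curves under a Poincare inequality\<close>

lemma upper_gradient_realI:
  assumes "g \<in> borel_measurable borel"
    and "\<And>\<gamma> l. arc_curve \<gamma> l \<Longrightarrow> ennreal \<bar>f (\<gamma> 0) - f (\<gamma> l)\<bar> \<le> curve_integral g \<gamma> l"
  shows "upper_gradient g (\<lambda>x. ereal (f x))"
  using assms unfolding upper_gradient_def by auto

lemma diameter_ball_le: "0 \<le> r \<Longrightarrow> diameter (ball (z :: 'a :: metric_space) r) \<le> 2 * r"
proof (cases "ball z r = {}")
  case False
  have "dist x y \<le> 2 * r" if "x \<in> ball z r" "y \<in> ball z r" for x y
    using that dist_triangle3[of x y z] by simp
  then show ?thesis using False unfolding diameter_def by (auto intro!: cSUP_least)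
qed simp

section \<open>Ball averages and mean oscillation\<close>

context metric_measure_space begin

definition avg :: "('a \<Rightarrow> real) \<Rightarrow> 'a \<Rightarrow> real \<Rightarrow> real" where
  "avg f z r = (LINT y:ball z r|M. f y) / measure M (ball z r)"

lemma set_integrable_ball:
  fixes f :: "'a \<Rightarrow> real"
  assumes "f \<in> borel_measurable M" "\<And>y. \<bar>f y\<bar> \<le> b"
  shows "set_integrable M (ball z r) f"
  unfolding set_integrable_def using assms ball_finite[of z r]
  by (intro integrableI_bounded_set_indicator[where B = b]) auto

end

context doubling_space begin

text \<open>The number \<open>a\<close> is left free: it is the average over the larger ball in the
  telescoping sum and the value at the centre in the convergence of averages.\<close>

lemma avg_diff_le:
  fixes f :: "'a \<Rightarrow> real"
  assumes f: "f \<in> borel_measurable M" "\<And>y. \<bar>f y\<bar> \<le> b" and "0 < r'" and sub: "ball z' r' \<subseteq> ball z r"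
    and c: "measure M (ball z r) \<le> c * measure M (ball z' r')" and "0 \<le> A"
    and osc: "(\<integral>\<^sup>+ y\<in>ball z r. ennreal \<bar>f y - a\<bar> \<partial>M) \<le> ennreal (A * measure M (ball z r))"
  shows "\<bar>avg f z' r' - a\<bar> \<le> c * A"
proof -
  define m where "m = measure M (ball z' r')"
  have m: "0 < m" unfolding m_def using ball_pos[OF \<open>0 < r'\<close>] .
  have i: "set_integrable M (ball z' r') f" by (rule set_integrable_ball[OF f])
  have i2: "set_integrable M (ball z' r') (\<lambda>y. f y - a)"
    using f(1) f(2) by (intro set_integrable_ball[where b = "b + \<bar>a\<bar>"]) (auto intro: order_trans[OF abs_triangle_ineq4] add_right_mono)
  have i3: "set_integrable M (ball z' r') (\<lambda>y. \<bar>f y - a\<bar>)" using set_integrable_abs[OF i2] .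
  have "(LINT y:ball z' r'|M. f y - a) = (LINT y:ball z' r'|M. f y) - a * m"
  proof -
    have ia: "set_integrable M (ball z' r') (\<lambda>y. a)" by (rule set_integrable_ball[where b = "\<bar>a\<bar>"]) auto
    have "(LINT y:ball z' r'|M. a) = a * m"
      unfolding m_def set_lebesgue_integral_def by simp
    then show ?thesis using set_integral_diff(2)[OF i ia] by simp
  qed
  then have "avg f z' r' - a = (LINT y:ball z' r'|M. f y - a) / m"
    unfolding avg_def m_def[symmetric] using m by (simp add: field_simps)
  then have "\<bar>avg f z' r' - a\<bar> = \<bar>LINT y:ball z' r'|M. f y - a\<bar> / m" using m by simp
  also have "\<dots> \<le> (LINT y:ball z' r'|M. \<bar>f y - a\<bar>) / m"
    using set_integral_norm_bound[OF i2] m by (intro divide_right_mono) auto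
  also have "\<dots> \<le> A * measure M (ball z r) / m"
  proof (rule divide_right_mono)
    have "ennreal (LINT y:ball z' r'|M. \<bar>f y - a\<bar>) = (\<integral>\<^sup>+ y. ennreal (indicator (ball z' r') y *\<^sub>R \<bar>f y - a\<bar>) \<partial>M)"
      using i3 unfolding set_lebesgue_integral_def set_integrable_def
      by (intro nn_integral_eq_integral[symmetric]) auto
    also have "\<dots> \<le> (\<integral>\<^sup>+ y\<in>ball z r. ennreal \<bar>f y - a\<bar> \<partial>M)"
      using sub by (intro nn_integral_mono) (auto simp: indicator_def)
    also note osc
    finally show "(LINT y:ball z' r'|M. \<bar>f y - a\<bar>) \<le> A * measure M (ball z r)"
      using \<open>0 \<le> A\<close> by (subst (asm) ennreal_le_iff) auto
  qed (use m in simp)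
  also have "\<dots> \<le> A * (c * m) / m"
    using c m \<open>0 \<le> A\<close> unfolding m_def[symmetric] by (intro divide_right_mono mult_left_mono) auto
  also have "\<dots> = c * A" using m by simp
  finally show ?thesis .
qed

lemma avg_tendsto:
  fixes f :: "'a \<Rightarrow> real"
  assumes f: "continuous_on UNIV f" "\<And>y. \<bar>f y\<bar> \<le> b" and "0 < r"
  shows "(\<lambda>i. avg f x (r / 2 ^ i)) \<longlonglongrightarrow> f x"
proof (rule metric_LIMSEQ_I)
  fix e :: real assume "0 < e"
  have fM: "f \<in> borel_measurable M" using f(1) by (intro measurable_from_borel borel_measurable_continuous_onI)
  obtain d where d: "d > 0" "\<And>y. dist y x < d \<Longrightarrow> \<bar>f y - f x\<bar> < e / 2"
    using f(1) \<open>0 < e\<close> unfolding continuous_on_iff dist_real_def by (metis UNIV_I half_gt_zero)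
  have "(\<lambda>i. r / 2 ^ i) \<longlonglongrightarrow> 0" by (rule LIMSEQ_divide_realpow_zero) simp
  from order_tendstoD(2)[OF this d(1)] obtain n where n: "\<And>i. i \<ge> n \<Longrightarrow> r / 2 ^ i < d"
    unfolding eventually_sequentially by auto
  have "dist (avg f x (r / 2 ^ i)) (f x) < e" if "i \<ge> n" for i
  proof -
    define s where "s = r / 2 ^ i"
    have s: "0 < s" "s < d" unfolding s_def using n[OF that] \<open>0 < r\<close> by auto
    have "(\<integral>\<^sup>+ y\<in>ball x s. ennreal \<bar>f y - f x\<bar> \<partial>M) \<le> (\<integral>\<^sup>+ y. ennreal (e / 2) * indicator (ball x s) y \<partial>M)"
    proof (rule nn_integral_mono)
      fix y
      have "ennreal \<bar>f y - f x\<bar> \<le> ennreal (e / 2)" if "y \<in> ball x s"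
        using d(2)[of y] that s by (intro ennreal_leI) (auto simp: dist_commute)
      then show "ennreal \<bar>f y - f x\<bar> * indicator (ball x s) y \<le> ennreal (e / 2) * indicator (ball x s) y"
        by (auto simp: indicator_def)
    qed
    also have "\<dots> = ennreal (e / 2 * measure M (ball x s))"
      using \<open>0 < e\<close> by (subst ennreal_mult) (auto simp: nn_integral_cmult_indicator emeasure_ball)
    finally have "\<bar>avg f x s - f x\<bar> \<le> 1 * (e / 2)"
      using \<open>0 < e\<close> s by (intro avg_diff_le[OF fM f(2), where z = x and r = s]) auto
    then show ?thesis using \<open>0 < e\<close> unfolding s_def dist_real_def by linarith
  qed
  then show "\<exists>n. \<forall>i\<ge>n. dist (avg f x (r / 2 ^ i)) (f x) < e" by blast
qed

text \<open>Along dyadic radii the averages change by at most \<open>D * A * r / 2 ^ i\<close>, a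
  geometric series with sum \<open>2 * D * A * r\<close>. Continuity of \<open>f\<close> makes the
  averages converge at this very \<open>x\<close>, not just at almost every point.\<close>

lemma avg_telescope:
  fixes f :: "'a \<Rightarrow> real"
  assumes f: "continuous_on UNIV f" "\<And>y. \<bar>f y\<bar> \<le> b" and "0 < r" "0 \<le> A"
    and osc: "\<And>s. 0 < s \<Longrightarrow> (\<integral>\<^sup>+ y\<in>ball x s. ennreal \<bar>f y - avg f x s\<bar> \<partial>M) \<le> ennreal (A * s * measure M (ball x s))"
  shows "\<bar>f x - avg f x r\<bar> \<le> 2 * D * A * r"
proof -
  have fM: "f \<in> borel_measurable M" using f(1) by (intro measurable_from_borel borel_measurable_continuous_onI)
  define a where "a i = avg f x (r / 2 ^ i)" for i
  have step: "\<bar>a (Suc i) - a i\<bar> \<le> D * (A * (r / 2 ^ i))" for i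
  proof -
    have "measure M (ball x (r / 2 ^ i)) \<le> D * measure M (ball x (r / 2 ^ Suc i))"
      using ball_double[of "r / 2 ^ Suc i" x] \<open>0 < r\<close> by simp
    moreover have "r / 2 ^ Suc i \<le> r / 2 ^ i" using \<open>0 < r\<close> by (simp add: field_simps)
    ultimately show ?thesis
      unfolding a_def using \<open>0 < r\<close> \<open>0 \<le> A\<close> osc[of "r / 2 ^ i"]
      by (intro avg_diff_le[OF fM f(2)]) (auto intro: subset_ball)
  qed
  have "\<bar>a n - a 0\<bar> \<le> 2 * D * A * r * (1 - (1 / 2) ^ n)" for n
  proof (induction n)
    case (Suc n)
    have "\<bar>a (Suc n) - a 0\<bar> \<le> D * (A * (r / 2 ^ n)) + 2 * D * A * r * (1 - (1 / 2) ^ n)"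
      using step[of n] Suc by linarith
    also have "\<dots> = 2 * D * A * r * (1 - (1 / 2) ^ Suc n)" by (simp add: field_simps power_one_over)
    finally show ?case .
  qed simp
  moreover have "2 * D * A * r * (1 - (1 / 2) ^ n) \<le> 2 * D * A * r" for n
    using D_ge_1 \<open>0 < r\<close> \<open>0 \<le> A\<close> by (intro mult_left_le) auto
  ultimately have le: "\<bar>a n - a 0\<bar> \<le> 2 * D * A * r" for n by (meson order_trans)
  have "a \<longlonglongrightarrow> f x" unfolding a_def by (rule avg_tendsto[OF f \<open>0 < r\<close>])
  then have "(\<lambda>n. \<bar>a n - a 0\<bar>) \<longlonglongrightarrow> \<bar>f x - a 0\<bar>" by (intro tendsto_intros)
  then have "\<bar>f x - a 0\<bar> \<le> 2 * D * A * r" by (rule LIMSEQ_le_const2) (use le in auto)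
  then show ?thesis unfolding a_def by simp
qed

text \<open>Only balls centred at \<open>x\<close> or \<open>y\<close> are involved, which is what
  can be guaranteed for two points outside the exceptional open set. The averages over
  \<open>ball y d\<close> and \<open>ball x (2 * d)\<close> are compared directly; the three errors
  add up to \<open>(6 * D + 2 * D^2) * A * d\<close>.\<close>

lemma mean_oscillation_imp_lipschitz:
  fixes f :: "'a \<Rightarrow> real"
  assumes f: "continuous_on UNIV f" "\<And>y. \<bar>f y\<bar> \<le> b" and "0 \<le> A"
    and osc: "\<And>z s. z = x \<or> z = y \<Longrightarrow> 0 < s \<Longrightarrow>
      (\<integral>\<^sup>+ w\<in>ball z s. ennreal \<bar>f w - avg f z s\<bar> \<partial>M) \<le> ennreal (A * s * measure M (ball z s))"
  shows "\<bar>f x - f y\<bar> \<le> 8 * D\<^sup>2 * A * dist x y"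
proof (cases "x = y")
  case False
  have fM: "f \<in> borel_measurable M" using f(1) by (intro measurable_from_borel borel_measurable_continuous_onI)
  define d where "d = dist x y"
  have d: "0 < d" unfolding d_def using False by simp
  have 1: "\<bar>f x - avg f x (2 * d)\<bar> \<le> 2 * D * A * (2 * d)"
    using d osc by (intro avg_telescope[OF f _ \<open>0 \<le> A\<close>]) auto
  have 2: "\<bar>f y - avg f y d\<bar> \<le> 2 * D * A * d"
    using d osc by (intro avg_telescope[OF f _ \<open>0 \<le> A\<close>]) auto
  have 3: "\<bar>avg f y d - avg f x (2 * d)\<bar> \<le> D\<^sup>2 * (A * (2 * d))"
  proof (rule avg_diff_le[OF fM f(2) d])
    show "ball y d \<subseteq> ball x (2 * d)"
    proof
      fix w assume "w \<in> ball y d"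
      then show "w \<in> ball x (2 * d)" using dist_triangle[of x w y] d by (simp add: d_def)
    qed
    have "ball x (2 * d) \<subseteq> ball y (2 ^ 2 * d)"
    proof
      fix w assume "w \<in> ball x (2 * d)"
      then have "dist y w < d + 2 * d" using dist_triangle[of y w x] by (simp add: d_def dist_commute)
      then show "w \<in> ball y (2 ^ 2 * d)" using d by simp
    qed
    then have "measure M (ball x (2 * d)) \<le> measure M (ball y (2 ^ 2 * d))" by (rule measure_ball_mono)
    also have "\<dots> \<le> D\<^sup>2 * measure M (ball y d)" by (rule ball_double_pow[OF d])
    finally show "measure M (ball x (2 * d)) \<le> D\<^sup>2 * measure M (ball y d)" .
    show "0 \<le> A * (2 * d)" using \<open>0 \<le> A\<close> d by simp
    show "(\<integral>\<^sup>+ w\<in>ball x (2 * d). ennreal \<bar>f w - avg f x (2 * d)\<bar> \<partial>M) \<le> ennreal (A * (2 * d) * measure M (ball x (2 * d)))"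
      using d by (intro osc) auto
  qed
  have "\<bar>f x - f y\<bar> \<le> 2 * D * A * (2 * d) + 2 * D * A * d + D\<^sup>2 * (A * (2 * d))"
    using 1 2 3 by linarith
  also have "\<dots> = (6 * D + 2 * D\<^sup>2) * (A * d)" by (simp add: algebra_simps)
  also have "\<dots> \<le> (8 * D\<^sup>2) * (A * d)"
  proof (rule mult_right_mono)
    have "D * 1 \<le> D * D" using D_ge_1 by (intro mult_left_mono) auto
    then show "6 * D + 2 * D\<^sup>2 \<le> 8 * D\<^sup>2" by (simp add: power2_eq_square)
  qed (use d \<open>0 \<le> A\<close> in simp)
  finally show ?thesis unfolding d_def by (simp add: algebra_simps)
qed simp

text \<open>Bounding the means of \<open>g\<close> to the power \<open>p\<close> over all balls
  around \<open>z\<close> by one \<open>K\<close> hides the dilation of the ball on the right of the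
  Poincare inequality. The factor 2 comes from the diameter.\<close>

lemma poincare_oscillation:
  assumes p: "1 \<le> p" and "poincare_inequality p M"
  obtains C where "0 < C"
    "\<And>z r f g K. 0 < r \<Longrightarrow> f \<in> borel_measurable M \<Longrightarrow> (\<integral>\<^sup>+ x. ennreal \<bar>f x\<bar> \<partial>M) < \<infinity> \<Longrightarrow>
      upper_gradient g (\<lambda>x. ereal (f x)) \<Longrightarrow> 0 \<le> K \<Longrightarrow>
      (\<And>s. 0 < s \<Longrightarrow> (\<integral>\<^sup>+ x\<in>ball z s. epowr (g x) p \<partial>M) \<le> ennreal K * emeasure M (ball z s)) \<Longrightarrow>
      (\<integral>\<^sup>+ y\<in>ball z r. ennreal \<bar>f y - avg f z r\<bar> \<partial>M) \<le> ennreal (C * K powr (1 / p) * r * measure M (ball z r))"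
proof -
  obtain C L where C: "0 < C" "1 \<le> L" and poin: "\<And>z r f g. r > 0 \<Longrightarrow> f \<in> borel_measurable M \<Longrightarrow>
      (\<integral>\<^sup>+ x. e2ennreal \<bar>f x\<bar> \<partial>M) < \<infinity> \<Longrightarrow> upper_gradient g f \<Longrightarrow>
      (\<integral>\<^sup>+ x\<in>ball z r. e2ennreal \<bar>f x - ereal ((LINT x:ball z r|M. real_of_ereal (f x)) / measure M (ball z r))\<bar> \<partial>M) / emeasure M (ball z r)
                 \<le> ennreal (C * diameter (ball z r)) *
                   epowr ((\<integral>\<^sup>+ x\<in>ball z (L * r). epowr (g x) p \<partial>M) / emeasure M (ball z (L * r))) (1 / p)"
    using assms(2) unfolding poincare_inequality_def Let_def by blast
  show thesis
  proof (rule that[of "2 * C"])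
    fix z :: 'a and r K :: real and f :: "'a \<Rightarrow> real" and g
    assume r: "0 < r" and f: "f \<in> borel_measurable M" "(\<integral>\<^sup>+ x. ennreal \<bar>f x\<bar> \<partial>M) < \<infinity>"
      and g: "upper_gradient g (\<lambda>x. ereal (f x))" and K: "0 \<le> K"
      and gK: "\<And>s. 0 < s \<Longrightarrow> (\<integral>\<^sup>+ x\<in>ball z s. epowr (g x) p \<partial>M) \<le> ennreal K * emeasure M (ball z s)"
    define X where "X = (\<integral>\<^sup>+ y\<in>ball z r. ennreal \<bar>f y - avg f z r\<bar> \<partial>M)"
    define m where "m = measure M (ball z r)"
    have m: "0 < m" "emeasure M (ball z r) = ennreal m" unfolding m_def by (auto simp: ball_pos r emeasure_ball)
    have Lr: "0 < L * r" using C r by simp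
    have "(\<integral>\<^sup>+ x\<in>ball z (L * r). epowr (g x) p \<partial>M) / emeasure M (ball z (L * r)) \<le> ennreal K"
      using gK[OF Lr] ball_pos[OF Lr, of z]
      by (intro divide_le_posI_ennreal) (auto simp: emeasure_ball mult.commute)
    then have 1: "epowr ((\<integral>\<^sup>+ x\<in>ball z (L * r). epowr (g x) p \<partial>M) / emeasure M (ball z (L * r))) (1 / p) \<le> ennreal (K powr (1 / p))"
      using epowr_mono[of _ "ennreal K" "1 / p"] p K by (simp add: epowr_ennreal)
    have "X / ennreal m \<le> ennreal (C * diameter (ball z r)) *
        epowr ((\<integral>\<^sup>+ x\<in>ball z (L * r). epowr (g x) p \<partial>M) / emeasure M (ball z (L * r))) (1 / p)"
      using poin[of r "\<lambda>x. ereal (f x)" g z] r f g m unfolding X_def avg_def by simp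
    also have "\<dots> \<le> ennreal (C * (2 * r)) * ennreal (K powr (1 / p))"
      using C r diameter_ball_le[of r z] by (intro mult_mono ennreal_leI 1 mult_left_mono) auto
    also have "\<dots> = ennreal (2 * C * K powr (1 / p) * r)"
      using C r K by (simp add: ennreal_mult[symmetric] algebra_simps)
    finally have 2: "X / ennreal m \<le> ennreal (2 * C * K powr (1 / p) * r)" .
    have "X = X / ennreal m * ennreal m"
      using m by (subst ennreal_divide_times) auto
    also have "\<dots> \<le> ennreal (2 * C * K powr (1 / p) * r) * ennreal m" by (rule mult_right_mono[OF 2]) simp
    also have "\<dots> = ennreal (2 * C * K powr (1 / p) * r * m)" using m C r K by (simp add: ennreal_mult)
    finally show "(\<integral>\<^sup>+ y\<in>ball z r. ennreal \<bar>f y - avg f z r\<bar> \<partial>M) \<le> ennreal (2 * C * K powr (1 / p) * r * measure M (ball z r))"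
      unfolding X_def m_def .
  qed (use C in simp)
qed

lemma not_high_average:
  assumes "x \<notin> high_average h k" "0 < r" "x \<in> ball z r"
  shows "(\<integral>\<^sup>+ x\<in>ball z r. h x \<partial>M) \<le> ennreal k * emeasure M (ball z r)"
  using assms unfolding high_average_def by (force simp: not_less)

end

text \<open>\<open>h\<close> stays at the level of \<open>p\<close>-th powers, where its supremum is
  integrable; the root is taken only here. The value \<open>c = 1\<close> gives the weight
  \<open>w\<close> of the overview and \<open>c = 1 + L\<close> gives \<open>w + L\<close>.\<close>

definition root_weight :: "(nat \<Rightarrow> 'a \<Rightarrow> real) \<Rightarrow> real \<Rightarrow> real \<Rightarrow> nat \<Rightarrow> 'a \<Rightarrow> real" where
  "root_weight h p c n x = h n x powr (1 / p) + c"

lemma weight_seq_root_weight: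
  assumes "weight_seq h" "0 < p" "0 \<le> c"
  shows "weight_seq (root_weight h p c)"
  unfolding weight_seq_def root_weight_def
proof (intro conjI allI incseq_SucI)
  note h = weight_seqD[OF assms(1)]
  show "continuous_on UNIV (\<lambda>x. h n x powr (1 / p) + c)" for n
    using h assms by (intro continuous_intros continuous_on_powr') auto
  show "0 \<le> h n x powr (1 / p) + c" for n x using assms by simp
  show "h n x powr (1 / p) + c \<le> h (Suc n) x powr (1 / p) + c" for n x
    using h(2,3) assms by (intro add_right_mono powr_mono2) auto
qed

lemma epowr_root_weight_le:
  assumes "weight_seq h" "0 < p" "0 \<le> c"
  shows "epowr (ennreal (root_weight h p c n x)) p \<le> ennreal (2 powr p) * (weight h x + ennreal (c powr p))"
proof -
  note h = weight_seqD[OF assms(1)]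
  have "epowr (ennreal (root_weight h p c n x)) p = epowr (ennreal (h n x powr (1 / p)) + ennreal c) p"
    unfolding root_weight_def using assms by simp
  also have "\<dots> \<le> ennreal (2 powr p) * (epowr (ennreal (h n x powr (1 / p))) p + epowr (ennreal c) p)"
    using assms by (intro epowr_add_le) auto
  also have "epowr (ennreal (h n x powr (1 / p))) p = ennreal (h n x)"
    using h(2)[of n x] assms by (simp add: epowr_ennreal powr_powr)
  also have "epowr (ennreal c) p = ennreal (c powr p)" using assms by (simp add: epowr_ennreal)
  also have "ennreal (2 powr p) * (ennreal (h n x) + ennreal (c powr p)) \<le> ennreal (2 powr p) * (weight h x + ennreal (c powr p))"
    by (intro mult_left_mono add_right_mono weight_upper) auto
  finally show ?thesis .
qed

lemma epowr_weight_root_weight_le: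
  assumes "weight_seq h" "0 < p" "0 \<le> c"
  shows "epowr (weight (root_weight h p c) x) p \<le> ennreal (2 powr p) * (weight h x + ennreal (c powr p))"
proof -
  note W = weight_seqD[OF weight_seq_root_weight[OF assms]]
  have "epowr (weight (root_weight h p c) x) p = (SUP n. ennreal (root_weight h p c n x powr p))"
    unfolding weight_def using W assms by (intro epowr_SUP) auto
  also have "\<dots> = (SUP n. epowr (ennreal (root_weight h p c n x)) p)" using W by (simp add: epowr_ennreal)
  also have "\<dots> \<le> ennreal (2 powr p) * (weight h x + ennreal (c powr p))"
    by (intro SUP_least epowr_root_weight_le assms)
  finally show ?thesis .
qed

text \<open>The capped chain infima to \<open>{y}\<close> have \<open>W n\<close> as upper gradient,
  and the means of its \<open>p\<close>-th power over balls centred at \<open>x\<close> or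
  \<open>y\<close> are of order \<open>k\<close>. The oscillation estimate then bounds their values
  at \<open>x\<close> uniformly in \<open>n\<close>, and the limit of nearly optimal chains is the
  curve.\<close>

lemma (in complete_doubling_space) connecting_curve:
  assumes p: "1 \<le> p" and "poincare_inequality p M" and h: "weight_seq h"
  obtains C where "0 < C"
    "\<And>k x y. 1 \<le> k \<Longrightarrow> x \<notin> high_average (weight h) k \<Longrightarrow> y \<notin> high_average (weight h) k \<Longrightarrow>
      \<exists>\<gamma> T. 0 \<le> T \<and> 1-lipschitz_on {0..T} \<gamma> \<and> \<gamma> 0 = x \<and> \<gamma> T = y \<and>
        curve_integral (weight (root_weight h p 1)) \<gamma> T \<le> ennreal (C * k powr (1 / p) * dist x y)"
proof -
  obtain C where C: "0 < C" and osc: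
    "\<And>z r f g K. 0 < r \<Longrightarrow> f \<in> borel_measurable M \<Longrightarrow> (\<integral>\<^sup>+ x. ennreal \<bar>f x\<bar> \<partial>M) < \<infinity> \<Longrightarrow>
      upper_gradient g (\<lambda>x. ereal (f x)) \<Longrightarrow> 0 \<le> K \<Longrightarrow>
      (\<And>s. 0 < s \<Longrightarrow> (\<integral>\<^sup>+ x\<in>ball z s. epowr (g x) p \<partial>M) \<le> ennreal K * emeasure M (ball z s)) \<Longrightarrow>
      (\<integral>\<^sup>+ y\<in>ball z r. ennreal \<bar>f y - avg f z r\<bar> \<partial>M) \<le> ennreal (C * K powr (1 / p) * r * measure M (ball z r))"
    using poincare_oscillation[OF assms(1,2)] by blast
  define C' where "C' = 8 * D\<^sup>2 * (C * (2 powr (p + 1)) powr (1 / p))"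
  define W where "W = root_weight h p 1"
  have W: "weight_seq W" unfolding W_def using h p by (intro weight_seq_root_weight) auto
  note WD = weight_seqD[OF W]
  have W1: "1 \<le> W n x" for n x unfolding W_def root_weight_def by simp
  have [measurable]: "weight h \<in> borel_measurable M" by (intro measurable_from_borel borel_measurable_weight h)
  show thesis
  proof (rule that[of C'])
    show "0 < C'" unfolding C'_def using C D_ge_1 by simp
    fix k :: real and x y :: 'a
    assume k: "1 \<le> k" and xy: "x \<notin> high_average (weight h) k" "y \<notin> high_average (weight h) k"
    \<comment> \<open>One factor \<open>2 powr p\<close> comes from expanding the
      \<open>p\<close>-th power of a sum; the extra 2 from estimating both \<open>h\<close> and the
      summand 1 by \<open>k \<ge> 1\<close>.\<close>
    define K where "K = 2 powr (p + 1) * k"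
    have K: "0 \<le> K" unfolding K_def using k by simp
    define a where "a = C' * k powr (1 / p) * dist x y"
    have a: "0 \<le> a" unfolding a_def using \<open>0 < C'\<close> by simp
    \<comment> \<open>The cap must lie strictly above the expected bound \<open>a\<close>, otherwise
      no nearly optimal chains could be extracted.\<close>
    define N where "N = a + 1"
    have "chain_inf N (W n) (1 / real (Suc n)) {y} x \<le> a" for n
    proof -
      define v where "v = chain_inf N (W n) (1 / real (Suc n)) {y}"
      \<comment> \<open>The chain infimum equals the cap far away and need not be integrable; its
        complement to the cap is.\<close>
      define f where "f w = N - v w" for w
      have v01: "0 \<le> v w" "v w \<le> N" for w
        unfolding v_def using WD(2) a N_def by (auto intro!: chain_inf_nonneg chain_inf_le_N)
      have cont: "continuous_on UNIV f"
        unfolding f_def v_def by (intro continuous_intros continuous_on_chain_inf WD) auto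
      have fb: "\<bar>f w\<bar> \<le> N" for w unfolding f_def using v01[of w] by simp
      have fM: "f \<in> borel_measurable M" using cont by (intro measurable_from_borel borel_measurable_continuous_onI)
      \<comment> \<open>With weights at least 1, the cost of a chain is at least the distance it
        covers.\<close>
      have far: "f w = 0" if "w \<notin> ball y N" for w
      proof -
        have "N \<le> v w" unfolding v_def
        proof (rule chain_inf_greatest)
          fix m c assume c: "is_chain (1 / real (Suc n)) {y} w m c"
          have "dist (c 0) (c j) \<le> (\<Sum>i<j. dist (c i) (c (Suc i)))" for j
          proof (induction j)
            case (Suc j)
            then show ?case using dist_triangle[of "c 0" "c (Suc j)" "c j"] by simp
          qed simp
          then have "dist w y \<le> (\<Sum>i<m. dist (c i) (c (Suc i)))" using c by (auto simp: is_chain_def)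
          also have "\<dots> \<le> chain_cost (W n) m c"
            unfolding chain_cost_def using W1 by (intro sum_mono) (simp add: mult_le_cancel_right1)
          finally show "N \<le> chain_cost (W n) m c" using that by (simp add: dist_commute)
        qed simp
        then show ?thesis using v01(2)[of w] unfolding f_def by simp
      qed
      have "(\<integral>\<^sup>+ w. ennreal \<bar>f w\<bar> \<partial>M) \<le> (\<integral>\<^sup>+ w. ennreal N * indicator (ball y N) w \<partial>M)"
        using fb far by (intro nn_integral_mono) (auto simp: indicator_def intro!: ennreal_leI)
      also have "\<dots> < \<infinity>"
        by (simp add: nn_integral_cmult_indicator emeasure_ball ennreal_mult_less_top)
      finally have fint: "(\<integral>\<^sup>+ w. ennreal \<bar>f w\<bar> \<partial>M) < \<infinity>" .
      have ug: "upper_gradient (\<lambda>w. ennreal (W n w)) (\<lambda>w. ereal (f w))"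
      proof (rule upper_gradient_realI)
        show "(\<lambda>w. ennreal (W n w)) \<in> borel_measurable borel" using WD(4) by measurable
        fix \<gamma> :: "real \<Rightarrow> 'a" and l assume \<gamma>: "arc_curve \<gamma> l"
        have "\<bar>f (\<gamma> 0) - f (\<gamma> l)\<bar> = \<bar>v (\<gamma> 0) - v (\<gamma> l)\<bar>" unfolding f_def by simp
        then show "ennreal \<bar>f (\<gamma> 0) - f (\<gamma> l)\<bar> \<le> curve_integral (\<lambda>w. ennreal (W n w)) \<gamma> l"
          unfolding v_def curve_integral_def
          using arc_curve_pos[OF \<gamma>] by (simp add: chain_inf_gradient[OF WD(1,2) _ _ arc_curve_lipschitz[OF \<gamma>]])
      qed
      have gK: "(\<integral>\<^sup>+ w\<in>ball z s. epowr (ennreal (W n w)) p \<partial>M) \<le> ennreal K * emeasure M (ball z s)"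
        if z: "z \<notin> high_average (weight h) k" and s: "0 < s" for z s
      proof -
        have "(\<integral>\<^sup>+ w\<in>ball z s. epowr (ennreal (W n w)) p \<partial>M) \<le>
            (\<integral>\<^sup>+ w. ennreal (2 powr p) * (weight h w * indicator (ball z s) w + indicator (ball z s) w) \<partial>M)"
          using epowr_root_weight_le[OF h, of p 1 n] p unfolding W_def
          by (intro nn_integral_mono) (auto simp: indicator_def)
        also have "\<dots> = ennreal (2 powr p) * ((\<integral>\<^sup>+ w\<in>ball z s. weight h w \<partial>M) + emeasure M (ball z s))"
          by (subst nn_integral_cmult) (auto simp: nn_integral_add)
        also have "\<dots> \<le> ennreal (2 powr p) * (ennreal k * emeasure M (ball z s) + ennreal k * emeasure M (ball z s))"
        proof (intro mult_left_mono add_mono)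
          show "(\<integral>\<^sup>+ w\<in>ball z s. weight h w \<partial>M) \<le> ennreal k * emeasure M (ball z s)"
            using s by (intro not_high_average[OF z]) auto
          show "emeasure M (ball z s) \<le> ennreal k * emeasure M (ball z s)"
            using mult_right_mono[of 1 "ennreal k" "emeasure M (ball z s)"] k by simp
        qed simp
        also have "\<dots> = ennreal K * emeasure M (ball z s)"
          unfolding emeasure_ball K_def using k
          by (simp add: ennreal_mult[symmetric] ennreal_plus[symmetric] powr_add del: ennreal_plus)
        finally show ?thesis .
      qed
      have "\<bar>f x - f y\<bar> \<le> 8 * D\<^sup>2 * (C * K powr (1 / p)) * dist x y"
      proof (rule mean_oscillation_imp_lipschitz[OF cont fb])
        show "0 \<le> C * K powr (1 / p)" using C by simp
        fix z s assume "z = x \<or> z = y" "(0::real) < s"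
        then show "(\<integral>\<^sup>+ w\<in>ball z s. ennreal \<bar>f w - avg f z s\<bar> \<partial>M) \<le> ennreal (C * K powr (1 / p) * s * measure M (ball z s))"
          using xy by (intro osc[OF _ fM fint ug K] gK) auto
      qed
      also have "8 * D\<^sup>2 * (C * K powr (1 / p)) * dist x y = a"
        unfolding a_def C'_def K_def using k by (simp add: powr_mult)
      finally have "\<bar>f x - f y\<bar> \<le> a" .
      moreover have "v y = 0" unfolding v_def using WD(2) a N_def by (intro chain_inf_eq_0) auto
      ultimately show ?thesis unfolding f_def v_def[symmetric] by simp
    qed
    moreover have "closed {y}" "a < N" "0 \<le> N" unfolding N_def using a by auto
    ultimately have "\<exists>\<gamma> T. 0 \<le> T \<and> 1-lipschitz_on {0..T} \<gamma> \<and> \<gamma> 0 = x \<and> \<gamma> T \<in> {y} \<and>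
        curve_integral (weight W) \<gamma> T \<le> ennreal a"
      by (metis chains_limit_curve[OF compact_cball W W1])
    then show "\<exists>\<gamma> T. 0 \<le> T \<and> 1-lipschitz_on {0..T} \<gamma> \<and> \<gamma> 0 = x \<and> \<gamma> T = y \<and>
        curve_integral (weight (root_weight h p 1)) \<gamma> T \<le> ennreal (C' * k powr (1 / p) * dist x y)"
      unfolding a_def W_def by simp
  qed
qed

section \<open>Path potentials\<close>

lemma nn_integral_interval_shift:
  fixes a b s :: real
  assumes "(\<lambda>t. F t * indicator {a..b} t) \<in> borel_measurable lborel"
  shows "(\<integral>\<^sup>+ t\<in>{a + s..b + s}. F (t - s) \<partial>lborel) = (\<integral>\<^sup>+ t\<in>{a..b}. F t \<partial>lborel)"
proof -
  have "(\<integral>\<^sup>+ t\<in>{a..b}. F t \<partial>lborel) = (\<integral>\<^sup>+ t. F (- s + 1 * t) * indicator {a..b} (- s + 1 * t) \<partial>lborel)"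
    using nn_integral_real_affine[of "\<lambda>t. F t * indicator {a..b} t" 1 "- s"] assms by simp
  also have "\<dots> = (\<integral>\<^sup>+ t\<in>{a + s..b + s}. F (t - s) \<partial>lborel)"
    by (intro nn_integral_cong) (auto simp: indicator_def)
  finally show ?thesis by simp
qed

lemma nn_integral_interval_reflect:
  fixes a b s :: real
  assumes "(\<lambda>t. F t * indicator {a..b} t) \<in> borel_measurable lborel"
  shows "(\<integral>\<^sup>+ t\<in>{s - b..s - a}. F (s - t) \<partial>lborel) = (\<integral>\<^sup>+ t\<in>{a..b}. F t \<partial>lborel)"
proof -
  have "(\<integral>\<^sup>+ t\<in>{a..b}. F t \<partial>lborel) = (\<integral>\<^sup>+ t. F (s + - 1 * t) * indicator {a..b} (s + - 1 * t) \<partial>lborel)"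
    using nn_integral_real_affine[of "\<lambda>t. F t * indicator {a..b} t" "- 1" s] assms by simp
  also have "\<dots> = (\<integral>\<^sup>+ t\<in>{s - b..s - a}. F (s - t) \<partial>lborel)"
    by (intro nn_integral_cong) (auto simp: indicator_def)
  finally show ?thesis by simp
qed

lemma lipschitz_concat:
  fixes \<gamma>1 \<gamma>2 :: "real \<Rightarrow> 'a::metric_space"
  assumes T: "0 \<le> T1" "0 \<le> T2" and \<gamma>1: "1-lipschitz_on {0..T1} \<gamma>1" and \<gamma>2: "1-lipschitz_on {0..T2} \<gamma>2"
    and eq: "\<gamma>1 T1 = \<gamma>2 0" and w: "w \<in> borel_measurable borel"
  obtains \<gamma> where "1-lipschitz_on {0..T1 + T2} \<gamma>" "\<gamma> 0 = \<gamma>1 0" "\<gamma> (T1 + T2) = \<gamma>2 T2"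
    "curve_integral w \<gamma> (T1 + T2) \<le> curve_integral w \<gamma>1 T1 + curve_integral w \<gamma>2 T2"
proof
  define \<gamma> where "\<gamma> t = (if t \<le> T1 then \<gamma>1 t else \<gamma>2 (t - T1))" for t
  show "\<gamma> 0 = \<gamma>1 0" "\<gamma> (T1 + T2) = \<gamma>2 T2" unfolding \<gamma>_def using T eq by auto
  show "1-lipschitz_on {0..T1 + T2} \<gamma>"
  proof (rule lipschitz_onI)
    have *: "dist (\<gamma> s) (\<gamma> t) \<le> t - s" if st: "0 \<le> s" "s \<le> t" "t \<le> T1 + T2" for s t
    proof -
      have L1: "dist (\<gamma>1 s) (\<gamma>1 t) \<le> t - s" if "0 \<le> s" "s \<le> t" "t \<le> T1" for s t
        using lipschitz_onD[OF \<gamma>1, of s t] that by (auto simp: dist_real_def)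
      have L2: "dist (\<gamma>2 s) (\<gamma>2 t) \<le> t - s" if "0 \<le> s" "s \<le> t" "t \<le> T2" for s t
        using lipschitz_onD[OF \<gamma>2, of s t] that by (auto simp: dist_real_def)
      consider "t \<le> T1" | "s \<le> T1" "T1 < t" | "T1 < s" by linarith
      then show ?thesis
      proof cases
        case 1 then show ?thesis unfolding \<gamma>_def using L1[of s t] st by auto
      next
        case 2
        have "dist (\<gamma>1 s) (\<gamma>1 T1) \<le> T1 - s" "dist (\<gamma>2 0) (\<gamma>2 (t - T1)) \<le> (t - T1) - 0"
          using L1[of s T1] L2[of 0 "t - T1"] 2 st by auto
        then show ?thesis
          using 2 dist_triangle[of "\<gamma>1 s" "\<gamma>2 (t - T1)" "\<gamma>1 T1"] eq unfolding \<gamma>_def by auto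
      next
        case 3 then show ?thesis unfolding \<gamma>_def using L2[of "s - T1" "t - T1"] st by auto
      qed
    qed
    show "dist (\<gamma> s) (\<gamma> t) \<le> 1 * dist s t" if "s \<in> {0..T1 + T2}" "t \<in> {0..T1 + T2}" for s t
      using that *[of s t] *[of t s] by (cases "s \<le> t") (auto simp: dist_real_def dist_commute)
  qed simp
  have m1 [measurable]: "(\<lambda>t. w (\<gamma>1 t) * indicator {0..T1} t) \<in> borel_measurable lborel"
    by (rule curve_integral_measurable[OF lipschitz_on_continuous_on[OF \<gamma>1] w])
  have m2: "(\<lambda>t. w (\<gamma>2 t) * indicator {0..T2} t) \<in> borel_measurable lborel"
    by (rule curve_integral_measurable[OF lipschitz_on_continuous_on[OF \<gamma>2] w])
  have m3 [measurable]: "(\<lambda>t. w (\<gamma>2 (t - T1)) * indicator {0 + T1..T2 + T1} t) \<in> borel_measurable lborel"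
  proof (rule curve_integral_measurable[OF _ w])
    show "continuous_on {0 + T1..T2 + T1} (\<lambda>t. \<gamma>2 (t - T1))"
      by (rule continuous_on_compose2[OF lipschitz_on_continuous_on[OF \<gamma>2]]) (auto intro!: continuous_intros)
  qed
  have "curve_integral w \<gamma> (T1 + T2) \<le>
      (\<integral>\<^sup>+ t. w (\<gamma>1 t) * indicator {0..T1} t + w (\<gamma>2 (t - T1)) * indicator {0 + T1..T2 + T1} t \<partial>lborel)"
    unfolding curve_integral_def \<gamma>_def by (intro nn_integral_mono) (auto simp: indicator_def)
  also have "\<dots> = curve_integral w \<gamma>1 T1 + curve_integral w \<gamma>2 T2"
    unfolding curve_integral_def nn_integral_interval_shift[OF m2, of T1, symmetric]
    by (rule nn_integral_add) (use m1 m3 in auto)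
  finally show "curve_integral w \<gamma> (T1 + T2) \<le> curve_integral w \<gamma>1 T1 + curve_integral w \<gamma>2 T2" .
qed

lemma lipschitz_reverse:
  fixes \<gamma> :: "real \<Rightarrow> 'a::metric_space"
  assumes "1-lipschitz_on {0..T} \<gamma>" and w: "w \<in> borel_measurable borel"
  shows "1-lipschitz_on {0..T} (\<lambda>t. \<gamma> (T - t))" "curve_integral w (\<lambda>t. \<gamma> (T - t)) T = curve_integral w \<gamma> T"
proof -
  show "1-lipschitz_on {0..T} (\<lambda>t. \<gamma> (T - t))"
  proof (rule lipschitz_onI)
    show "dist (\<gamma> (T - s)) (\<gamma> (T - t)) \<le> 1 * dist s t" if "s \<in> {0..T}" "t \<in> {0..T}" for s t
      using lipschitz_onD[OF assms(1), of "T - s" "T - t"] that by (auto simp: dist_real_def)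
  qed simp
  show "curve_integral w (\<lambda>t. \<gamma> (T - t)) T = curve_integral w \<gamma> T"
    unfolding curve_integral_def
    using nn_integral_interval_reflect[OF curve_integral_measurable[OF lipschitz_on_continuous_on[OF assms(1)] w], of T]
    by simp
qed

lemma curve_integral_0: "curve_integral w \<gamma> 0 = 0"
proof -
  have "(\<integral>\<^sup>+ t\<in>{0..0}. w (\<gamma> t) \<partial>lborel) = (\<integral>\<^sup>+ (t::real). 0 \<partial>lborel)"
    by (rule nn_integral_cong_AE) (use AE_lborel_singleton[of "0::real"] in \<open>auto elim!: eventually_mono simp: indicator_def\<close>)
  then show ?thesis unfolding curve_integral_def by simp
qed

text \<open>Lipschitz curves are used instead of arc-length ones: they include the constant curve,
  which gives the value 0 outside \<open>U\<close>, and are closed under concatenation and reversal.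
  If no curve leaves \<open>U\<close>, the infimum is infinite.\<close>

definition path_inf :: "('a::metric_space \<Rightarrow> ennreal) \<Rightarrow> 'a set \<Rightarrow> 'a \<Rightarrow> ennreal" where
  "path_inf w U x = (INF (\<gamma>, T) \<in> {(\<gamma>, T). 0 \<le> T \<and> 1-lipschitz_on {0..T} \<gamma> \<and> \<gamma> 0 = x \<and> \<gamma> T \<notin> U}. curve_integral w \<gamma> T)"

lemma path_inf_le:
  "0 \<le> T \<Longrightarrow> 1-lipschitz_on {0..T} \<gamma> \<Longrightarrow> \<gamma> T \<notin> U \<Longrightarrow> path_inf w U (\<gamma> 0) \<le> curve_integral w \<gamma> T"
  unfolding path_inf_def by (rule INF_lower2[of "(\<gamma>, T)"]) auto

lemma path_inf_outside: "x \<notin> U \<Longrightarrow> path_inf w U x = 0"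
  using path_inf_le[of 0 "\<lambda>_. x" U w] by (simp add: curve_integral_0 lipschitz_on_def)

text \<open>Prepending \<open>\<gamma>\<close> to an almost optimal curve from its endpoint gives a
  competitor from its starting point.\<close>

lemma path_inf_gradient:
  assumes T: "0 \<le> T" and \<gamma>: "1-lipschitz_on {0..T} \<gamma>" and w: "w \<in> borel_measurable borel"
  shows "path_inf w U (\<gamma> 0) \<le> curve_integral w \<gamma> T + path_inf w U (\<gamma> T)"
proof -
  have "path_inf w U (\<gamma> 0) \<le> curve_integral w \<gamma> T + curve_integral w \<gamma>' T'"
    if \<gamma>': "0 \<le> T'" "1-lipschitz_on {0..T'} \<gamma>'" "\<gamma>' 0 = \<gamma> T" "\<gamma>' T' \<notin> U" for \<gamma>' T'
  proof -
    obtain \<beta> where \<beta>: "1-lipschitz_on {0..T + T'} \<beta>" "\<beta> 0 = \<gamma> 0" "\<beta> (T + T') = \<gamma>' T'"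
      "curve_integral w \<beta> (T + T') \<le> curve_integral w \<gamma> T + curve_integral w \<gamma>' T'"
      using lipschitz_concat[OF T \<gamma>'(1) \<gamma> \<gamma>'(2) \<gamma>'(3)[symmetric] w] by blast
    then have "path_inf w U (\<beta> 0) \<le> curve_integral w \<beta> (T + T')"
      using \<gamma>' T by (intro path_inf_le) auto
    then show ?thesis using \<beta> by simp
  qed
  note * = this
  show ?thesis
  proof (rule ennreal_le_epsilon)
    fix e :: real
    assume "curve_integral w \<gamma> T + path_inf w U (\<gamma> T) < top" "0 < e"
    then have "path_inf w U (\<gamma> T) < path_inf w U (\<gamma> T) + ennreal e"
      by (cases "path_inf w U (\<gamma> T)") (auto simp flip: ennreal_plus simp: ennreal_less_iff)
    then obtain \<gamma>' T' where \<gamma>': "0 \<le> T'" "1-lipschitz_on {0..T'} \<gamma>'" "\<gamma>' 0 = \<gamma> T" "\<gamma>' T' \<notin> U"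
      "curve_integral w \<gamma>' T' < path_inf w U (\<gamma> T) + ennreal e"
      unfolding path_inf_def[of w U "\<gamma> T"] INF_less_iff by force
    have "path_inf w U (\<gamma> 0) \<le> curve_integral w \<gamma> T + curve_integral w \<gamma>' T'" by (rule *[OF \<gamma>'(1-4)])
    also have "\<dots> \<le> curve_integral w \<gamma> T + (path_inf w U (\<gamma> T) + ennreal e)"
      using \<gamma>'(5) by (intro add_left_mono) simp
    finally show "path_inf w U (\<gamma> 0) \<le> curve_integral w \<gamma> T + path_inf w U (\<gamma> T) + ennreal e"
      by (simp add: add.assoc)
  qed
qed

definition path_pot :: "('a::metric_space \<Rightarrow> ennreal) \<Rightarrow> 'a set \<Rightarrow> 'a \<Rightarrow> real" where
  "path_pot w U x = enn2real (min 1 (path_inf w U x))"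

lemma ennreal_path_pot: "ennreal (path_pot w U x) = min 1 (path_inf w U x)"
  unfolding path_pot_def by (rule ennreal_enn2real) (auto simp: min_less_iff_disj)

lemma path_pot_bounds: "0 \<le> path_pot w U x" "path_pot w U x \<le> 1"
proof -
  show "0 \<le> path_pot w U x" unfolding path_pot_def by simp
  have "ennreal (path_pot w U x) \<le> ennreal 1" unfolding ennreal_path_pot by simp
  then show "path_pot w U x \<le> 1" by (subst (asm) ennreal_le_iff) auto
qed

lemma path_pot_outside: "x \<notin> U \<Longrightarrow> path_pot w U x = 0"
  unfolding path_pot_def by (simp add: path_inf_outside)

lemma path_pot_gradient:
  assumes T: "0 \<le> T" and \<gamma>: "1-lipschitz_on {0..T} \<gamma>" and w: "w \<in> borel_measurable borel"
  shows "ennreal \<bar>path_pot w U (\<gamma> 0) - path_pot w U (\<gamma> T)\<bar> \<le> curve_integral w \<gamma> T"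
proof -
  have *: "ennreal (path_pot w U (\<gamma> 0) - path_pot w U (\<gamma> T)) \<le> curve_integral w \<gamma> T"
    if \<gamma>: "1-lipschitz_on {0..T} \<gamma>" for \<gamma>
  proof -
    have "ennreal (path_pot w U (\<gamma> 0)) \<le> ennreal (path_pot w U (\<gamma> T)) + curve_integral w \<gamma> T"
      unfolding ennreal_path_pot using path_inf_gradient[OF T \<gamma> w, of U]
      by (auto simp: min_def add.commute intro: order_trans add_increasing2)
    then show ?thesis
      by (subst ennreal_minus[symmetric]) (auto simp: path_pot_bounds ennreal_minus_le_iff)
  qed
  show ?thesis
    using *[OF \<gamma>] *[OF lipschitz_reverse(1)[OF \<gamma> w]] lipschitz_reverse(2)[OF \<gamma> w] T
    by (cases "path_pot w U (\<gamma> T) \<le> path_pot w U (\<gamma> 0)") auto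
qed


text \<open>Each \<open>\<gamma> j\<close> is run from \<open>x\<close> to its tip and back. The
  excursions are arranged in reverse order, those with large index coming first, so that infinitely
  many of them accumulate at time 0 and the tips are visited at times \<open>c j\<close> tending to
  0.\<close>

lemma infinite_concatenation:
  fixes \<gamma> :: "nat \<Rightarrow> real \<Rightarrow> 'a::metric_space"
  assumes T: "\<And>j. 0 < T j" "summable T" and \<gamma>: "\<And>j. 1-lipschitz_on {0..T j} (\<gamma> j)" "\<And>j. \<gamma> j 0 = x"
    and w: "w \<in> borel_measurable borel"
  obtains \<Gamma> R c where "0 < R" "1-lipschitz_on {0..R} \<Gamma>" "\<Gamma> 0 = x" "\<And>j. c j \<in> {0..R}" "c \<longlonglongrightarrow> 0"
    "\<And>j. \<Gamma> (c j) = \<gamma> j (T j)" "curve_integral w \<Gamma> R \<le> (\<Sum>j. 2 * curve_integral w (\<gamma> j) (T j))"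
proof -
  define R where "R = (\<Sum>j. 2 * T j)"
  have sm: "summable (\<lambda>j. 2 * T j)" using T(2) by (rule summable_mult)
  \<comment> \<open>Excursion \<open>j\<close> occupies the times between \<open>S (Suc j)\<close>
    and \<open>S j\<close>, an interval of length \<open>2 * T j\<close> with midpoint
    \<open>c j\<close>.\<close>
  define S where "S j = R - (\<Sum>i<j. 2 * T i)" for j
  have S0: "S 0 = R" unfolding S_def by simp
  have S_Suc: "S j = S (Suc j) + 2 * T j" for j unfolding S_def by simp
  have S_lim: "S \<longlonglongrightarrow> 0"
    using tendsto_diff[OF tendsto_const summable_LIMSEQ[OF sm], of R] unfolding S_def R_def by simp
  have S_pos: "0 < S j" for j
    unfolding S_def R_def using sum_less_suminf[OF sm, of j] T(1) by auto
  have S_anti: "S j \<le> S i" if "i \<le> j" for i j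
    using that
  proof (induction rule: dec_induct)
    case (step n) then show ?case using S_Suc[of n] T(1)[of n] by simp
  qed simp
  define c where "c j = S (Suc j) + T j" for j
  \<comment> \<open>A tent function: the position on \<open>\<gamma> j\<close> at time
    \<open>t\<close>, rising to the tip at \<open>c j\<close>, returning to 0, and 0 at all times
    outside the excursion.\<close>
  define \<phi> where "\<phi> j t = max 0 (T j - \<bar>t - c j\<bar>)" for j t
  have \<phi>_lip: "\<bar>\<phi> j s - \<phi> j t\<bar> \<le> \<bar>s - t\<bar>" for j s t unfolding \<phi>_def by auto
  have \<phi>_range: "\<phi> j t \<in> {0..T j}" for j t unfolding \<phi>_def using T(1)[of j] by auto
  have \<phi>_pos: "S (Suc j) < t \<and> t < S j" if "0 < \<phi> j t" for j t
    using that S_Suc[of j] unfolding \<phi>_def c_def by (auto simp: max_def abs_if split: if_splits)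
  have \<phi>_room: "\<phi> j t \<le> t - S (Suc j)" "\<phi> j t \<le> S j - t" if "0 < \<phi> j t" for j t
    using that S_Suc[of j] unfolding \<phi>_def c_def by (auto simp: max_def abs_if split: if_splits)
  have uniq: "i = j" if "0 < \<phi> i t" "0 < \<phi> j t" for i j t
  proof (rule ccontr)
    assume "i \<noteq> j"
    then consider "Suc i \<le> j" | "Suc j \<le> i" by linarith
    then show False
      using \<phi>_pos[OF that(1)] \<phi>_pos[OF that(2)] S_anti[of "Suc i" j] S_anti[of "Suc j" i] by cases auto
  qed
  define \<Gamma> where "\<Gamma> t = (if \<exists>j. 0 < \<phi> j t then \<gamma> (THE j. 0 < \<phi> j t) (\<phi> (THE j. 0 < \<phi> j t) t) else x)" for t
  have \<Gamma>_in: "\<Gamma> t = \<gamma> j (\<phi> j t)" if "0 < \<phi> j t" for j t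
  proof -
    have "(THE j. 0 < \<phi> j t) = j" using that uniq by blast
    then show ?thesis unfolding \<Gamma>_def using that by auto
  qed
  have \<Gamma>_out: "\<Gamma> t = x" if "\<And>j. \<not> 0 < \<phi> j t" for t
    unfolding \<Gamma>_def using that by simp
  have \<gamma>x: "dist (\<gamma> j (\<phi> j t)) x \<le> \<phi> j t" for j t
    using lipschitz_onD[OF \<gamma>(1), of "\<phi> j t" j 0] \<phi>_range[of j t] \<gamma>(2)[of j] T(1)[of j] by (simp add: dist_real_def)
  have \<Gamma>_lip: "dist (\<Gamma> s) (\<Gamma> t) \<le> t - s" if st: "s \<le> t" for s t
  proof (cases "\<exists>i. 0 < \<phi> i s")
    case True
    then obtain i where i: "0 < \<phi> i s" by blast
    show ?thesis
    proof (cases "\<exists>j. 0 < \<phi> j t")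
      case True
      then obtain j where j: "0 < \<phi> j t" by blast
      show ?thesis
      proof (cases "i = j")
        case True
        have "dist (\<gamma> j (\<phi> j s)) (\<gamma> j (\<phi> j t)) \<le> \<bar>\<phi> j s - \<phi> j t\<bar>"
          using lipschitz_onD[OF \<gamma>(1) \<phi>_range \<phi>_range, of j s t] by (simp add: dist_real_def)
        then show ?thesis using \<phi>_lip[of j s t] st \<Gamma>_in[OF i] \<Gamma>_in[OF j] True by simp
      next
        case False
        have "Suc j \<le> i"
        proof (rule ccontr)
          assume "\<not> Suc j \<le> i"
          then have "S j \<le> S (Suc i)" using False by (intro S_anti) simp
          then show False using \<phi>_pos[OF i] \<phi>_pos[OF j] st by linarith
        qed
        then have "S i \<le> S (Suc j)" by (rule S_anti)
        \<comment> \<open>Between different excursions the curve passes through \<open>x\<close>;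
          the way back from the earlier one and the way out in the later one both fit into
          \<open>t - s\<close>.\<close>
        then have "\<phi> i s + \<phi> j t \<le> t - s" using \<phi>_room[OF i] \<phi>_room[OF j] by linarith
        moreover have "dist (\<Gamma> s) (\<Gamma> t) \<le> \<phi> i s + \<phi> j t"
          using dist_triangle2[of "\<Gamma> s" "\<Gamma> t" x] \<gamma>x[of i s] \<gamma>x[of j t] \<Gamma>_in[OF i] \<Gamma>_in[OF j] by simp
        ultimately show ?thesis by linarith
      qed
    next
      case False
      then have "\<phi> i t = 0" using \<phi>_range[of i t] by (auto simp: not_less order_antisym)
      then have "\<phi> i s \<le> t - s" using \<phi>_lip[of i s t] st by simp
      then show ?thesis using \<Gamma>_in[OF i] \<Gamma>_out[of t] False \<gamma>x[of i s] by auto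
    qed
  next
    case no: False
    show ?thesis
    proof (cases "\<exists>j. 0 < \<phi> j t")
      case True
      then obtain j where j: "0 < \<phi> j t" by blast
      have "\<phi> j s = 0" using no \<phi>_range[of j s] by (auto simp: not_less order_antisym)
      then have "\<phi> j t \<le> t - s" using \<phi>_lip[of j s t] st by simp
      then show ?thesis using \<Gamma>_in[OF j] \<Gamma>_out[of s] no \<gamma>x[of j t] by (auto simp: dist_commute)
    next
      case False
      then show ?thesis using no \<Gamma>_out[of s] \<Gamma>_out[of t] st by auto
    qed
  qed
  have lip: "1-lipschitz_on {0..R} \<Gamma>"
  proof (rule lipschitz_onI)
    show "dist (\<Gamma> s) (\<Gamma> t) \<le> 1 * dist s t" for s t
      using \<Gamma>_lip[of s t] \<Gamma>_lip[of t s] by (cases "s \<le> t") (auto simp: dist_real_def dist_commute)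
  qed simp
  have c_pos: "0 < \<phi> j (c j)" "\<phi> j (c j) = T j" for j unfolding \<phi>_def using T(1)[of j] by auto
  have c: "S (Suc j) < c j" "c j < S j" for j using \<phi>_pos[OF c_pos(1)] by auto
  have c_lim: "c \<longlonglongrightarrow> 0"
  proof (rule tendsto_sandwich[OF always_eventually always_eventually tendsto_const S_lim])
    show "\<forall>j. 0 \<le> c j" using c(1) S_pos by (metis less_imp_le less_trans)
    show "\<forall>j. c j \<le> S j" using c(2) by (simp add: less_imp_le)
  qed
  define left where "left j t = w (\<gamma> j (t - S (Suc j))) * indicator {0 + S (Suc j)..T j + S (Suc j)} t" for j t
  define right where "right j t = w (\<gamma> j (S j - t)) * indicator {S j - T j..S j - 0} t" for j t
  have left_m: "left j \<in> borel_measurable lborel" for j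
    unfolding left_def
  proof (rule curve_integral_measurable[OF _ w])
    show "continuous_on {0 + S (Suc j)..T j + S (Suc j)} (\<lambda>t. \<gamma> j (t - S (Suc j)))"
      by (rule continuous_on_compose2[OF lipschitz_on_continuous_on[OF \<gamma>(1)]]) (auto intro!: continuous_intros)
  qed
  have right_m: "right j \<in> borel_measurable lborel" for j
    unfolding right_def
  proof (rule curve_integral_measurable[OF _ w])
    show "continuous_on {S j - T j..S j - 0} (\<lambda>t. \<gamma> j (S j - t))"
      by (rule continuous_on_compose2[OF lipschitz_on_continuous_on[OF \<gamma>(1)]]) (auto intro!: continuous_intros)
  qed
  have m: "(\<lambda>t. w (\<gamma> j t) * indicator {0..T j} t) \<in> borel_measurable lborel" for j
    by (rule curve_integral_measurable[OF lipschitz_on_continuous_on[OF \<gamma>(1)] w])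
  have left_i: "(\<integral>\<^sup>+ t. left j t \<partial>lborel) = curve_integral w (\<gamma> j) (T j)" for j
    unfolding left_def curve_integral_def by (rule nn_integral_interval_shift[OF m])
  have right_i: "(\<integral>\<^sup>+ t. right j t \<partial>lborel) = curve_integral w (\<gamma> j) (T j)" for j
    unfolding right_def curve_integral_def by (rule nn_integral_interval_reflect[OF m])
  have "countable (range S \<union> {0})" by auto
  then have "AE t in lborel. t \<notin> range S \<union> {0}"
    \<comment> \<open>Away from this countable set every time in the range lies strictly inside
      exactly one excursion.\<close>
    by (intro AE_not_in countable_imp_null_set_lborel)
  then have "AE t in lborel. w (\<Gamma> t) * indicator {0..R} t \<le> (\<Sum>j. left j t + right j t)"
  proof eventually_elim
    case (elim t)
    show ?case
    proof (cases "t \<in> {0..R}")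
      case True
      then have t: "0 < t" "t < S 0" using elim S0 by (auto simp: less_le)
      obtain k where k: "S k < t" using order_tendstoD(2)[OF S_lim t(1)] unfolding eventually_sequentially by auto
      \<comment> \<open>The least index is positive because \<open>t < S 0\<close>, so its
        predecessor names the excursion containing \<open>t\<close>.\<close>
      define j where "j = (LEAST k. S k < t) - 1"
      have L: "S (LEAST k. S k < t) < t" using k by (rule LeastI)
      then have "(LEAST k. S k < t) \<noteq> 0" using t by (metis less_asym)
      then have j: "(LEAST k. S k < t) = Suc j" unfolding j_def by simp
      have "\<not> S j < t" using not_less_Least[of j "\<lambda>k. S k < t"] j by simp
      then have tj: "S (Suc j) < t" "t < S j" using L j elim by (auto simp: less_le not_less)
      then have "0 < \<phi> j t" unfolding \<phi>_def c_def using S_Suc[of j] by (auto simp: max_def abs_if)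
      then have "\<Gamma> t = \<gamma> j (\<phi> j t)" by (rule \<Gamma>_in)
      moreover have "w (\<gamma> j (\<phi> j t)) \<le> left j t + right j t"
      proof (cases "t \<le> c j")
        case True
        then have "\<phi> j t = t - S (Suc j)" unfolding \<phi>_def c_def using tj by (auto simp: max_def abs_if)
        then show ?thesis using True tj unfolding left_def c_def by (simp add: add.commute add_increasing2)
      next
        case False
        then have "\<phi> j t = S j - t" unfolding \<phi>_def c_def using tj S_Suc[of j] by (auto simp: max_def abs_if)
        moreover have "t \<in> {S j - T j..S j - 0}" using False tj S_Suc[of j] unfolding c_def by auto
        ultimately show ?thesis unfolding right_def by (simp add: add_increasing)
      qed
      moreover have "left j t + right j t \<le> (\<Sum>j. left j t + right j t)"
        using sum_le_suminf[of "\<lambda>j. left j t + right j t" "{j}"] by simp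
      ultimately show ?thesis using True by simp
    qed simp
  qed
  then have "curve_integral w \<Gamma> R \<le> (\<integral>\<^sup>+ t. (\<Sum>j. left j t + right j t) \<partial>lborel)"
    unfolding curve_integral_def by (rule nn_integral_mono_AE)
  also have "\<dots> = (\<Sum>j. \<integral>\<^sup>+ t. left j t + right j t \<partial>lborel)"
    using left_m right_m by (intro nn_integral_suminf borel_measurable_add)
  also have "\<dots> = (\<Sum>j. 2 * curve_integral w (\<gamma> j) (T j))"
    using left_m right_m by (simp add: nn_integral_add left_i right_i mult_2)
  finally have int: "curve_integral w \<Gamma> R \<le> (\<Sum>j. 2 * curve_integral w (\<gamma> j) (T j))" .
  have "\<not> 0 < \<phi> j 0" for j
    using \<phi>_pos[of j 0] S_pos[of "Suc j"] by auto
  then have "\<Gamma> 0 = x" by (rule \<Gamma>_out)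
  moreover have "c j \<in> {0..R}" for j
    using c[of j] S_pos[of "Suc j"] S_anti[of 0 j] S0 by auto
  moreover have "\<Gamma> (c j) = \<gamma> j (T j)" for j using \<Gamma>_in[OF c_pos(1)] c_pos(2) by simp
  ultimately show thesis using that[of R \<Gamma> c] S_pos[of 0] S0 lip c_lim int by auto
qed

lemma path_pot_pos:
  fixes U :: "'a::metric_space set"
  assumes W: "weight_seq W" "\<And>n x. 1 \<le> W n x"
    and po: "\<And>\<gamma> l. arc_curve \<gamma> l \<Longrightarrow> curve_integral (weight W) \<gamma> l < \<infinity> \<Longrightarrow>
      openin (top_of_set {0..l}) {t \<in> {0..l}. \<gamma> t \<in> U}"
    and "x \<in> U"
  shows "0 < path_pot (weight W) U x"
proof (rule ccontr)
  assume "\<not> 0 < path_pot (weight W) U x"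
  then have "path_pot (weight W) U x = 0" using path_pot_bounds(1)[of "weight W" U x] by simp
  then have "min 1 (path_inf (weight W) U x) = 0"
    using ennreal_path_pot[of "weight W" U x] by simp
  then have "path_inf (weight W) U x = 0" by (auto simp: min_def split: if_splits)
  then have "path_inf (weight W) U x < ennreal ((1 / 2) ^ j)" for j by simp
  then have "\<exists>\<gamma> T. 0 \<le> T \<and> 1-lipschitz_on {0..T} \<gamma> \<and> \<gamma> 0 = x \<and> \<gamma> T \<notin> U \<and>
      curve_integral (weight W) \<gamma> T < ennreal ((1 / 2) ^ j)" for j
    unfolding path_inf_def INF_less_iff by force
  then obtain \<gamma> T where \<gamma>: "\<And>j. 0 \<le> T j" "\<And>j. 1-lipschitz_on {0..T j} (\<gamma> j)" "\<And>j. \<gamma> j 0 = x"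
      "\<And>j. \<gamma> j (T j) \<notin> U" "\<And>j. curve_integral (weight W) (\<gamma> j) (T j) < ennreal ((1 / 2) ^ j)"
    by metis
  have w: "weight W \<in> borel_measurable borel" by (rule borel_measurable_weight[OF W(1)])
  have Tpos: "0 < T j" for j
    using \<gamma>(1)[of j] \<gamma>(3)[of j] \<gamma>(4)[of j] \<open>x \<in> U\<close> by (cases "T j = 0") auto
  \<comment> \<open>The weight is at least 1, so a curve with small integral is short; this makes
    the total duration of the excursions finite.\<close>
  have Tle: "T j \<le> (1 / 2) ^ j" for j
  proof -
    have w1: "1 \<le> weight W y" for y
      using order_trans[OF ennreal_leI[OF W(2)] weight_upper[of W 0 y]] by simp
    have "ennreal (T j) = (\<integral>\<^sup>+ t\<in>{0..T j}. 1 \<partial>lborel)" using \<gamma>(1)[of j] by simp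
    also have "\<dots> \<le> curve_integral (weight W) (\<gamma> j) (T j)"
      unfolding curve_integral_def using w1 by (intro nn_integral_mono mult_right_mono) auto
    also have "\<dots> \<le> ennreal ((1 / 2) ^ j)" using \<gamma>(5)[of j] by simp
    finally show ?thesis by (subst (asm) ennreal_le_iff) auto
  qed
  have "summable T"
    by (rule summable_comparison_test[of T "\<lambda>j. (1 / 2) ^ j"])
      (use Tle \<gamma>(1) in \<open>auto intro!: exI[of _ 0] summable_geometric\<close>)
  show False
  proof (rule infinite_concatenation[OF Tpos \<open>summable T\<close> \<gamma>(2,3) w])
    fix \<Gamma> R c assume \<Gamma>: "0 < R" "1-lipschitz_on {0..R} \<Gamma>" "\<Gamma> 0 = x" "\<And>j. c j \<in> {0..R}" "c \<longlonglongrightarrow> 0"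
      "\<And>j. \<Gamma> (c j) = \<gamma> j (T j)" "curve_integral (weight W) \<Gamma> R \<le> (\<Sum>j. 2 * curve_integral (weight W) (\<gamma> j) (T j))"
  have "(\<Sum>j. 2 * curve_integral (weight W) (\<gamma> j) (T j)) \<le> (\<Sum>j. ennreal (2 * (1 / 2) ^ j))"
    using \<gamma>(5) by (intro suminf_le allI) (auto simp: ennreal_mult less_imp_le intro!: mult_left_mono)
  also have "\<dots> = ennreal (\<Sum>j. 2 * (1 / 2) ^ j)"
    by (intro suminf_ennreal2 summable_mult summable_geometric) auto
  also have "\<dots> < \<infinity>" by simp
  finally have fin: "curve_integral (weight W) \<Gamma> R < \<infinity>" using \<Gamma>(7) by (rule le_less_trans[rotated])
  \<comment> \<open>The tips lie outside \<open>U\<close>, while the starting point \<open>x\<close>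
    lies in it.\<close>
  have nc: "\<not> \<Gamma> constant_on {0..R}"
    using \<Gamma>(1,3,4,6) \<gamma>(4) \<open>x \<in> U\<close> unfolding constant_on_def by (metis atLeastAtMost_iff less_imp_le order_refl)
  obtain \<delta> l s where \<delta>: "arc_curve \<delta> l" "continuous_on {0..R} s" "s 0 = 0" "s ` {0..R} \<subseteq> {0..l}"
    "\<And>t. t \<in> {0..R} \<Longrightarrow> \<Gamma> t = \<delta> (s t)" "curve_integral (weight W) \<delta> l \<le> curve_integral (weight W) \<Gamma> R"
    using ex_arc_curve_reparametrization[OF W(1) \<Gamma>(2) less_imp_le[OF \<Gamma>(1)] nc] by metis
  have "openin (top_of_set {0..l}) {t \<in> {0..l}. \<delta> t \<in> U}"
    using \<delta>(6) fin by (intro po[OF \<delta>(1)]) (rule le_less_trans)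
  then obtain V where V: "open V" "{t \<in> {0..l}. \<delta> t \<in> U} = {0..l} \<inter> V" unfolding openin_open by blast
  have s0: "0 \<in> {0..R}" using \<Gamma>(1) by simp
  have "s 0 \<in> {0..l}" using \<delta>(4) s0 by blast
  then have "s 0 \<in> V" using V(2) \<delta>(5)[OF s0] \<Gamma>(3) \<open>x \<in> U\<close> by auto
  \<comment> \<open>Continuity of \<open>s\<close> moves the accumulation of tips to the start of
    the arc-length curve: relative openness there would force some tip into
    \<open>U\<close>.\<close>
  have "((\<lambda>j. s (c j)) \<longlongrightarrow> s 0) sequentially"
    using continuous_on_tendsto_compose[OF \<delta>(2) \<Gamma>(5) s0] \<Gamma>(4) by simp
  from topological_tendstoD[OF this V(1) \<open>s 0 \<in> V\<close>] obtain j where "s (c j) \<in> V"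
    unfolding eventually_sequentially by blast
  moreover have "s (c j) \<in> {0..l}" using \<delta>(4) \<Gamma>(4) by blast
  ultimately have "\<delta> (s (c j)) \<in> U" using V(2) by blast
  then show False using \<delta>(5)[OF \<Gamma>(4)] \<Gamma>(6) \<gamma>(4) by metis
  qed
qed

section \<open>Approximation by continuous functions\<close>

text \<open>Infimal convolution with the cone \<open>L * dist\<close>. Inserting 1 truncates the
  extension from above and gives a value even for empty \<open>E\<close>.\<close>

lemma mcshane_extension:
  fixes f :: "'a::metric_space \<Rightarrow> real"
  assumes "0 \<le> L" "\<And>x. 0 \<le> f x" "\<And>x. f x \<le> 1"
    and L: "\<And>x y. x \<in> E \<Longrightarrow> y \<in> E \<Longrightarrow> \<bar>f x - f y\<bar> \<le> L * dist x y"
  obtains F where "\<And>x. 0 \<le> F x" "\<And>x. F x \<le> 1" "\<And>x y. \<bar>F x - F y\<bar> \<le> L * dist x y" "\<And>x. x \<in> E \<Longrightarrow> F x = f x"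
proof -
  define F where "F x = Inf (insert 1 ((\<lambda>z. f z + L * dist x z) ` E))" for x
  have nn: "0 \<le> f z + L * dist x z" for x z using assms(1,2) by simp
  have bdd: "bdd_below (insert 1 ((\<lambda>z. f z + L * dist x z) ` E))" for x
    using nn by (intro bdd_belowI[of _ 0]) auto
  have F1: "F x \<le> 1" for x unfolding F_def by (intro cInf_lower bdd) simp
  have Fle: "F x \<le> f z + L * dist x z" if "z \<in> E" for x z
    unfolding F_def using that by (intro cInf_lower bdd) simp
  have Fge: "b \<le> F x" if "b \<le> 1" "\<And>z. z \<in> E \<Longrightarrow> b \<le> f z + L * dist x z" for b x
    unfolding F_def using that by (intro cInf_greatest) auto
  have *: "F x - L * dist x y \<le> F y" for x y
  proof (rule Fge)
    show "F x - L * dist x y \<le> 1" using F1[of x] mult_nonneg_nonneg[OF \<open>0 \<le> L\<close> zero_le_dist[of x y]] by linarith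
    fix z assume "z \<in> E"
    have "L * dist x z \<le> L * (dist x y + dist y z)" using \<open>0 \<le> L\<close> by (intro mult_left_mono dist_triangle)
    then show "F x - L * dist x y \<le> f z + L * dist y z" using Fle[OF \<open>z \<in> E\<close>, of x] by (simp add: distrib_left)
  qed
  show thesis
  proof
    show "0 \<le> F x" for x by (rule Fge) (use nn in auto)
    show "F x \<le> 1" for x by (rule F1)
    show "\<bar>F x - F y\<bar> \<le> L * dist x y" for x y using *[of x y] *[of y x] by (simp add: dist_commute abs_le_iff)
    show "F x = f x" if "x \<in> E" for x
    proof (rule antisym)
      show "F x \<le> f x" using Fle[OF that, of x] by simp
      show "f x \<le> F x"
      proof (rule Fge)
        show "f x \<le> f z + L * dist x z" if "z \<in> E" for z using L[OF \<open>x \<in> E\<close> that] by simp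
      qed (rule assms)
    qed
  qed
qed

text \<open>Refining the mesh and increasing the weight both raise the chain infima. A supremum of
  continuous functions has open superlevel sets, which capacity needs and which a direct infimum
  over curves would not provide.\<close>

definition potential :: "(nat \<Rightarrow> 'a::metric_space \<Rightarrow> real) \<Rightarrow> 'a set \<Rightarrow> 'a \<Rightarrow> real" where
  "potential W E x = (SUP n. chain_inf 1 (W n) (1 / real (Suc n)) E x)"

section \<open>The potential as an increasing limit of chain infima\<close>

context
  fixes W :: "nat \<Rightarrow> 'a::metric_space \<Rightarrow> real" and E :: "'a set"
  assumes W: "weight_seq W"
begin

lemma chain_inf_le_potential: "chain_inf 1 (W n) (1 / real (Suc n)) E x \<le> potential W E x"
  unfolding potential_def using chain_inf_le_N[OF weight_seqD(2)[OF W]]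
  by (intro cSUP_upper) (auto intro!: bdd_aboveI[of _ 1])

lemma potential_bounds: "0 \<le> potential W E x" "potential W E x \<le> 1"
proof -
  show "0 \<le> potential W E x"
    by (rule order_trans[OF chain_inf_nonneg[of "W 0" 1 "1 / real (Suc 0)" E x] chain_inf_le_potential])
      (auto simp: weight_seqD(2)[OF W])
  show "potential W E x \<le> 1"
    unfolding potential_def using chain_inf_le_N[OF weight_seqD(2)[OF W]] by (intro cSUP_least) auto
qed

lemma potential_eq_0: "x \<in> E \<Longrightarrow> potential W E x = 0"
  unfolding potential_def by (simp add: chain_inf_eq_0 weight_seqD(2)[OF W])

lemma chain_inf_tendsto_potential:
  "(\<lambda>n. chain_inf 1 (W n) (1 / real (Suc n)) E x) \<longlonglongrightarrow> potential W E x"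
  unfolding potential_def
proof (rule LIMSEQ_incseq_SUP)
  show "bdd_above (range (\<lambda>n. chain_inf 1 (W n) (1 / real (Suc n)) E x))"
    using chain_inf_le_N[OF weight_seqD(2)[OF W]] by (auto intro!: bdd_aboveI[of _ 1])
  show "incseq (\<lambda>n. chain_inf 1 (W n) (1 / real (Suc n)) E x)"
    using weight_seqD[OF W] by (intro incseq_SucI chain_inf_mono) (auto simp: field_simps)
qed

lemma open_potential_gt: "open {x. s < potential W E x}"
proof -
  have "{x. s < potential W E x} = (\<Union>n. {x. s < chain_inf 1 (W n) (1 / real (Suc n)) E x})"
  proof (intro equalityI subsetI)
    fix x assume "x \<in> {x. s < potential W E x}"
    then have "s < potential W E x" by simp
    from order_tendstoD(1)[OF chain_inf_tendsto_potential this]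
    show "x \<in> (\<Union>n. {x. s < chain_inf 1 (W n) (1 / real (Suc n)) E x})"
      unfolding eventually_sequentially by blast
  next
    fix x assume "x \<in> (\<Union>n. {x. s < chain_inf 1 (W n) (1 / real (Suc n)) E x})"
    then show "x \<in> {x. s < potential W E x}" using chain_inf_le_potential[of _ x] less_le_trans by blast
  qed
  also have "open \<dots>"
    using weight_seqD[OF W] by (intro open_UN ballI open_Collect_less continuous_on_const continuous_on_chain_inf) auto
  finally show ?thesis .
qed

lemma borel_measurable_potential: "potential W E \<in> borel_measurable borel"
  by (rule borel_measurableI_greater) (use open_potential_gt in \<open>auto intro!: borel_open\<close>)

lemma potential_gradient_interval:
  fixes \<gamma> :: "real \<Rightarrow> 'a"
  assumes "a \<le> b" and \<gamma>: "1-lipschitz_on {a..b} \<gamma>"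
  shows "ennreal \<bar>potential W E (\<gamma> a) - potential W E (\<gamma> b)\<bar> \<le> (\<integral>\<^sup>+ t\<in>{a..b}. weight W (\<gamma> t) \<partial>lborel)"
proof (cases "(\<integral>\<^sup>+ t\<in>{a..b}. weight W (\<gamma> t) \<partial>lborel)")
  case (real r)
  define v where "v n x = chain_inf 1 (W n) (1 / real (Suc n)) E x" for n x
  have "\<bar>v n (\<gamma> a) - v n (\<gamma> b)\<bar> \<le> r" for n
  proof -
    have "ennreal \<bar>v n (\<gamma> a) - v n (\<gamma> b)\<bar> \<le> (\<integral>\<^sup>+ t\<in>{a..b}. ennreal (W n (\<gamma> t)) \<partial>lborel)"
      unfolding v_def using weight_seqD[OF W] by (intro chain_inf_gradient assms) auto
    also have "\<dots> \<le> (\<integral>\<^sup>+ t\<in>{a..b}. weight W (\<gamma> t) \<partial>lborel)"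
      by (intro nn_integral_mono mult_right_mono weight_upper) auto
    finally show ?thesis using real by simp
  qed
  moreover have "(\<lambda>n. \<bar>v n (\<gamma> a) - v n (\<gamma> b)\<bar>) \<longlonglongrightarrow> \<bar>potential W E (\<gamma> a) - potential W E (\<gamma> b)\<bar>"
    unfolding v_def by (intro tendsto_intros chain_inf_tendsto_potential)
  ultimately have "\<bar>potential W E (\<gamma> a) - potential W E (\<gamma> b)\<bar> \<le> r"
    by (intro LIMSEQ_le_const2) auto
  then show ?thesis using real by (simp add: ennreal_leI)
qed simp

text \<open>The gradient may be cut off on \<open>E\<close>: a curve meeting \<open>E\<close> is only tracked up to its first and
  from its last visit to \<open>E\<close>, where the potential vanishes.\<close>

lemma potential_gradient:
  assumes "closed E" and \<gamma>: "arc_curve \<gamma> l"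
  shows "ennreal \<bar>potential W E (\<gamma> 0) - potential W E (\<gamma> l)\<bar> \<le> curve_integral (\<lambda>x. weight W x * indicator (- E) x) \<gamma> l"
proof -
  note lip = arc_curve_lipschitz[OF \<gamma>]
  have l: "0 < l" by (rule arc_curve_pos[OF \<gamma>])
  define I where "I = curve_integral (\<lambda>x. weight W x * indicator (- E) x) \<gamma> l"
  define Z where "Z = {0..l} \<inter> \<gamma> -` E"
  have sub: "(\<integral>\<^sup>+ t\<in>{a..b}. weight W (\<gamma> t) \<partial>lborel) \<le> I"
    if "0 \<le> a" "b \<le> l" "\<And>t. a < t \<Longrightarrow> t < b \<Longrightarrow> \<gamma> t \<notin> E" for a b
    unfolding I_def curve_integral_def
  proof (rule nn_integral_mono_AE)
    \<comment> \<open>The endpoints may lie in \<open>E\<close>, where the cut-off weight vanishes;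
      two points are null.\<close>
    show "AE t in lborel. weight W (\<gamma> t) * indicator {a..b} t \<le> weight W (\<gamma> t) * indicator (- E) (\<gamma> t) * indicator {0..l} t"
      using AE_lborel_singleton[of a] AE_lborel_singleton[of b]
      by eventually_elim (use that in \<open>auto simp: indicator_def\<close>)
  qed
  show ?thesis
  proof (cases "Z = {}")
    case True
    then have "\<gamma> t \<notin> E" if "t \<in> {0..l}" for t using that unfolding Z_def by auto
    then have "(\<integral>\<^sup>+ t\<in>{0..l}. weight W (\<gamma> t) \<partial>lborel) \<le> I" by (intro sub) auto
    then show ?thesis using potential_gradient_interval[OF _ lip] l unfolding I_def by (meson less_imp_le order_trans)
  next
    case False
    have "closed Z" unfolding Z_def
      using \<gamma> \<open>closed E\<close> by (intro continuous_closed_preimage) (auto simp: arc_curve_def)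
    then have "compact ({0..l} \<inter> Z)" by (intro compact_Int_closed compact_Icc)
    moreover have "{0..l} \<inter> Z = Z" unfolding Z_def by auto
    ultimately have Zc: "compact Z" by simp
    obtain a where a: "a \<in> Z" "\<And>t. t \<in> Z \<Longrightarrow> a \<le> t" using compact_attains_inf[OF Zc False] by blast
    obtain b where b: "b \<in> Z" "\<And>t. t \<in> Z \<Longrightarrow> t \<le> b" using compact_attains_sup[OF Zc False] by blast
    have ab: "0 \<le> a" "b \<le> l" "a \<le> l" "0 \<le> b" "\<gamma> a \<in> E" "\<gamma> b \<in> E" using a(1) b(1) unfolding Z_def by auto
    have "ennreal \<bar>potential W E (\<gamma> 0) - potential W E (\<gamma> a)\<bar> \<le> I"
    proof (rule order_trans[OF potential_gradient_interval sub])
      show "\<gamma> t \<notin> E" if "0 < t" "t < a" for t using a(2)[of t] that ab unfolding Z_def by auto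
    qed (use ab in \<open>auto intro: lipschitz_on_subset[OF lip]\<close>)
    then have 1: "ennreal (potential W E (\<gamma> 0)) \<le> I" using potential_eq_0[OF ab(5)] potential_bounds by simp
    have "ennreal \<bar>potential W E (\<gamma> b) - potential W E (\<gamma> l)\<bar> \<le> I"
    proof (rule order_trans[OF potential_gradient_interval sub])
      show "\<gamma> t \<notin> E" if "b < t" "t < l" for t using b(2)[of t] that ab unfolding Z_def by auto
    qed (use ab in \<open>auto intro: lipschitz_on_subset[OF lip]\<close>)
    then have 2: "ennreal (potential W E (\<gamma> l)) \<le> I" using potential_eq_0[OF ab(6)] potential_bounds by simp
    \<comment> \<open>Nonnegative numbers differ by at most the larger one, so only one of the two
      pieces has to be paid for.\<close>
    have "\<bar>potential W E (\<gamma> 0) - potential W E (\<gamma> l)\<bar> \<le> max (potential W E (\<gamma> 0)) (potential W E (\<gamma> l))"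
      using potential_bounds(1)[of "\<gamma> 0"] potential_bounds(1)[of "\<gamma> l"] by auto
    then have "ennreal \<bar>potential W E (\<gamma> 0) - potential W E (\<gamma> l)\<bar> \<le> ennreal (max (potential W E (\<gamma> 0)) (potential W E (\<gamma> l)))"
      by (rule ennreal_leI)
    also have "\<dots> \<le> I" using 1 2 by (auto simp: max_def)
    finally show ?thesis unfolding I_def .
  qed
qed

end

section \<open>Distance between the path potential and a Lipschitz extension\<close>

lemma weight_root_weight_add:
  assumes "0 \<le> L"
  shows "weight (root_weight h p (1 + L)) x = weight (root_weight h p 1) x + ennreal L"
proof -
  have "root_weight h p (1 + L) n x = root_weight h p 1 n x + L" for n by (simp add: root_weight_def)
  then have "weight (root_weight h p (1 + L)) x = (SUP n. ennreal (root_weight h p 1 n x) + ennreal L)"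
    unfolding weight_def using assms by (simp add: root_weight_def add.assoc)
  also have "\<dots> = weight (root_weight h p 1) x + ennreal L"
    unfolding weight_def by (rule ennreal_SUP_add_left) simp
  finally show ?thesis .
qed

lemma curve_integral_add_const:
  fixes \<gamma> :: "real \<Rightarrow> 'a::metric_space"
  assumes "continuous_on {0..T} \<gamma>" "w \<in> borel_measurable borel" "0 \<le> T" "0 \<le> L"
  shows "curve_integral (\<lambda>x. w x + ennreal L) \<gamma> T = curve_integral w \<gamma> T + ennreal (L * T)"
proof -
  have "curve_integral (\<lambda>x. w x + ennreal L) \<gamma> T = (\<integral>\<^sup>+ t. w (\<gamma> t) * indicator {0..T} t + ennreal L * indicator {0..T} t \<partial>lborel)"
    unfolding curve_integral_def by (intro nn_integral_cong) (auto simp: indicator_def)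
  also have "\<dots> = curve_integral w \<gamma> T + ennreal (L * T)"
    unfolding curve_integral_def using curve_integral_measurable[OF assms(1,2)] assms
    by (subst nn_integral_add) (auto simp: nn_integral_cmult_indicator ennreal_mult)
  finally show ?thesis .
qed

text \<open>When the potential is below 1 it is realized by a curve from \<open>x\<close> to
  \<open>E\<close>. Along it \<open>f\<close> changes by at most the integral of \<open>w\<close>
  and \<open>F\<close> by at most \<open>L\<close> times the duration, and the two agree at the end
  in \<open>E\<close>; this is why \<open>L\<close> is added to the weight. When it is 1, the
  trivial bound suffices.\<close>

lemma diff_le_potential:
  fixes f F :: "'a::complete_space \<Rightarrow> real"
  assumes proper: "\<And>y r. compact (cball (y :: 'a) r)" and h: "weight_seq h" and "0 < p" "closed E" "0 \<le> L"
    and f: "\<And>\<gamma> T. 0 \<le> T \<Longrightarrow> 1-lipschitz_on {0..T} \<gamma> \<Longrightarrow>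
      ennreal \<bar>f (\<gamma> 0) - f (\<gamma> T)\<bar> \<le> curve_integral (weight (root_weight h p 1)) \<gamma> T"
    and F: "\<And>x y. \<bar>F x - F y\<bar> \<le> L * dist x y" "\<And>x. x \<in> E \<Longrightarrow> F x = f x" "\<bar>f x - F x\<bar> \<le> 1"
  shows "\<bar>f x - F x\<bar> \<le> potential (root_weight h p (1 + L)) E x"
proof (cases "potential (root_weight h p (1 + L)) E x < 1")
  case True
  define W where "W = root_weight h p (1 + L)"
  have W: "weight_seq W" unfolding W_def using assms by (intro weight_seq_root_weight) auto
  have W1: "1 \<le> W n y" for n y unfolding W_def root_weight_def using \<open>0 \<le> L\<close> by simp
  define a where "a = potential W E x"
  have "chain_inf 1 (W n) (1 / real (Suc n)) E x \<le> a" for n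
    unfolding a_def by (rule chain_inf_le_potential[OF W])
  moreover have "a < 1" using True unfolding a_def W_def .
  ultimately have "\<exists>\<gamma> T. 0 \<le> T \<and> 1-lipschitz_on {0..T} \<gamma> \<and> \<gamma> 0 = x \<and> \<gamma> T \<in> E \<and>
      curve_integral (weight W) \<gamma> T \<le> ennreal a"
    by (metis chains_limit_curve[OF proper W W1 \<open>closed E\<close>] zero_le_one)
  then obtain \<gamma> T where \<gamma>: "0 \<le> T" "1-lipschitz_on {0..T} \<gamma>" "\<gamma> 0 = x" "\<gamma> T \<in> E"
      "curve_integral (weight W) \<gamma> T \<le> ennreal a"
    by blast
  have "ennreal \<bar>f x - F x\<bar> \<le> ennreal (\<bar>f (\<gamma> 0) - f (\<gamma> T)\<bar> + L * T)"
  proof (rule ennreal_leI)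
    have "dist (\<gamma> 0) (\<gamma> T) \<le> T" using lipschitz_onD[OF \<gamma>(2), of 0 T] \<gamma>(1) by (simp add: dist_real_def)
    then have "L * dist (\<gamma> 0) (\<gamma> T) \<le> L * T" using \<open>0 \<le> L\<close> by (rule mult_left_mono)
    then show "\<bar>f x - F x\<bar> \<le> \<bar>f (\<gamma> 0) - f (\<gamma> T)\<bar> + L * T"
      using F(1)[of "\<gamma> 0" "\<gamma> T"] F(2)[OF \<gamma>(4)] \<gamma>(3) by auto
  qed
  also have "\<dots> = ennreal \<bar>f (\<gamma> 0) - f (\<gamma> T)\<bar> + ennreal (L * T)" using \<gamma>(1) \<open>0 \<le> L\<close> by simp
  also have "\<dots> \<le> curve_integral (weight (root_weight h p 1)) \<gamma> T + ennreal (L * T)"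
    by (intro add_right_mono f \<gamma>)
  also have "\<dots> = curve_integral (\<lambda>x. weight (root_weight h p 1) x + ennreal L) \<gamma> T"
    using \<gamma> assms
    by (intro curve_integral_add_const[symmetric] borel_measurable_weight weight_seq_root_weight) (auto intro: lipschitz_on_continuous_on)
  also have "\<dots> = curve_integral (weight W) \<gamma> T"
    unfolding W_def curve_integral_def by (simp add: weight_root_weight_add[OF \<open>0 \<le> L\<close>])
  also note \<gamma>(5)
  finally show ?thesis using potential_bounds(1)[OF W] unfolding a_def W_def by simp
next
  case False
  then show ?thesis using F(3) by simp
qed

text \<open>\<open>f\<close> enters only through the bound by \<open>v\<close>: it will be an
  infimum over curves, whose measurability is not clear beforehand. All capacity estimates are made
  for \<open>v\<close>.\<close>

definition approximation :: "real \<Rightarrow> 'a::metric_space measure \<Rightarrow> ('a \<Rightarrow> real) \<Rightarrow> real \<Rightarrow>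
    ('a \<Rightarrow> real) \<Rightarrow> ('a \<Rightarrow> real) \<Rightarrow> ('a \<Rightarrow> ennreal) \<Rightarrow> bool" where
  "approximation p M f \<eta> F v g \<longleftrightarrow> continuous_on UNIV F \<and> v \<in> borel_measurable borel \<and>
    (\<forall>x. 0 \<le> v x) \<and> (\<forall>s. open {x. s < v x}) \<and> (\<forall>x. \<bar>f x - F x\<bar> \<le> v x) \<and> g \<in> borel_measurable borel \<and>
    (\<forall>\<gamma> l. arc_curve \<gamma> l \<longrightarrow> ennreal \<bar>v (\<gamma> 0) - v (\<gamma> l)\<bar> \<le> curve_integral g \<gamma> l) \<and>
    (\<integral>\<^sup>+ x. epowr (ennreal (v x)) p \<partial>M) + (\<integral>\<^sup>+ x. epowr (g x) p \<partial>M) \<le> ennreal \<eta>"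

text \<open>The energy of \<open>v\<close> lives on the open set \<open>V\<close> of high averages.
  The constant part of the weight there contributes \<open>(1 + L) powr p\<close> times the measure
  of \<open>V\<close>, which is comparable to \<open>k\<close> times that measure; the level
  \<open>k\<close> is chosen to make exactly this small.\<close>

lemma (in complete_doubling_space) ex_approximation_path_pot:
  assumes p: "1 \<le> p" and poin: "poincare_inequality p M" and h: "weight_seq h"
    and fin: "(\<integral>\<^sup>+ x. weight h x \<partial>M) < \<infinity>"
    and "0 < \<eta>"
  shows "\<exists>F v g. approximation p M (path_pot (weight (root_weight h p 1)) U) \<eta> F v g"
proof -
  define f where "f = path_pot (weight (root_weight h p 1)) U"
  obtain C where C: "0 < C" and conn:
    "\<And>k x y. 1 \<le> k \<Longrightarrow> x \<notin> high_average (weight h) k \<Longrightarrow> y \<notin> high_average (weight h) k \<Longrightarrow>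
      \<exists>\<gamma> T. 0 \<le> T \<and> 1-lipschitz_on {0..T} \<gamma> \<and> \<gamma> 0 = x \<and> \<gamma> T = y \<and>
        curve_integral (weight (root_weight h p 1)) \<gamma> T \<le> ennreal (C * k powr (1 / p) * dist x y)"
    using connecting_curve[OF p poin h] by blast
  have w1: "weight (root_weight h p 1) \<in> borel_measurable borel"
    using p by (intro borel_measurable_weight weight_seq_root_weight h) auto
  have hM [measurable]: "weight h \<in> borel_measurable M" by (intro measurable_from_borel borel_measurable_weight h)
  \<comment> \<open>The three summands, once multiplied out, match the integral of \<open>v\<close>
    to the power \<open>p\<close>, the integral of \<open>h\<close> over \<open>V\<close>, and the
    constant part of the weight on \<open>V\<close>.\<close>
  define B where "B = 1 + 2 powr p * (1 + (1 + C) powr p)"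
  have B: "0 < B" unfolding B_def by (simp add: add_pos_nonneg)
  obtain k where k: "1 \<le> k" "ennreal k * emeasure M (high_average (weight h) k) \<le> ennreal (\<eta> / B)"
    "(\<integral>\<^sup>+ x\<in>high_average (weight h) k. weight h x \<partial>M) \<le> ennreal (\<eta> / B)"
    using high_average_small[OF hM fin, of "\<eta> / B"] \<open>0 < \<eta>\<close> B by auto
  define V where "V = high_average (weight h) k"
  have V: "open V" unfolding V_def by (rule open_high_average)
  have VM [measurable]: "V \<in> sets M" using V by (rule open_in_sets)
  define L where "L = C * k powr (1 / p)"
  have L: "0 \<le> L" unfolding L_def using C by simp
  have "\<bar>f x - f y\<bar> \<le> L * dist x y" if xy: "x \<in> - V" "y \<in> - V" for x y
  proof -
    obtain \<gamma> T where \<gamma>: "0 \<le> T" "1-lipschitz_on {0..T} \<gamma>" "\<gamma> 0 = x" "\<gamma> T = y"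
        "curve_integral (weight (root_weight h p 1)) \<gamma> T \<le> ennreal (L * dist x y)"
      using conn[OF k(1)] xy unfolding V_def L_def by (meson ComplD)
    have "ennreal \<bar>f (\<gamma> 0) - f (\<gamma> T)\<bar> \<le> ennreal (L * dist x y)"
      unfolding f_def by (rule order_trans[OF path_pot_gradient[OF \<gamma>(1,2) w1] \<gamma>(5)])
    then show ?thesis using \<gamma> L by (subst (asm) ennreal_le_iff) auto
  qed
  then obtain F where F: "\<And>x. 0 \<le> F x" "\<And>x. F x \<le> 1" "\<And>x y. \<bar>F x - F y\<bar> \<le> L * dist x y" "\<And>x. x \<in> - V \<Longrightarrow> F x = f x"
    using mcshane_extension[of L f "- V"] L path_pot_bounds[of "weight (root_weight h p 1)" U] unfolding f_def by metis
  define W where "W = root_weight h p (1 + L)"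
  have W: "weight_seq W" unfolding W_def using h p L by (intro weight_seq_root_weight) auto
  define v where "v = potential W (- V)"
  define g where "g x = weight W x * indicator V x" for x
  have g: "g \<in> borel_measurable borel"
    unfolding g_def using borel_measurable_weight[OF W] V by (intro borel_measurable_times_ennreal borel_measurable_indicator) auto
  have "continuous_on UNIV F"
  proof -
    have "L-lipschitz_on UNIV F" using F(3) L by (intro lipschitz_onI) (auto simp: dist_real_def)
    then show ?thesis by (rule lipschitz_on_continuous_on)
  qed
  moreover have "v \<in> borel_measurable borel" unfolding v_def by (rule borel_measurable_potential[OF W])
  moreover have "0 \<le> v x" for x unfolding v_def by (rule potential_bounds[OF W])
  moreover have "open {x. s < v x}" for s unfolding v_def by (rule open_potential_gt[OF W])
  moreover have "\<bar>f x - F x\<bar> \<le> v x" for x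
    unfolding v_def W_def
  proof (rule diff_le_potential[OF compact_cball h])
    show "ennreal \<bar>f (\<gamma> 0) - f (\<gamma> T)\<bar> \<le> curve_integral (weight (root_weight h p 1)) \<gamma> T"
      if "0 \<le> T" "1-lipschitz_on {0..T} \<gamma>" for \<gamma> T
      unfolding f_def by (rule path_pot_gradient[OF that w1])
    show "\<bar>f x - F x\<bar> \<le> 1"
      using F(1,2)[of x] path_pot_bounds[of "weight (root_weight h p 1)" U x] unfolding f_def by auto
  qed (use p V L F in auto)
  moreover have "ennreal \<bar>v (\<gamma> 0) - v (\<gamma> l)\<bar> \<le> curve_integral g \<gamma> l" if "arc_curve \<gamma> l" for \<gamma> l
    using potential_gradient[OF W _ that, of "- V"] V unfolding v_def g_def by (simp add: closed_Compl)
  moreover have "(\<integral>\<^sup>+ x. epowr (ennreal (v x)) p \<partial>M) + (\<integral>\<^sup>+ x. epowr (g x) p \<partial>M) \<le> ennreal \<eta>"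
  proof -
    have "(\<integral>\<^sup>+ x. epowr (ennreal (v x)) p \<partial>M) \<le> (\<integral>\<^sup>+ x. indicator V x \<partial>M)"
    proof (rule nn_integral_mono)
      fix x
      \<comment> \<open>\<open>v\<close> is at most 1 and vanishes off \<open>V\<close>.\<close>
      show "epowr (ennreal (v x)) p \<le> indicator V x"
      proof (cases "x \<in> V")
        case True
        have "v x powr p \<le> 1 powr p"
          unfolding v_def using potential_bounds[OF W, of "- V" x] p by (intro powr_mono2) auto
        then show ?thesis using True potential_bounds(1)[OF W, of "- V" x] by (simp add: epowr_ennreal v_def)
      next
        case False
        then show ?thesis unfolding v_def using potential_eq_0[OF W, of x "- V"] by simp
      qed
    qed
    also have "\<dots> = 1 * emeasure M V" by simp
    also have "\<dots> \<le> ennreal k * emeasure M V"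
      using mult_right_mono[of 1 "ennreal k" "emeasure M V"] k(1) by simp
    also have "\<dots> \<le> ennreal (\<eta> / B)" using k(2) unfolding V_def .
    finally have 1: "(\<integral>\<^sup>+ x. epowr (ennreal (v x)) p \<partial>M) \<le> ennreal (\<eta> / B)" .
    \<comment> \<open>\<open>k \<ge> 1\<close> allows the summand 1 to be absorbed into the multiple
      of \<open>k powr (1 / p)\<close>.\<close>
    have Lp: "(1 + L) powr p \<le> (1 + C) powr p * k"
    proof -
      have "1 \<le> k powr (1 / p)" using k(1) p by (intro ge_one_powr_ge_zero) auto
      then have "1 + L \<le> (1 + C) * k powr (1 / p)" unfolding L_def by (simp add: distrib_right)
      then have "(1 + L) powr p \<le> ((1 + C) * k powr (1 / p)) powr p" using L p by (intro powr_mono2) auto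
      also have "\<dots> = (1 + C) powr p * k" using C k(1) p by (simp add: powr_mult powr_powr)
      finally show ?thesis .
    qed
    have "(\<integral>\<^sup>+ x. epowr (g x) p \<partial>M) \<le>
        (\<integral>\<^sup>+ x. ennreal (2 powr p) * (weight h x * indicator V x + ennreal ((1 + C) powr p * k) * indicator V x) \<partial>M)"
    proof (rule nn_integral_mono)
      fix x
      have "epowr (weight W x) p \<le> ennreal (2 powr p) * (weight h x + ennreal ((1 + L) powr p))"
        unfolding W_def using p L by (intro epowr_weight_root_weight_le h) auto
      also have "\<dots> \<le> ennreal (2 powr p) * (weight h x + ennreal ((1 + C) powr p * k))"
        by (intro mult_left_mono add_left_mono ennreal_leI Lp) auto
      finally show "epowr (g x) p \<le> ennreal (2 powr p) * (weight h x * indicator V x + ennreal ((1 + C) powr p * k) * indicator V x)"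
        unfolding g_def by (simp add: indicator_def)
    qed
    also have "\<dots> = ennreal (2 powr p) * ((\<integral>\<^sup>+ x\<in>V. weight h x \<partial>M) + ennreal ((1 + C) powr p * k) * emeasure M V)"
      by (subst nn_integral_cmult) (auto simp: nn_integral_add nn_integral_cmult_indicator)
    also have "\<dots> \<le> ennreal (2 powr p) * (ennreal (\<eta> / B) + ennreal ((1 + C) powr p) * ennreal (\<eta> / B))"
    proof (intro mult_left_mono add_mono)
      show "(\<integral>\<^sup>+ x\<in>V. weight h x \<partial>M) \<le> ennreal (\<eta> / B)" using k(3) unfolding V_def .
      have "ennreal ((1 + C) powr p * k) * emeasure M V = ennreal ((1 + C) powr p) * (ennreal k * emeasure M V)"
        using k(1) by (simp add: ennreal_mult mult.assoc)
      also have "\<dots> \<le> ennreal ((1 + C) powr p) * ennreal (\<eta> / B)"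
        using k(2) unfolding V_def by (intro mult_left_mono) auto
      finally show "ennreal ((1 + C) powr p * k) * emeasure M V \<le> ennreal ((1 + C) powr p) * ennreal (\<eta> / B)" .
    qed simp
    also have "\<dots> = ennreal (2 powr p * (\<eta> / B + (1 + C) powr p * (\<eta> / B)))"
      using \<open>0 < \<eta>\<close> B by (simp add: ennreal_mult del: times_divide_eq_right)
    finally have 2: "(\<integral>\<^sup>+ x. epowr (g x) p \<partial>M) \<le> ennreal (2 powr p * (\<eta> / B + (1 + C) powr p * (\<eta> / B)))" .
    have "(\<integral>\<^sup>+ x. epowr (ennreal (v x)) p \<partial>M) + (\<integral>\<^sup>+ x. epowr (g x) p \<partial>M) \<le>
        ennreal (\<eta> / B) + ennreal (2 powr p * (\<eta> / B + (1 + C) powr p * (\<eta> / B)))"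
      by (rule add_mono[OF 1 2])
    also have "\<dots> = ennreal (\<eta> / B + 2 powr p * (\<eta> / B + (1 + C) powr p * (\<eta> / B)))"
      using \<open>0 < \<eta>\<close> B by (intro ennreal_plus[symmetric]) auto
    also have "\<eta> / B + 2 powr p * (\<eta> / B + (1 + C) powr p * (\<eta> / B)) = B * (\<eta> / B)"
      unfolding B_def by (simp add: algebra_simps del: times_divide_eq_right)
    also have "B * (\<eta> / B) = \<eta>" using B by simp
    finally show ?thesis .
  qed
  ultimately show ?thesis using g unfolding approximation_def f_def by blast
qed

section \<open>Capacity and quasiopen sets\<close>

context metric_measure_space begin

lemma capacity_le:
  fixes u :: "'a \<Rightarrow> real"
  assumes p: "1 \<le> p" and u: "u \<in> borel_measurable M" "\<And>x. 0 \<le> u x" "\<And>x. x \<in> G \<Longrightarrow> 1 \<le> u x"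
    and g: "upper_gradient g (\<lambda>x. ereal (u x))"
    and le: "(\<integral>\<^sup>+ x. epowr (ennreal (u x)) p \<partial>M) + (\<integral>\<^sup>+ x. epowr (g x) p \<partial>M) \<le> c" and "c < \<infinity>"
  shows "capacity p M G \<le> c"
proof -
  define A where "A = (\<integral>\<^sup>+ x. epowr (ennreal (u x)) p \<partial>M)"
  define I where "I = (INF g \<in> {g. upper_gradient g (\<lambda>x. ereal (u x))}. \<integral>\<^sup>+ x. epowr (g x) p \<partial>M)"
  have "I \<le> (\<integral>\<^sup>+ x. epowr (g x) p \<partial>M)" unfolding I_def by (rule INF_lower) (use g in simp)
  then have AI: "A + I \<le> c" using le unfolding A_def by (meson add_left_mono order_trans)
  have n: "newtonian_norm p M (\<lambda>x. ereal (u x)) = epowr (A + I) (1 / p)"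
    unfolding newtonian_norm_def A_def I_def using u(2) by simp
  have "A + I < \<infinity>" using AI \<open>c < \<infinity>\<close> by (rule le_less_trans)
  then have "newtonian_norm p M (\<lambda>x. ereal (u x)) < \<infinity>"
    unfolding n epowr_def by (auto simp: less_top)
  then have "(\<lambda>x. ereal (u x)) \<in> newtonian_space p M"
    unfolding newtonian_space_def using u(1) by simp
  then have "capacity p M G \<le> epowr (newtonian_norm p M (\<lambda>x. ereal (u x))) p"
    unfolding capacity_def using u(3) by (intro INF_lower) auto
  also have "\<dots> = A + I" unfolding n using p by (intro epowr_epowr_inverse) simp
  finally show ?thesis using AI by (rule order_trans)
qed

lemma emeasure_le_capacity:
  assumes p: "1 \<le> p" and G: "G \<in> sets M"
  shows "emeasure M G \<le> capacity p M G"
  unfolding capacity_def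
proof (rule INF_greatest)
  fix u assume u: "u \<in> {u \<in> newtonian_space p M. \<forall>x\<in>G. 1 \<le> u x}"
  have "emeasure M G = (\<integral>\<^sup>+ x. indicator G x \<partial>M)" using G by simp
  also have "\<dots> \<le> (\<integral>\<^sup>+ x. epowr (e2ennreal \<bar>u x\<bar>) p \<partial>M)"
  proof (rule nn_integral_mono)
    fix x
    show "indicator G x \<le> epowr (e2ennreal \<bar>u x\<bar>) p"
    proof (cases "x \<in> G")
      case True
      then have "1 \<le> u x" using u by auto
      then have "ereal 1 \<le> \<bar>u x\<bar>" by (cases "u x") auto
      then have "ennreal 1 \<le> e2ennreal \<bar>u x\<bar>" using e2ennreal_mono by fastforce
      then have "epowr (ennreal 1) p \<le> epowr (e2ennreal \<bar>u x\<bar>) p" using p by (intro epowr_mono) auto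
      then show ?thesis using True epowr_ennreal[of 1 p] by simp
    qed simp
  qed
  also have "\<dots> \<le> epowr (newtonian_norm p M u) p"
    unfolding newtonian_norm_def using p by (subst epowr_epowr_inverse) (auto simp: add_increasing2)
  finally show "emeasure M G \<le> epowr (newtonian_norm p M u) p" .
qed

text \<open>\<open>U\<close> differs from a countable intersection of open sets by a subset of
  \<open>N\<close>, which is null because capacity dominates measure; completeness of the measure
  does the rest.\<close>

lemma quasiopen_imp_measurable:
  assumes p: "1 \<le> p" and U: "quasiopen p M U"
  shows "U \<in> sets M"
proof -
  have "\<forall>n. \<exists>G. open G \<and> capacity p M G < ennreal (1 / real (Suc n)) \<and> open (G \<union> U)"
    using U unfolding quasiopen_def by simp
  then obtain G where G: "\<And>n. open (G n)" "\<And>n. capacity p M (G n) < ennreal (1 / real (Suc n))" "\<And>n. open (G n \<union> U)"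
    by metis
  have [measurable]: "G n \<in> sets M" "G n \<union> U \<in> sets M" for n
    using open_in_sets G by auto
  define N where "N = (\<Inter>n. G n)"
  define A where "A = (\<Inter>n. G n \<union> U)"
  have NM [measurable]: "N \<in> sets M" "A \<in> sets M" unfolding N_def A_def by measurable
  have le: "emeasure M N \<le> ennreal (1 / real (Suc n))" for n
  proof -
    have "emeasure M N \<le> emeasure M (G n)" unfolding N_def by (intro emeasure_mono) auto
    also have "\<dots> \<le> capacity p M (G n)" by (intro emeasure_le_capacity p) simp
    finally show ?thesis using G(2)[of n] by simp
  qed
  have "(\<lambda>n. ennreal (1 / real (Suc n))) \<longlonglongrightarrow> ennreal 0"
    by (intro tendsto_ennrealI LIMSEQ_Suc[OF lim_1_over_n])
  then have "emeasure M N \<le> ennreal 0" by (rule LIMSEQ_le_const) (use le in auto)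
  then have "N \<in> null_sets M" by (intro null_setsI) auto
  moreover have "A - U \<subseteq> N" unfolding A_def N_def by auto
  ultimately have "A - U \<in> sets M" using complete by blast
  moreover have "U = A - (A - U)" unfolding A_def by auto
  ultimately show ?thesis using NM(2) by (metis sets.Diff)
qed

text \<open>All exceptional sets are handled by a single test function \<open>u\<close> for their
  union \<open>G\<close>, in place of countable subadditivity of capacity. Off \<open>G\<close> the
  functions \<open>F j\<close> converge uniformly to \<open>f\<close>.\<close>

lemma approximation_imp_quasiopen:
  assumes p: "1 \<le> p" and f: "\<And>\<eta>. 0 < \<eta> \<Longrightarrow> \<exists>F v g. approximation p M f \<eta> F v g"
  shows "quasiopen p M {x. 0 < f x}"
  unfolding quasiopen_def
proof (intro allI impI)
  fix \<epsilon> :: real assume "0 < \<epsilon>"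
  \<comment> \<open>The last factor cancels the scaling by \<open>a j = 2 ^ j\<close> under the
    \<open>p\<close>-th power; what remains sums to \<open>\<epsilon> / 2\<close>, strictly below
    \<open>\<epsilon>\<close>.\<close>
  define \<eta> where "\<eta> j = \<epsilon> / 4 * (1 / 2) ^ j * (1 / 2 ^ j) powr p" for j :: nat
  have "0 < \<eta> j" for j unfolding \<eta>_def using \<open>0 < \<epsilon>\<close> by simp
  then have "\<forall>j. \<exists>F v g. approximation p M f (\<eta> j) F v g" using f by blast
  then obtain F v g where F: "\<And>j. continuous_on UNIV (F j)" and v: "\<And>j. v j \<in> borel_measurable borel"
    "\<And>j x. 0 \<le> v j x" "\<And>j s. open {x. s < v j x}" and Fv: "\<And>j x. \<bar>f x - F j x\<bar> \<le> v j x"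
    and g: "\<And>j. g j \<in> borel_measurable borel"
    "\<And>j \<gamma> l. arc_curve \<gamma> l \<Longrightarrow> ennreal \<bar>v j (\<gamma> 0) - v j (\<gamma> l)\<bar> \<le> curve_integral (g j) \<gamma> l"
    and small: "\<And>j. (\<integral>\<^sup>+ x. epowr (ennreal (v j x)) p \<partial>M) + (\<integral>\<^sup>+ x. epowr (g j x) p \<partial>M) \<le> ennreal (\<eta> j)"
    unfolding approximation_def by metis
  define a where "a j = (2 ^ j :: real)" for j :: nat
  have a: "0 < a j" for j unfolding a_def by simp
  define G where "G = (\<Union>j. {x. 1 / a j < v j x})"
  define u where "u x = (SUP j. min 1 (a j * v j x))" for x
  \<comment> \<open>An \<open>l^p\<close> sum dominates each of its terms, so \<open>q\<close>
    serves all scaled \<open>v j\<close> at once, and its \<open>p\<close>-th power is additive in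
    the energies. \<open>q'\<close> plays the same part for the values of \<open>u\<close>.\<close>
  define q where "q x = epowr (\<Sum>j. epowr (ennreal (a j) * g j x) p) (1 / p)" for x
  define q' where "q' x = epowr (\<Sum>j. epowr (ennreal (a j) * ennreal (v j x)) p) (1 / p)" for x
  have root_ge: "s i \<le> epowr (\<Sum>j. epowr (s j) p) (1 / p)" for s :: "nat \<Rightarrow> ennreal" and i
  proof -
    have "s i = epowr (epowr (s i) p) (1 / p)" using epowr_epowr_inverse[of "1 / p" "s i"] p by simp
    also have "\<dots> \<le> epowr (\<Sum>j. epowr (s j) p) (1 / p)"
      using sum_le_suminf[of "\<lambda>j. epowr (s j) p" "{i}"] p by (intro epowr_mono) auto
    finally show ?thesis .
  qed
  have bdd: "bdd_above (range (\<lambda>j. min 1 (a j * v j x)))" for x by (auto intro!: bdd_aboveI[of _ 1])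
  have u_ge: "min 1 (a j * v j x) \<le> u x" for j x unfolding u_def by (intro cSUP_upper bdd) simp
  have u_le: "u x \<le> b" if "\<And>j. min 1 (a j * v j x) \<le> b" for x b
    unfolding u_def using that by (intro cSUP_least) auto
  have u0: "0 \<le> u x" for x
    using order_trans[OF _ u_ge[of 0 x], of 0] a[of 0] v(2)[of 0 x] by simp
  have [measurable]: "v j \<in> borel_measurable M" "g j \<in> borel_measurable M" "g j \<in> borel_measurable borel" for j
    using v(1) g(1) by (auto intro: measurable_from_borel)
  have um: "u \<in> borel_measurable M"
    unfolding u_def by (intro borel_measurable_cSUP bdd) measurable
  have uG: "1 \<le> u x" if x: "x \<in> G" for x
  proof -
    obtain j where "1 / a j < v j x" using x unfolding G_def by auto
    then have "1 < a j * v j x" using a[of j] by (simp add: field_simps)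
    then show ?thesis using u_ge[of j x] by simp
  qed
  have uq: "ennreal (u x) \<le> q' x" for x
  proof (cases "q' x")
    case (real r)
    have "min 1 (a j * v j x) \<le> r" for j
    proof -
      have "ennreal (a j) * ennreal (v j x) \<le> q' x"
        unfolding q'_def by (rule root_ge[of "\<lambda>j. ennreal (a j) * ennreal (v j x)"])
      then have "ennreal (a j * v j x) \<le> ennreal r" using real a[of j] v(2)[of j x] by (simp add: ennreal_mult)
      then show ?thesis using real by (subst (asm) ennreal_le_iff) auto
    qed
    then have "u x \<le> r" by (rule u_le)
    then show ?thesis using real by (simp add: ennreal_leI)
  qed simp
  have ug: "upper_gradient q (\<lambda>x. ereal (u x))"
  proof (rule upper_gradient_realI)
    show "q \<in> borel_measurable borel" unfolding q_def by measurable
    fix \<gamma> :: "real \<Rightarrow> 'a" and l assume \<gamma>: "arc_curve \<gamma> l"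
    show "ennreal \<bar>u (\<gamma> 0) - u (\<gamma> l)\<bar> \<le> curve_integral q \<gamma> l"
    proof (cases "curve_integral q \<gamma> l")
      case (real r)
      have *: "a j * \<bar>v j (\<gamma> 0) - v j (\<gamma> l)\<bar> \<le> r" for j
      proof -
        have m: "(\<lambda>t. g j (\<gamma> t) * indicator {0..l} t) \<in> borel_measurable lborel"
          using \<gamma> g(1) by (intro curve_integral_measurable) (auto simp: arc_curve_def)
        have "ennreal (a j * \<bar>v j (\<gamma> 0) - v j (\<gamma> l)\<bar>) \<le> ennreal (a j) * curve_integral (g j) \<gamma> l"
          using g(2)[OF \<gamma>, of j] a[of j] by (simp add: ennreal_mult mult_left_mono)
        also have "\<dots> = (\<integral>\<^sup>+ t. ennreal (a j) * (g j (\<gamma> t) * indicator {0..l} t) \<partial>lborel)"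
          unfolding curve_integral_def by (rule nn_integral_cmult[symmetric, OF m])
        also have "\<dots> \<le> curve_integral q \<gamma> l"
          unfolding curve_integral_def q_def mult.assoc[symmetric]
          by (intro nn_integral_mono mult_right_mono root_ge[of "\<lambda>j. ennreal (a j) * g j _"]) auto
        finally show ?thesis using real by simp
      qed
      have **: "u x \<le> u y + r" if "\<And>j. a j * \<bar>v j x - v j y\<bar> \<le> r" for x y
      proof (rule u_le)
        fix j
        have "a j * (v j x - v j y) \<le> a j * \<bar>v j x - v j y\<bar>" using a[of j] by (intro mult_left_mono) auto
        then have "a j * v j x - a j * v j y \<le> r" using that[of j] unfolding right_diff_distrib by linarith
        then have "min 1 (a j * v j x) \<le> min 1 (a j * v j y) + r" using real(1) by (auto simp: min_def)
        then show "min 1 (a j * v j x) \<le> u y + r" using u_ge[of j y] by linarith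
      qed
      have "\<bar>u (\<gamma> 0) - u (\<gamma> l)\<bar> \<le> r"
        using **[of "\<gamma> 0" "\<gamma> l"] **[of "\<gamma> l" "\<gamma> 0"] * by (simp add: abs_le_iff abs_minus_commute)
      then show ?thesis using real by (simp add: ennreal_leI)
    qed simp
  qed
  have "(\<integral>\<^sup>+ x. epowr (ennreal (u x)) p \<partial>M) \<le> (\<integral>\<^sup>+ x. (\<Sum>j. epowr (ennreal (a j) * ennreal (v j x)) p) \<partial>M)"
  proof (rule nn_integral_mono)
    fix x
    have "epowr (ennreal (u x)) p \<le> epowr (q' x) p" using uq p by (intro epowr_mono) auto
    also have "\<dots> = (\<Sum>j. epowr (ennreal (a j) * ennreal (v j x)) p)"
      unfolding q'_def using p by (intro epowr_epowr_inverse) simp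
    finally show "epowr (ennreal (u x)) p \<le> (\<Sum>j. epowr (ennreal (a j) * ennreal (v j x)) p)" .
  qed
  also have "\<dots> = (\<Sum>j. ennreal (a j powr p) * (\<integral>\<^sup>+ x. epowr (ennreal (v j x)) p \<partial>M))"
    using a by (subst nn_integral_suminf) (auto simp: epowr_mult nn_integral_cmult)
  finally have 1: "(\<integral>\<^sup>+ x. epowr (ennreal (u x)) p \<partial>M) \<le> (\<Sum>j. ennreal (a j powr p) * (\<integral>\<^sup>+ x. epowr (ennreal (v j x)) p \<partial>M))" .
  have "(\<integral>\<^sup>+ x. epowr (q x) p \<partial>M) = (\<integral>\<^sup>+ x. (\<Sum>j. epowr (ennreal (a j) * g j x) p) \<partial>M)"
    unfolding q_def using p by (simp add: epowr_epowr_inverse)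
  also have "\<dots> = (\<Sum>j. ennreal (a j powr p) * (\<integral>\<^sup>+ x. epowr (g j x) p \<partial>M))"
    using a by (subst nn_integral_suminf) (auto simp: epowr_mult nn_integral_cmult)
  finally have 2: "(\<integral>\<^sup>+ x. epowr (q x) p \<partial>M) = (\<Sum>j. ennreal (a j powr p) * (\<integral>\<^sup>+ x. epowr (g j x) p \<partial>M))" .
  have "(\<integral>\<^sup>+ x. epowr (ennreal (u x)) p \<partial>M) + (\<integral>\<^sup>+ x. epowr (q x) p \<partial>M) \<le>
      (\<Sum>j. ennreal (a j powr p) * (\<integral>\<^sup>+ x. epowr (ennreal (v j x)) p \<partial>M) + ennreal (a j powr p) * (\<integral>\<^sup>+ x. epowr (g j x) p \<partial>M))"
    unfolding 2 by (subst suminf_add[symmetric]) (auto intro: add_right_mono 1)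
  also have "\<dots> \<le> (\<Sum>j. ennreal (\<epsilon> / 4 * (1 / 2) ^ j))"
  proof (intro suminf_le allI)
    fix j
    have "ennreal (a j powr p) * (\<integral>\<^sup>+ x. epowr (ennreal (v j x)) p \<partial>M) + ennreal (a j powr p) * (\<integral>\<^sup>+ x. epowr (g j x) p \<partial>M)
        \<le> ennreal (a j powr p) * ennreal (\<eta> j)"
      unfolding distrib_left[symmetric] by (intro mult_left_mono small) simp
    also have "\<dots> = ennreal (a j powr p * \<eta> j)" using \<open>0 < \<eta> j\<close> by (intro ennreal_mult[symmetric]) auto
    also have "a j powr p * \<eta> j = \<epsilon> / 4 * (1 / 2) ^ j"
    proof -
      have "a j powr p * (1 / 2 ^ j) powr p = 1"
        unfolding a_def by (subst powr_mult[symmetric]) auto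
      then show ?thesis unfolding \<eta>_def by (metis mult.commute mult.left_commute mult.right_neutral)
    qed
    finally show "ennreal (a j powr p) * (\<integral>\<^sup>+ x. epowr (ennreal (v j x)) p \<partial>M) + ennreal (a j powr p) * (\<integral>\<^sup>+ x. epowr (g j x) p \<partial>M)
        \<le> ennreal (\<epsilon> / 4 * (1 / 2) ^ j)" .
  qed auto
  also have "\<dots> = ennreal (\<Sum>j. \<epsilon> / 4 * (1 / 2) ^ j)"
    using \<open>0 < \<epsilon>\<close> by (intro suminf_ennreal2 summable_mult summable_geometric) auto
  also have "(\<Sum>j. \<epsilon> / 4 * (1 / 2 :: real) ^ j) = \<epsilon> / 2"
    by (subst suminf_mult) (auto simp: suminf_geometric)
  finally have "capacity p M G \<le> ennreal (\<epsilon> / 2)"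
    by (intro capacity_le[OF p um u0 uG ug]) auto
  also have "\<dots> < ennreal \<epsilon>" using \<open>0 < \<epsilon>\<close> by (simp add: ennreal_less_iff)
  finally have cap: "capacity p M G < ennreal \<epsilon>" .
  have opG: "open G" unfolding G_def using v(3) by auto
  have "open (G \<union> {x. 0 < f x})"
  proof (subst open_subopen, intro ballI)
    fix x assume x: "x \<in> G \<union> {x. 0 < f x}"
    show "\<exists>T. open T \<and> x \<in> T \<and> T \<subseteq> G \<union> {x. 0 < f x}"
    proof (cases "x \<in> G")
      case True
      then show ?thesis using opG by blast
    next
      case False
      then have fx: "0 < f x" using x by simp
      have vx: "v j y \<le> 1 / a j" if "y \<notin> G" for j y using that unfolding G_def by (auto simp: not_less)
      have "(\<lambda>j. 1 / a j) \<longlonglongrightarrow> 0" unfolding a_def by (rule LIMSEQ_divide_realpow_zero) simp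
      from order_tendstoD(2)[OF this, of "f x / 2"] fx obtain j where j: "1 / a j < f x / 2"
        unfolding eventually_sequentially by auto
      \<comment> \<open>Off \<open>G\<close> the error is at most \<open>1 / a j\<close>, so
        \<open>F j > 1 / a j\<close> forces \<open>f > 0\<close>; and \<open>x\<close> itself passes
        this test because \<open>f x\<close> exceeds \<open>2 / a j\<close>.\<close>
      define T where "T = {y. 1 / a j < F j y}"
      have "open T" unfolding T_def by (intro open_Collect_less continuous_on_const F)
      moreover have "x \<in> T"
        using Fv[of x j] vx[OF False, of j] j unfolding T_def by (simp add: abs_le_iff)
      moreover have "T \<subseteq> G \<union> {x. 0 < f x}"
      proof
        fix y assume "y \<in> T"
        show "y \<in> G \<union> {x. 0 < f x}"
        proof (cases "y \<in> G")
          case False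
          have "0 < f y" using Fv[of y j] vx[OF False, of j] \<open>y \<in> T\<close> unfolding T_def by (auto simp: abs_le_iff)
          then show ?thesis by simp
        qed simp
      qed
      ultimately show ?thesis by blast
    qed
  qed
  with opG cap show "\<exists>G. open G \<and> capacity p M G < ennreal \<epsilon> \<and> open (G \<union> {x. 0 < f x})" by blast
qed

end

theorem theorem1p1:
  fixes p :: real and M :: "'a::complete_space measure" and U :: "'a set"
  assumes "1 \<le> p"
    and "metric_measure_space M"
    and "doubling M"
    and "poincare_inequality p M"
    and "path_open p M U"
  shows "quasiopen p M U \<and> U \<in> sets M"
proof -
  interpret metric_measure_space M by fact
  obtain D where "doubling_space M D"
    using doubling_imp_doubling_space[OF assms(2,3)] by blast
  then interpret complete_doubling_space M D by (simp add: complete_doubling_space_def)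
  have p0: "0 < p" using assms(1) by simp
  obtain \<rho> where \<rho>: "\<rho> \<in> borel_measurable borel" "(\<integral>\<^sup>+ x. epowr (\<rho> x) p \<partial>M) < \<infinity>"
    and exc: "\<And>\<gamma> l. arc_curve \<gamma> l \<Longrightarrow> \<not> openin (top_of_set {0..l}) {t \<in> {0..l}. \<gamma> t \<in> U} \<Longrightarrow> curve_integral \<rho> \<gamma> l = \<infinity>"
    using assms(5) unfolding path_open_def ae_curve_def exceptional_def by auto
  obtain h where h: "\<And>n. continuous_on UNIV (h n)" "\<And>n x. 0 \<le> h n x" "\<And>x. incseq (\<lambda>n. h n x)"
    and fin: "(\<integral>\<^sup>+ x. (SUP n. ennreal (h n x)) \<partial>M) < \<infinity>"
    and \<rho>h: "\<And>x. \<rho> x \<le> ennreal (2 powr (1 / p)) * ((SUP n. ennreal (h n x powr (1 / p))) + 1)"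
    using vitali_caratheodory[OF \<rho> p0] by metis
  have hw: "weight_seq h" unfolding weight_seq_def using h by blast
  define W where "W = root_weight h p 1"
  have W: "weight_seq W" unfolding W_def using p0 by (intro weight_seq_root_weight hw) auto
  \<comment> \<open>The rounding error 1 of the majorant is exactly the constant that gives the
    weight its lower bound 1.\<close>
  have "(SUP n. ennreal (h n x powr (1 / p))) + 1 = weight W x" for x
    unfolding weight_def W_def root_weight_def
    by (subst ennreal_SUP_add_left[symmetric]) auto
  then have \<rho>W: "\<rho> x \<le> ennreal (2 powr (1 / p)) * weight W x" for x using \<rho>h[of x] by simp
  \<comment> \<open>Only finiteness of integrals matters for exceptional curves, so the factor
    \<open>2 powr (1 / p)\<close> is harmless.\<close>
  have po: "openin (top_of_set {0..l}) {t \<in> {0..l}. \<gamma> t \<in> U}"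
    if \<gamma>: "arc_curve \<gamma> l" and Wf: "curve_integral (weight W) \<gamma> l < \<infinity>" for \<gamma> l
  proof (rule ccontr)
    assume "\<not> ?thesis"
    then have "\<infinity> = curve_integral \<rho> \<gamma> l" using exc[OF \<gamma>] by simp
    also have "\<dots> \<le> (\<integral>\<^sup>+ t. ennreal (2 powr (1 / p)) * (weight W (\<gamma> t) * indicator {0..l} t) \<partial>lborel)"
      unfolding curve_integral_def using \<rho>W by (intro nn_integral_mono) (auto simp: indicator_def)
    also have "\<dots> = ennreal (2 powr (1 / p)) * curve_integral (weight W) \<gamma> l"
      unfolding curve_integral_def using \<gamma>
      by (intro nn_integral_cmult curve_integral_measurable borel_measurable_weight W) (auto simp: arc_curve_def)
    also have "\<dots> < \<infinity>" using Wf by (simp add: ennreal_mult_less_top)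
    finally show False by simp
  qed
  have "U = {x. 0 < path_pot (weight W) U x}"
  proof (intro equalityI subsetI CollectI)
    show "0 < path_pot (weight W) U x" if "x \<in> U" for x
      by (rule path_pot_pos[OF W _ po that]) (auto simp: W_def root_weight_def)
    show "x \<in> U" if "x \<in> {x. 0 < path_pot (weight W) U x}" for x
      using that path_pot_outside[of x U "weight W"] by auto
  qed
  moreover have "\<exists>F v g. approximation p M (path_pot (weight W) U) \<eta> F v g" if "0 < \<eta>" for \<eta>
    unfolding W_def using fin that by (intro ex_approximation_path_pot assms hw) (simp_all add: weight_def)
  ultimately have "quasiopen p M U" using approximation_imp_quasiopen[OF assms(1)] by metis
  then show ?thesis using quasiopen_imp_measurable[OF assms(1)] by blast
qed

end
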